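(* Assume that $g_\theta$ and $g_\kappa$ both have radius of convergence $R>0$ and are holomorphic in some domain $\Delta_0$, that $g_\kappa^{\{1\}}(R)=1$, and that for some $\theta^*\ge0$, $\delta>0$, $s\in(1,2)$, $a_s>0$, as $z\to R$, $z\in\Delta_0$, $$g_\theta(z)=-\theta^*\log(1-z/R)+O((1-z/R)^\delta),\qquad g_\kappa(z)=g_\kappa(R)-(1-z/R)+a_s(1-z/R)^s+O((1-z/R)^{s+\delta}).$$ Let $f:\Delta_0\to\mathbb C$ be holomorphic with $f(z)=1+O((1-z/R)^\delta)$ as $z\to R$, $z\in\Delta_0$. Then for any $u\ge0$, as $N\to\infty$, $$[z^N]\big[f(z)\exp\{e^{-u/\sqrt N}G_N(z)\}\big]\sim\frac{\exp\{Ng_\kappa(R)-\sqrt N\,u\,g_\kappa(R)+\tfrac12u^2g_\kappa(R)\}}{R^N}\cdot\frac{(Na_s)^{(\theta^*-1)/s}}{s\,\Gamma\big(\frac{s-1+\theta^*}{s}\big)}.$$ In particular, $H_N\sim\dfrac{\exp\{Ng_\kappa(R)\}\cdot(Na_s)^{(\theta^*-1)/s}}{sR^N\,\Gamma\big(\frac{s-1+\theta^*}{s}\big)}$ as $N\to\infty$.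
   Context: $(\theta_j)_{j\ge1}$, $(\kappa_j)_{j\ge1}$ are sequences of nonnegative reals; $g_\theta(z)=\sum_{j\ge1}\theta_jz^j/j$, $g_\kappa(z)=\sum_{j\ge1}\kappa_jz^j/j$, $G_N=g_\theta+Ng_\kappa$. $[z^N]F(z)$ is the coefficient of $z^N$. $H_N=\frac1{N!}\sum_{\sigma\in S_N}\prod_{j=1}^N(\theta_j+N\kappa_j)^{C_j(\sigma)}$, $C_j(\sigma)$ the number of $j$-cycles of $\sigma$. $g^{\{1\}}(z)=zg'(z)$, $g_\kappa^{\{1\}}(R):=\lim_{r\uparrow R}g_\kappa^{\{1\}}(r)$. Domain: for $\eta>0$, $\varphi\in(0,\pi/2)$, $\Delta_0=\{z\in\mathbb C:|z|<R|1+\eta e^{i\varphi}|,\ z\ne R,\ |\arg(z-R)|>\varphi\}$. Logs and powers use principal branches. Standing assumption: $(\kappa_j)$ is non-arithmetic (no integer $j_0>1$ such that $\kappa_j\ne0$ implies $j_0\mid j$) and $\kappa_j>0$ for some $j\ge2$. *)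

theory Defs
  imports "HOL-Complex_Analysis.Complex_Analysis" "HOL-Combinatorics.Permutations"
    "HOL-Library.Landau_Symbols"
begin

text \<open>Power series g(z) = sum_{j>=1} c_j z^j / j (index 0 contributes 0 since c/0 = 0).\<close>
definition gcoef :: "(nat \<Rightarrow> real) \<Rightarrow> nat \<Rightarrow> complex" where
  "gcoef c j = complex_of_real (c j / real j)"

definition gser :: "(nat \<Rightarrow> real) \<Rightarrow> complex \<Rightarrow> complex" where
  "gser c z = (\<Sum>j. gcoef c j * z ^ j)"

definition Delta0 :: "real \<Rightarrow> real \<Rightarrow> real \<Rightarrow> complex set" where
  "Delta0 R \<eta> \<phi> = {z. cmod z < R * cmod (1 + complex_of_real \<eta> * cis \<phi>)
        \<and> z \<noteq> complex_of_real R \<and> \<bar>Arg (z - complex_of_real R)\<bar> > \<phi>}"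

definition non_arithmetic :: "(nat \<Rightarrow> real) \<Rightarrow> bool" where
  "non_arithmetic k \<longleftrightarrow> \<not> (\<exists>j0::nat. j0 > 1 \<and> (\<forall>j\<ge>1. k j \<noteq> 0 \<longrightarrow> j0 dvd j))"

definition ncycles :: "nat \<Rightarrow> (nat \<Rightarrow> nat) \<Rightarrow> nat \<Rightarrow> nat" where
  "ncycles N \<sigma> j = card {c. \<exists>x\<in>{1..N}. c = range (\<lambda>k. (\<sigma> ^^ k) x) \<and> card c = j}"

definition H :: "(nat \<Rightarrow> real) \<Rightarrow> (nat \<Rightarrow> real) \<Rightarrow> nat \<Rightarrow> real" where
  "H \<theta> \<kappa> N = (1 / fact N) * (\<Sum>\<sigma>\<in>{\<sigma>. \<sigma> permutes {1..N}}.
      \<Prod>j=1..N. (\<theta> j + real N * \<kappa> j) ^ ncycles N \<sigma> j)"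

definition zcoeff :: "nat \<Rightarrow> (complex \<Rightarrow> complex) \<Rightarrow> complex" where
  "zcoeff N F = (deriv ^^ N) F 0 / fact N"

end

(*
The coefficient is a Cauchy integral over the circle |z| = R exp(-N^(-1/s)), which stays inside the
disc of convergence. Parametrise z = R exp(-N^(-1/s) w) with w = 1 + i y. The linear term of g_kappa
at R cancels against z^(-N), the quadratic error contributes N^(1-2/s) -> 0 since s < 2, and
N a (1 - z/R)^s tends to a w^s; so the rescaled integrand converges to exp(a w^s) w^(-theta_s). Since
Re (w^s) is at most -c |y|^s + C on the line and non-arithmeticity makes Re g_kappa strictly smaller
than g_kappa(R) away from R, it is dominated by C exp(-c |y|^s), and dominated convergence applies.
Replacing 1 by exp(-u / sqrt N) only costs terms sqrt N * N^(-1/s) -> 0, again since s < 2.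

The limit integral J(a) is a constant multiple of a^((theta_s - 1)/s), by moving the line of
integration. The constant is read off from the Laplace transform of J at a single point, which by
Fubini is the integral of w^(-theta_s) / (l - w^s), a residue at w = l^(1/s).

For H_N, splitting off the cycle of a fixed point gives the recurrence
n S_n = sum_k x_k S_(n-k) for the cycle-weighted permutation sums, which is also the coefficient
recurrence of F' = G' F for F = exp G.
*)
theory Submission
  imports Defs "HOL-Real_Asymp.Real_Asymp" "HOL-Combinatorics.Orbits"
begin

section \<open>Integrals over vertical lines\<close>

text \<open>Dominated convergence needs one integrable majorant in y that serves every large N on
  the whole circle. For this reason \<open>key_bound\<close> treats the radius R exp(-\<epsilon>)
  and the angle \<alpha> jointly: with \<epsilon> = N^(-1/s) and |\<alpha>| = \<epsilon> |y|, both
  \<epsilon>^s and |\<alpha>|^s carry the factor 1/N that cancels N. The exponent (\<theta>s - 1)/s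
  has two sources: the logarithm in g_theta contributes N^(\<theta>s/s), the rescaled line element
  N^(-1/s). The factor exp(u^2 g_kappa(R)/2) is the third term of N exp(-u/sqrt N) = N - u sqrt N +
  u^2/2 + o(1). Under v = a w^s the limit integral becomes Hankel's integral for 1/Gamma(p), p = (s
  - 1 + \<theta>s)/s, but that map bends the line. Instead J(a) = J(1) a^(p-1) has the Laplace
  transform J(1) Gamma(p) l^(-p), and the residue is a multiple of the same power l^(-p). All this
  takes place in the right half-plane, where principal powers are holomorphic; as s < 2, w^s does
  not reach the cut there, so w^s = l has only one root.\<close>

lemma integrable_abs_halfline:
  fixes f :: "real \<Rightarrow> 'a :: {banach, second_countable_topology}"
  assumes "set_integrable lborel {0..} f"
  shows "integrable lborel (\<lambda>y. f \<bar>y\<bar>)"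
proof -
  define g where "g = (\<lambda>y. indicator {0..} y *\<^sub>R f y)"
  have g: "integrable lborel g"
    using assms by (simp add: set_integrable_def g_def)
  then have g': "integrable lborel (\<lambda>y. g (- y))"
    using lborel_integrable_real_affine[OF g, of "-1" 0] by simp
  have "integrable lborel (\<lambda>y. g y + g (- y))"
    using g g' by (rule Bochner_Integration.integrable_add)
  \<comment> \<open>At y = 0 both halves contribute, so the identity may fail there and this single
    point is discarded.\<close>
  moreover have "g y + g (- y) = f \<bar>y\<bar>" if "y \<noteq> 0" for y
    using that by (cases "y > 0") (auto simp: g_def indicator_def)
  ultimately show ?thesis
    by (subst integrable_discrete_difference[where X = "{0}" and g = "\<lambda>y. g y + g (- y)"]) auto
qed

lemma integrable_one_plus_abs_powr:
  assumes "q > 1"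
  shows "integrable lborel (\<lambda>y. (1 + \<bar>y\<bar>) powr (- q) :: real)"
proof (rule integrable_abs_halfline)
  have "((\<lambda>x. x powr (- q)) has_integral (-(1 powr (- q + 1)) / (- q + 1))) {1..}"
    using assms by (intro has_integral_powr_to_inf) auto
  then have "(\<lambda>x. x powr (- q)) integrable_on {1..}" by blast
  then have "(\<lambda>x. x powr (- q)) absolutely_integrable_on {1..}"
    by (intro nonnegative_absolutely_integrable_1) auto
  then have "integrable lborel (\<lambda>x. indicator {1..} x *\<^sub>R x powr (- q))"
    by (auto simp: set_integrable_def integrable_completion)
  from lborel_integrable_real_affine[OF this, of 1 1]
  show "set_integrable lborel {0..} (\<lambda>y. (1 + y) powr (- q) :: real)"
    by (simp add: set_integrable_def indicator_def)
qed

lemma integrable_exp_minus_abs: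
  assumes "c > 0"
  shows "integrable lborel (\<lambda>y. exp (- c * \<bar>y\<bar>) :: real)"
proof (rule integrable_abs_halfline)
  have "(\<lambda>x. exp (- c * x)) absolutely_integrable_on {0..}"
    using integrable_on_exp_minus_to_infinity[OF assms]
    by (intro nonnegative_absolutely_integrable_1) auto
  then show "set_integrable lborel {0..} (\<lambda>y. exp (- c * y) :: real)"
    by (auto simp: set_integrable_def integrable_completion)
qed

lemma le_powr_plus_one:
  fixes x s :: real
  assumes "x \<ge> 0" "s \<ge> 1"
  shows "x \<le> x powr s + 1"
proof (cases "x \<le> 1")
  case False
  then have "x powr 1 \<le> x powr s" using assms by (intro powr_mono) auto
  with False show ?thesis by simp
qed (use assms in \<open>smt (verit) powr_ge_zero\<close>)

lemma integrable_exp_minus_abs_powr: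
  assumes "c > 0" "s \<ge> 1"
  shows "integrable lborel (\<lambda>y. exp (- c * \<bar>y\<bar> powr s) :: real)"
proof (rule Bochner_Integration.integrable_bound)
  show "integrable lborel (\<lambda>y. exp c * exp (- c * \<bar>y\<bar>))"
    using integrable_exp_minus_abs[OF assms(1)] by auto
  show "AE y in lborel. norm (exp (- c * \<bar>y\<bar> powr s)) \<le> norm (exp c * exp (- c * \<bar>y\<bar>))"
  proof (rule AE_I2)
    fix y :: real
    have "c * \<bar>y\<bar> \<le> c * (\<bar>y\<bar> powr s + 1)"
      using le_powr_plus_one[of "\<bar>y\<bar>" s] assms by (intro mult_left_mono) auto
    then show "norm (exp (- c * \<bar>y\<bar> powr s)) \<le> norm (exp c * exp (- c * \<bar>y\<bar>))"
      by (simp add: mult_exp_exp algebra_simps)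
  qed
qed auto

text \<open>Lets integrals over the whole line be evaluated by antiderivatives on [-n, n]; the
  majorant is the norm of f itself.\<close>

lemma integral_symmetric_interval_tendsto:
  fixes f :: "real \<Rightarrow> complex"
  assumes "integrable lborel f"
  shows "(\<lambda>n. integral {- real n..real n} f) \<longlonglongrightarrow> integral\<^sup>L lborel f"
proof -
  have "integral {- real n..real n} f = (LINT y|lborel. indicator {- real n..real n} y *\<^sub>R f y)" for n
    using assms
    by (subst set_borel_integral_eq_integral(2)[symmetric])
       (auto simp: set_lebesgue_integral_def set_integrable_def intro: integrable_mult_indicator)
  moreover have "(\<lambda>n. LINT y|lborel. indicator {- real n..real n} y *\<^sub>R f y) \<longlonglongrightarrow> integral\<^sup>L lborel f"
  proof (rule integral_dominated_convergence)
    show "integrable lborel (\<lambda>y. norm (f y))" using assms by auto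
    show "AE y in lborel. (\<lambda>n. indicator {- real n..real n} y *\<^sub>R f y) \<longlonglongrightarrow> f y"
    proof (rule AE_I2)
      fix y :: real
      obtain m :: nat where "\<bar>y\<bar> \<le> real m" using real_arch_simple by blast
      then have "\<forall>\<^sub>F n in sequentially. indicator {- real n..real n} y *\<^sub>R f y = f y"
        unfolding eventually_sequentially by (intro exI[of _ m]) (auto simp: indicator_def)
      then show "(\<lambda>n. indicator {- real n..real n} y *\<^sub>R f y) \<longlonglongrightarrow> f y"
        by (rule tendsto_eventually)
    qed
  qed (use assms in \<open>auto simp: indicator_def\<close>)
  ultimately show ?thesis by simp
qed

text \<open>The half-plane is convex, so h has a primitive P there. The two truncated vertical
  integrals are differences of values of P, and their difference consists of two horizontal
  increments of P, each at most M n (b2 - b1).\<close>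

lemma vertical_line_integral_eq:
  assumes holo: "h holomorphic_on {z. Re z > 0}"
    and b: "0 < b1" "b1 \<le> b2"
    and int1: "integrable lborel (\<lambda>y. h (Complex b1 y))"
    and int2: "integrable lborel (\<lambda>y. h (Complex b2 y))"
    and M: "(M \<longlongrightarrow> 0) at_top"
    and bound: "\<And>x y. b1 \<le> x \<Longrightarrow> x \<le> b2 \<Longrightarrow> \<bar>y\<bar> \<ge> Y \<Longrightarrow> norm (h (Complex x y)) \<le> M \<bar>y\<bar>"
  shows "(LINT y|lborel. h (Complex b1 y)) = (LINT y|lborel. h (Complex b2 y))"
proof -
  obtain P where P: "\<And>z. Re z > 0 \<Longrightarrow> (P has_field_derivative h z) (at z within {z. Re z > 0})"
    using holomorphic_convex_primitive'[OF convex_halfspace_Re_gt open_halfspace_Re_gt holo] by auto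
  have P': "(P has_field_derivative h z) (at z)" if "Re z > 0" for z
    using P[OF that] at_within_open[of z "{z. Re z > 0}"] that by (simp add: open_halfspace_Re_gt)
  have vert: "integral {- real n..real n} (\<lambda>y. h (Complex b y))
      = - \<i> * (P (Complex b (real n)) - P (Complex b (- real n)))" if "b > 0" for b n
  proof -
    have "((\<lambda>y. P (Complex b y)) has_vector_derivative (\<i> * h (Complex b y))) (at y within {- real n..real n})" for y
    proof -
      have "((\<lambda>z. P (of_real b + \<i> * z)) has_field_derivative h (of_real b + \<i> * of_real y) * \<i>) (at (of_real y))"
      proof (rule DERIV_chain2[where f = P])
        show "(P has_field_derivative h (of_real b + \<i> * of_real y)) (at (of_real b + \<i> * of_real y))"
          using that by (intro P') simp
        show "((\<lambda>z. of_real b + \<i> * z) has_field_derivative \<i>) (at (of_real y))"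
          by (auto intro!: derivative_eq_intros)
      qed
      from has_vector_derivative_real_field[OF this] show ?thesis
        by (simp add: Complex_eq mult.commute has_vector_derivative_at_within)
    qed
    from fundamental_theorem_of_calculus[OF _ this]
    have "((\<lambda>y. \<i> * h (Complex b y)) has_integral (P (Complex b (real n)) - P (Complex b (- real n)))) {- real n..real n}"
      by simp
    from has_integral_mult_right[OF this, of "- \<i>"] show ?thesis
      by (simp add: integral_unique)
  qed
  have horiz: "norm (P (Complex b2 y) - P (Complex b1 y)) \<le> M \<bar>y\<bar> * (b2 - b1)" if "\<bar>y\<bar> \<ge> Y" for y
  proof -
    have "norm (P (Complex b2 y) - P (Complex b1 y)) \<le> M \<bar>y\<bar> * norm (Complex b2 y - Complex b1 y)"
    proof (rule field_differentiable_bound[where f' = h])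
      show "convex (closed_segment (Complex b1 y) (Complex b2 y))" by simp
      fix z assume "z \<in> closed_segment (Complex b1 y) (Complex b2 y)"
      then have z: "Im z = y" "b1 \<le> Re z" "Re z \<le> b2"
        using closed_segment_same_Im[of "Complex b1 y" "Complex b2 y"] b
        by (auto simp: closed_segment_eq_real_ivl)
      show "(P has_field_derivative h z) (at z within closed_segment (Complex b1 y) (Complex b2 y))"
        using b z by (intro has_field_derivative_at_within[OF P']) auto
      have "Complex (Re z) y = z" using z(1) by (auto simp: complex_eq_iff)
      then show "norm (h z) \<le> M \<bar>y\<bar>" using bound[of "Re z" y] z that by metis
    qed auto
    moreover have "Complex b2 y - Complex b1 y = of_real (b2 - b1)" by (simp add: complex_eq_iff)
    then have "norm (Complex b2 y - Complex b1 y) = b2 - b1" using b by (simp add: norm_of_real del: of_real_diff)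
    ultimately show ?thesis by simp
  qed
  let ?D = "\<lambda>n. integral {- real n..real n} (\<lambda>y. h (Complex b2 y)) - integral {- real n..real n} (\<lambda>y. h (Complex b1 y))"
  have "\<forall>\<^sub>F n in sequentially. norm (?D n) \<le> 2 * (M (real n) * (b2 - b1))"
  proof -
    obtain m :: nat where m: "Y \<le> real m" using real_arch_simple by blast
    have "norm (?D n) \<le> 2 * (M (real n) * (b2 - b1))" if "n \<ge> m" for n
    proof -
      have "?D n = - \<i> * ((P (Complex b2 (real n)) - P (Complex b1 (real n)))
                       - (P (Complex b2 (- real n)) - P (Complex b1 (- real n))))"
        using b by (simp add: vert algebra_simps)
      then have "norm (?D n) \<le> norm (P (Complex b2 (real n)) - P (Complex b1 (real n)))
                       + norm (P (Complex b2 (- real n)) - P (Complex b1 (- real n)))"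
        by (simp only: norm_mult norm_minus_cancel norm_ii mult_1_left norm_triangle_ineq4)
      then show ?thesis using horiz[of "real n"] horiz[of "- real n"] m that by auto
    qed
    then show ?thesis unfolding eventually_sequentially by blast
  qed
  moreover have "(\<lambda>n. 2 * (M (real n) * (b2 - b1))) \<longlonglongrightarrow> 0"
    by (intro tendsto_mult_right_zero tendsto_mult_left_zero filterlim_compose[OF M] filterlim_real_sequentially)
  ultimately have "?D \<longlonglongrightarrow> 0" by (rule Lim_null_comparison)
  moreover have "?D \<longlonglongrightarrow> (LINT y|lborel. h (Complex b2 y)) - (LINT y|lborel. h (Complex b1 y))"
    by (intro tendsto_diff integral_symmetric_interval_tendsto int1 int2)
  ultimately show ?thesis using LIMSEQ_unique by fastforce
qed

text \<open>For arguments close to \<plusminus>pi/2 the angle s arg z lies beyond pi/2, so the real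
  part is negative of order |z|^s. In the remaining sector |z| is comparable to Re z, and the term
  with C absorbs everything.\<close>

lemma Re_powr_sector_bound:
  assumes s: "1 < s" "s < 2"
  obtains c C where "c > 0" "C > 0"
    "\<And>z. Re z > 0 \<Longrightarrow> Re (z powr complex_of_real s) \<le> C * Re z powr s - c * norm z powr s"
proof -
  \<comment> \<open>The midpoint between pi/(2s) and pi/2: above the first, s \<psi> exceeds pi/2;
    below the second, s < 2 keeps s \<psi> under pi, so cos (s \<psi>) is negative.\<close>
  define \<psi> where "\<psi> = (pi / (2 * s) + pi / 2) / 2"
  have 1: "pi / (2 * s) < pi / 2" using s by (simp add: field_simps)
  have \<psi>: "pi / (2 * s) < \<psi>" "\<psi> < pi / 2" "\<psi> > 0" using 1 s unfolding \<psi>_def by (auto intro: add_pos_pos)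
  have s\<psi>: "pi / 2 < s * \<psi>" "s * \<psi> < pi"
  proof -
    show "pi / 2 < s * \<psi>" using \<psi> s by (simp add: field_simps)
    have "s * \<psi> < 2 * (pi / 2)" using \<psi> s by (intro mult_strict_mono) auto
    then show "s * \<psi> < pi" by simp
  qed
  define c where "c = - cos (s * \<psi>)"
  have c: "c > 0" using cos_lt_zero_pi[of "s * \<psi>"] s\<psi> by (auto simp: c_def)
  have cos\<psi>: "cos \<psi> > 0" using \<psi> by (intro cos_gt_zero) auto
  \<comment> \<open>Inside the sector |z| \<le> Re z / cos \<psi>, so this C gives (1 + c) |z|^s
    \<le> C (Re z)^s.\<close>
  define C where "C = (1 + c) / cos \<psi> powr s"
  have C: "C > 0" using c cos\<psi> by (auto simp: C_def)
  have *: "Re (z powr complex_of_real s) \<le> C * Re z powr s - c * norm z powr s" if z: "Re z > 0" for z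
  proof -
    have z0: "z \<noteq> 0" using z by auto
    have Re_powr: "Re (z powr complex_of_real s) = norm z powr s * cos (s * \<bar>Arg z\<bar>)"
    proof -
      have "z powr complex_of_real s = exp (of_real s * Ln z)" using z0 by (simp add: powr_def)
      then have "Re (z powr complex_of_real s) = exp (s * ln (norm z)) * cos (s * Arg z)"
        using z0 by (simp add: Re_exp Arg_def)
      also have "cos (s * Arg z) = cos (s * \<bar>Arg z\<bar>)" by (simp add: abs_if)
      also have "exp (s * ln (norm z)) = norm z powr s" using z0 by (simp add: powr_def)
      finally show ?thesis .
    qed
    have Arg: "\<bar>Arg z\<bar> < pi / 2" using z Arg_def Re_Ln_pos_lt_imp z0 by simp
    show ?thesis
    proof (cases "\<bar>Arg z\<bar> \<ge> \<psi>")
      case True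
      have "s * \<bar>Arg z\<bar> \<le> 2 * (pi / 2)" using Arg s by (intro mult_mono) auto
      then have "cos (s * \<bar>Arg z\<bar>) \<le> cos (s * \<psi>)"
        using True s \<psi> by (intro cos_monotone_0_pi_le) auto
      then have "Re (z powr complex_of_real s) \<le> norm z powr s * (- c)"
        unfolding Re_powr c_def by (intro mult_left_mono) auto
      moreover have "C * Re z powr s \<ge> 0" using C by simp
      ultimately show ?thesis by (simp add: mult.commute)
    next
      case False
      have "cos \<bar>Arg z\<bar> \<ge> cos \<psi>" using False \<psi> by (intro cos_monotone_0_pi_le) auto
      then have "norm z * cos \<psi> \<le> norm z * cos (Arg z)" by (intro mult_left_mono) auto
      also have "\<dots> = Re z" using cos_Arg[OF z0] z0 by simp
      finally have "norm z \<le> Re z / cos \<psi>" using cos\<psi> by (simp add: field_simps)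
      then have "norm z powr s \<le> (Re z / cos \<psi>) powr s" using s by (intro powr_mono2) auto
      also have "\<dots> = Re z powr s / cos \<psi> powr s" using cos\<psi> z by (simp add: powr_divide)
      finally have "(1 + c) * norm z powr s \<le> C * Re z powr s"
        unfolding C_def using c mult_left_mono[of "norm z powr s" "Re z powr s / cos \<psi> powr s" "1 + c"] by simp
      moreover have "Re (z powr complex_of_real s) \<le> norm z powr s * 1"
        unfolding Re_powr by (intro mult_left_mono) auto
      ultimately show ?thesis by (simp add: algebra_simps)
    qed
  qed
  from c C * show ?thesis by (rule that)
qed

section \<open>Explicit integrals, and lines that can be pushed to infinity\<close>

lemma laplace_transform_exp:
  fixes w :: complex
  assumes "Re w > 0"
  shows "integrable lborel (\<lambda>t. if t \<in> {0..} then exp (- w * of_real t) else 0)"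
    and "(LINT t|lborel. (if t \<in> {0..} then exp (- w * of_real t) else 0)) = 1 / w"
proof -
  let ?f = "\<lambda>t::real. (if t \<in> {0..} then exp (- w * of_real t) else 0)"
  have w: "w \<noteq> 0" using assms by auto
  show int: "integrable lborel ?f"
  proof (rule Bochner_Integration.integrable_bound)
    show "integrable lborel (\<lambda>t. exp (- Re w * \<bar>t\<bar>))" by (rule integrable_exp_minus_abs[OF assms])
  qed auto
  have "integral {- real n..real n} ?f = (1 - exp (- w * of_real (real n))) / w" for n
  proof -
    have "((\<lambda>t. exp (- w * of_real t)) has_integral
        (- exp (- w * of_real (real n)) / w - (- exp (- w * of_real 0) / w))) {0..real n}"
    proof (rule fundamental_theorem_of_calculus)
      fix t :: real
      have "((\<lambda>z. - exp (- w * z) / w) has_field_derivative exp (- w * of_real t)) (at (of_real t))"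
        using w by (auto intro!: derivative_eq_intros)
      from has_vector_derivative_real_field[OF this]
      show "((\<lambda>t. - exp (- w * of_real t) / w) has_vector_derivative exp (- w * of_real t)) (at t within {0..real n})"
        by (rule has_vector_derivative_at_within)
    qed simp
    then have "integral {0..real n} (\<lambda>t. exp (- w * of_real t)) = (1 - exp (- w * of_real (real n))) / w"
      by (simp add: integral_unique diff_divide_distrib)
    moreover have "{0..} \<inter> {- real n..real n} = {0..real n}" by auto
    ultimately show ?thesis by (simp only: integral_restrict_Int)
  qed
  moreover have "(\<lambda>n. (1 - exp (- w * of_real (real n))) / w) \<longlonglongrightarrow> (1 - 0) / w"
  proof (intro tendsto_intros)
    have "(\<lambda>n. exp (- Re w * real n)) \<longlonglongrightarrow> 0" using assms by real_asymp
    then show "(\<lambda>n. exp (- w * of_real (real n))) \<longlonglongrightarrow> 0"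
      by (subst tendsto_norm_zero_iff[symmetric]) simp
  qed (use w in auto)
  ultimately show "integral\<^sup>L lborel ?f = 1 / w"
    using integral_symmetric_interval_tendsto[OF int] by (simp add: LIMSEQ_unique)
qed

text \<open>Supplies the residue by hand: on Re z = b the second fraction is 1/(t - z) with t = b +
  u. Neither fraction is integrable alone, but their sum decays quadratically.\<close>

lemma vertical_line_integral_partial_fractions:
  fixes b u :: real
  assumes "b > 0" "u > 0"
    and int: "integrable lborel (\<lambda>y. 1 / Complex b y + 1 / Complex u (- y))"
  shows "(LINT y|lborel. 1 / Complex b y + 1 / Complex u (- y)) = 2 * of_real pi"
proof -
  let ?f = "\<lambda>y. 1 / Complex b y + 1 / Complex u (- y)"
  \<comment> \<open>Antiderivative of the real and imaginary parts. The imaginary part is even in y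
    and cancels between n and -n; the two arctangents give 2 pi in the limit.\<close>
  let ?A = "\<lambda>y. Complex (arctan (y / b) + arctan (y / u)) ((ln (u\<^sup>2 + y\<^sup>2) - ln (b\<^sup>2 + y\<^sup>2)) / 2)"
  have "integral {- real n..real n} ?f = ?A (real n) - ?A (- real n)" for n
  proof (rule integral_unique, rule fundamental_theorem_of_calculus)
    fix y :: real
    have pos: "b\<^sup>2 + y\<^sup>2 > 0" "u\<^sup>2 + y\<^sup>2 > 0" using assms by (auto intro: add_pos_nonneg)
    have 1: "((\<lambda>y. arctan (y / b) + arctan (y / u)) has_real_derivative (b / (b\<^sup>2 + y\<^sup>2) + u / (u\<^sup>2 + y\<^sup>2))) (at y)"
      using assms pos
      by (auto intro!: derivative_eq_intros simp: divide_simps power2_eq_square)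
    have 2: "((\<lambda>y. (ln (u\<^sup>2 + y\<^sup>2) - ln (b\<^sup>2 + y\<^sup>2)) / 2) has_real_derivative (y / (u\<^sup>2 + y\<^sup>2) - y / (b\<^sup>2 + y\<^sup>2))) (at y)"
      using assms pos
      by (auto intro!: derivative_eq_intros)
         (auto simp: field_simps)
    have "?f y = Complex (b / (b\<^sup>2 + y\<^sup>2) + u / (u\<^sup>2 + y\<^sup>2)) (y / (u\<^sup>2 + y\<^sup>2) - y / (b\<^sup>2 + y\<^sup>2))"
      by (simp add: complex_eq_iff Re_divide Im_divide)
    then show "(?A has_vector_derivative ?f y) (at y within {- real n..real n})"
      using 1 2 by (simp add: has_vector_derivative_complex_iff has_field_derivative_at_within flip: has_real_derivative_iff_has_vector_derivative)
  qed simp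
  moreover have "(\<lambda>n. ?A (real n) - ?A (- real n)) \<longlonglongrightarrow> 2 * of_real pi"
  proof -
    have "(\<lambda>n. 2 * (arctan (real n / b) + arctan (real n / u))) \<longlonglongrightarrow> 2 * (pi / 2 + pi / 2)"
      using assms by real_asymp
    then have "(\<lambda>n. complex_of_real (2 * (arctan (real n / b) + arctan (real n / u)))) \<longlonglongrightarrow> of_real (2 * (pi / 2 + pi / 2))"
      by (rule tendsto_of_real)
    moreover have "?A (real n) - ?A (- real n) = complex_of_real (2 * (arctan (real n / b) + arctan (real n / u)))" for n
      by (simp add: complex_eq_iff arctan_minus)
    ultimately show ?thesis by simp
  qed
  ultimately show ?thesis
    using integral_symmetric_interval_tendsto[OF int] by (simp add: LIMSEQ_unique)
qed

lemma norm_Complex_ge: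
  assumes "x \<ge> 1"
  shows "norm (Complex x y) \<ge> (1 + \<bar>y\<bar>) / 2" "norm (Complex x y) \<ge> x" "norm (Complex x y) \<ge> \<bar>y\<bar>"
  using abs_Re_le_cmod[of "Complex x y"] abs_Im_le_cmod[of "Complex x y"] assms by auto

lemma continuous_on_Complex: "continuous_on S (Complex x)"
  unfolding Complex_eq by (intro continuous_intros)

lemma continuous_on_vertical_line:
  assumes "h holomorphic_on {z. Re z > 0}" "b > 0"
  shows "continuous_on UNIV (\<lambda>y. h (Complex b y))"
  using assms
  by (intro continuous_on_compose2[OF holomorphic_on_imp_continuous_on[OF assms(1)]] continuous_on_Complex) auto

text \<open>The line of integration is moved to the right until the integrand disappears.\<close>

lemma vertical_line_integral_zero:
  assumes holo: "h holomorphic_on {z. Re z > 0}" and q: "q > 1" and \<rho>: "\<rho> \<ge> 1"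
    and bound: "\<And>z. Re z \<ge> 1 \<Longrightarrow> norm z \<ge> \<rho> \<Longrightarrow> norm (h z) \<le> C * norm z powr (- q)"
  shows "integrable lborel (\<lambda>y. h (Complex 1 y))" "(LINT y|lborel. h (Complex 1 y)) = 0"
proof -
  \<comment> \<open>Splits q as p + (1 + p): the power -(1 + p) is integrable in y, and the power -p
    of the abscissa tends to 0 as the line moves right.\<close>
  define p where "p = (q - 1) / 2"
  have p: "p > 0" "1 + p > 1" "q = p + (1 + p)" using q by (auto simp: p_def field_simps)
  define C' where "C' = max C 0"
  have C': "C' \<ge> 0" "C \<le> C'" by (auto simp: C'_def)
  let ?w = "\<lambda>y::real. 2 powr (1 + p) * (1 + \<bar>y\<bar>) powr (- (1 + p))"
  have w: "integrable lborel ?w"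
    using integrable_one_plus_abs_powr[OF p(2)] by auto
  have far: "norm (h (Complex x y)) \<le> C' * x powr (- p) * ?w y"
    if "x \<ge> 1" "norm (Complex x y) \<ge> \<rho>" for x y
  proof -
    have "norm (h (Complex x y)) \<le> C' * norm (Complex x y) powr (- q)"
      using bound[of "Complex x y"] that C'
        by (smt (verit) complex.sel(1) mult_right_mono powr_ge_zero)
    also have "norm (Complex x y) powr (- q) = norm (Complex x y) powr (- p) * norm (Complex x y) powr (- (1 + p))"
      by (simp add: p(3) flip: powr_add)
    also have "\<dots> \<le> x powr (- p) * ((1 + \<bar>y\<bar>) / 2) powr (- (1 + p))"
      using that p norm_Complex_ge[of x y] by (intro mult_mono powr_mono2') auto
    also have "((1 + \<bar>y\<bar>) / 2) powr (- (1 + p)) = ?w y"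
      by (subst powr_divide) (simp_all add: powr_minus_divide del: minus_add_distrib)
    finally show ?thesis using C' by (simp add: mult_left_mono mult.assoc)
  qed
  have meas: "(\<lambda>y. h (Complex b y)) \<in> borel_measurable lborel" if "b > 0" for b
    using borel_measurable_continuous_onI[OF continuous_on_vertical_line[OF holo that]] by simp
  have int: "integrable lborel (\<lambda>y. h (Complex b y))" if "b \<ge> 1" for b
  proof -
    have "compact ((\<lambda>y. h (Complex b y)) ` {-\<rho>..\<rho>})"
      using that by (intro compact_continuous_image continuous_on_subset[OF continuous_on_vertical_line[OF holo]]) auto
    then obtain B where B: "\<And>y. \<bar>y\<bar> \<le> \<rho> \<Longrightarrow> norm (h (Complex b y)) \<le> B"
      using compact_imp_bounded[THEN bounded_iff[THEN iffD1]] by (force simp: abs_le_iff)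
    have B0: "B \<ge> 0" using B[of 0] \<rho> norm_ge_zero[of "h (Complex b 0)"] by linarith
    have wge: "?w y \<ge> (1 + \<rho>) powr (- (1 + p))" if "\<bar>y\<bar> \<le> \<rho>" for y
    proof -
      have "1 * (1 + \<rho>) powr (- (1 + p)) \<le> ?w y" using that p by (intro mult_mono powr_mono2' ge_one_powr_ge_zero) auto
      then show ?thesis by simp
    qed
    \<comment> \<open>The first summand covers |y| \<le> \<rho>, where only compactness bounds h and
      \<open>?w\<close> is at least (1 + \<rho>) powr (- (1 + p)); C' covers the rest.\<close>
    define L where "L = B * (1 + \<rho>) powr (1 + p) + C'"
    have "norm (h (Complex b y)) \<le> L * ?w y" for y
    proof (cases "\<bar>y\<bar> \<le> \<rho>")
      case True
      have "norm (h (Complex b y)) \<le> B" by (rule B[OF True])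
      also have "B = B * (1 + \<rho>) powr (1 + p) * (1 + \<rho>) powr (- (1 + p))"
        using \<rho> by (simp flip: powr_add add: mult.assoc del: minus_add_distrib)
      also have "\<dots> \<le> L * ?w y"
        unfolding L_def using wge[OF True] B0 C' by (intro mult_mono) auto
      finally show ?thesis .
    next
      case False
      have "norm (h (Complex b y)) \<le> C' * b powr (- p) * ?w y"
        using norm_Complex_ge[of b y] False that by (intro far) auto
      also have "\<dots> \<le> L * ?w y"
      proof (rule mult_right_mono)
        have "b powr (- p) \<le> 1" using that p by (simp add: powr_minus inverse_le_1_iff ge_one_powr_ge_zero)
        then have "C' * b powr (- p) \<le> C'" using C' by (simp add: mult_left_le)
        also have "\<dots> \<le> L" unfolding L_def using B0 by simp
        finally show "C' * b powr (- p) \<le> L" .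
      qed auto
      finally show ?thesis .
    qed
    then show ?thesis using w that
      by (intro Bochner_Integration.integrable_bound[OF _ meas, where f = "\<lambda>y. L * ?w y"] AE_I2)
         (auto intro: order_trans[OF _ abs_ge_self])
  qed
  show "integrable lborel (\<lambda>y. h (Complex 1 y))" by (rule int) simp
  have eq: "(LINT y|lborel. h (Complex 1 y)) = (LINT y|lborel. h (Complex b y))" if "b \<ge> 1" for b
  proof (rule vertical_line_integral_eq[OF holo _ that int int, where Y = \<rho> and M = "\<lambda>y. C' * ?w y"])
    show "((\<lambda>y. C' * ?w y) \<longlongrightarrow> 0) at_top"
      using p by real_asymp
    fix x y :: real assume *: "1 \<le> x" "x \<le> b" "\<rho> \<le> \<bar>y\<bar>"
    have "norm (h (Complex x y)) \<le> C' * x powr (- p) * ?w y"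
      using * norm_Complex_ge[of x y] by (intro far) auto
    also have "\<dots> \<le> C' * ?w y"
    proof (rule mult_right_mono)
      have "x powr (- p) \<le> 1" using * p by (simp add: powr_minus inverse_le_1_iff ge_one_powr_ge_zero)
      then show "C' * x powr (- p) \<le> C'" using C' by (simp add: mult_left_le)
    qed auto
    finally show "norm (h (Complex x y)) \<le> C' * ?w \<bar>y\<bar>" by simp
  qed (use that in auto)
  have "\<forall>\<^sub>F b in at_top. norm (LINT y|lborel. h (Complex 1 y)) \<le> C' * b powr (- p) * (LINT y|lborel. ?w y)"
    using eventually_ge_at_top[of \<rho>]
  proof eventually_elim
    case (elim b)
    have "norm (LINT y|lborel. h (Complex b y)) \<le> (LINT y|lborel. C' * b powr (- p) * ?w y)"
      using elim \<rho> norm_Complex_ge[of b] w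
      by (intro Bochner_Integration.integral_norm_bound_integral int integrable_mult_right w far)
         (auto intro: order_trans)
    also have "\<dots> = C' * b powr (- p) * (LINT y|lborel. ?w y)"
      by simp
    finally show ?case using eq[of b] elim \<rho> by simp
  qed
  moreover have "((\<lambda>b. C' * b powr (- p) * (LINT y|lborel. ?w y)) \<longlongrightarrow> 0) at_top"
    by (rule tendsto_mult_left_zero) (use p in real_asymp)
  ultimately have "norm (LINT y|lborel. h (Complex 1 y)) \<le> 0"
    by (intro tendsto_le[OF _ _ tendsto_const]) auto
  then show "(LINT y|lborel. h (Complex 1 y)) = 0" by simp
qed

section \<open>A Hankel-type integral\<close>

lemma holomorphic_on_powr_halfplane: "(\<lambda>z. z powr w) holomorphic_on {z. Re z > 0}"
  by (intro holomorphic_intros) (auto simp: complex_nonpos_Reals_iff)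

text \<open>Since |arg z| < pi/2 and s < 2, the number s Ln z has imaginary part within (-pi, pi),
  so taking Ln of z^s returns it without a branch correction.\<close>

lemma powr_eq_of_real_halfplane:
  assumes s: "1 < s" "s < 2" and z: "Re z > 0" and l: "l > 0"
    and eq: "z powr complex_of_real s = complex_of_real l"
  shows "z = complex_of_real (l powr (1 / s))"
proof -
  have z0: "z \<noteq> 0" using z by auto
  have "\<bar>Im (Ln z)\<bar> < pi / 2" using z by (rule Re_Ln_pos_lt_imp)
  then have "s * \<bar>Im (Ln z)\<bar> < 2 * (pi / 2)" using s by (intro mult_strict_mono) auto
  then have "\<bar>s * Im (Ln z)\<bar> < pi" using s by (simp add: abs_mult)
  then have "Ln (exp (of_real s * Ln z)) = of_real s * Ln z"
    by (intro Ln_exp) auto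
  then have "of_real s * Ln z = of_real (ln l)"
    using eq z0 l by (simp add: powr_def Ln_of_real)
  then have "Ln z = of_real (ln l / s)" using s by (simp add: field_simps)
  then have "exp (Ln z) = of_real (exp (ln l / s))" by (simp only: exp_of_real)
  then show ?thesis using z0 l by (simp add: powr_def)
qed

text \<open>Closing the line to the right picks up the residue at \<open>l powr (1 / s)\<close>.\<close>

lemma vertical_line_integral_residue:
  assumes s: "1 < s" "s < 2" and \<theta>: "\<theta> \<ge> 0" and l: "l > 1"
  defines "h \<equiv> (\<lambda>z. z powr complex_of_real (- \<theta>) / (complex_of_real l - z powr complex_of_real s))"
  shows "(LINT y|lborel. h (Complex 1 y)) = complex_of_real (2 * pi / s * l powr (- ((s - 1 + \<theta>) / s)))"
proof -
  define t where "t = l powr (1 / s)"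
  have t1: "t > 1" using l s by (simp add: t_def)
  have ts: "t powr s = l" using l s by (simp add: t_def powr_powr)
  let ?S = "{z::complex. Re z > 0}"
  have S: "open ?S" by (rule open_halfspace_Re_gt)
  let ?t = "complex_of_real t"
  have tS: "?t \<in> ?S" using t1 by simp
  define pw where "pw = (\<lambda>z. z powr complex_of_real s)"
  have pwt: "pw ?t = of_real l" using t1 ts by (simp add: pw_def powr_of_real)
  \<comment> \<open>Divided difference of z^s at t, with the derivative filled in at t. It is
    holomorphic and has no zero in the half-plane, so h = n / (t - z) exhibits the pole as
    simple.\<close>
  define q where "q = (\<lambda>z. if z = ?t then deriv pw ?t else (pw z - pw ?t) / (z - ?t))"
  have q_holo: "q holomorphic_on ?S"
    unfolding q_def pw_def by (intro pole_lemma_open holomorphic_on_powr_halfplane S)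
  have "(pw has_field_derivative of_real s * ?t powr (of_real s - 1)) (at ?t)"
    unfolding pw_def using t1 by (intro has_field_derivative_powr) (auto simp: complex_nonpos_Reals_iff)
  then have qt: "q ?t = of_real (s * t powr (s - 1))"
    using t1 powr_of_real[of t "s - 1"] by (simp add: q_def DERIV_imp_deriv)
  have q_nz: "q z \<noteq> 0" if "z \<in> ?S" for z
  proof (cases "z = ?t")
    case True
    then show ?thesis using qt t1 s by (simp del: of_real_mult)
  next
    case False
    then have "pw z \<noteq> of_real l"
      using powr_eq_of_real_halfplane[OF s, of z l] that l by (auto simp: pw_def t_def)
    then show ?thesis using False by (simp add: q_def pwt)
  qed
  define n where "n = (\<lambda>z. z powr complex_of_real (- \<theta>) / q z)"
  define m where "m = (\<lambda>z. z * n z)"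
  define c where "c = t powr (- \<theta>) / (s * t powr (s - 1))"
  have nt: "n ?t = of_real c" using t1 by (simp add: n_def qt c_def powr_of_real flip: of_real_minus)
  have m_holo: "m holomorphic_on ?S"
    unfolding m_def n_def by (intro holomorphic_intros q_holo holomorphic_on_powr_halfplane) (use q_nz in auto)
  \<comment> \<open>Away from t this is c (1/z + 1/(t - z)) - h, holomorphic because the pole at t
    cancels. Subtracting only c/(t - z) would leave decay 1/|z|; the extra 1/z, whose pole 0 is
    outside the half-plane, improves it to |z|^(-2).\<close>
  define G where "G = (\<lambda>z. (if z = ?t then deriv m ?t else (m z - m ?t) / (z - ?t)) / z)"
  have G_holo: "G holomorphic_on ?S"
    unfolding G_def by (intro holomorphic_on_divide pole_lemma_open m_holo S holomorphic_on_ident) auto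
  have G_eq: "G z = of_real c * (1 / z + 1 / (?t - z)) - h z" if z: "z \<in> ?S" "z \<noteq> ?t" for z
  proof -
    have z0: "z \<noteq> 0" "z - ?t \<noteq> 0" "?t - z \<noteq> 0" using z by auto
    have "pw z \<noteq> of_real l"
      using powr_eq_of_real_halfplane[OF s, of z l] z l by (auto simp: pw_def t_def)
    then have "h z = n z / (?t - z)"
      using z z0 by (simp add: h_def n_def q_def pwt flip: pw_def) (simp add: divide_simps pw_def, simp add: algebra_simps)
    moreover have "G z = (z * n z - ?t * of_real c) / ((z - ?t) * z)"
      using z by (simp add: G_def m_def nt)
    ultimately show ?thesis using z0 by (simp add: divide_simps) (simp add: algebra_simps)
  qed
  have c0: "c \<ge> 0" using s by (simp add: c_def)
  have bound: "norm (G z) \<le> (2 + 2 * c * t) * norm z powr (- s)" if z: "Re z \<ge> 1" "norm z \<ge> 2 * t" for z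
  proof -
    have zt: "z \<noteq> ?t" using z t1 by (auto simp: norm_of_real)
    have nz: "norm z > 0" "norm z \<ge> 1" using z t1 by auto
    have far: "norm (?t - z) \<ge> norm z / 2"
      using norm_triangle_ineq3[of z ?t] z t1 by (simp add: norm_minus_commute)
    have "norm (of_real c * (1 / z + 1 / (?t - z))) = c * t / (norm z * norm (?t - z))"
    proof -
      have "1 / z + 1 / (?t - z) = ?t / (z * (?t - z))"
        using zt nz by (auto simp: field_simps)
      then show ?thesis using c0 t1 by (simp add: norm_mult norm_divide)
    qed
    also have "\<dots> \<le> c * t / (norm z * (norm z / 2))"
      using c0 t1 nz far by (intro divide_left_mono mult_left_mono mult_pos_pos) auto
    also have "\<dots> = 2 * c * t * norm z powr (- 2)"
      using nz by (simp add: powr_minus powr_numeral field_simps power2_eq_square)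
    also have "\<dots> \<le> 2 * c * t * norm z powr (- s)"
      using c0 t1 nz s by (intro mult_left_mono powr_mono) auto
    finally have 1: "norm (of_real c * (1 / z + 1 / (?t - z))) \<le> 2 * c * t * norm z powr (- s)" .
    \<comment> \<open>For |z| \<ge> 2 t this yields |z|^s \<ge> (2 t)^s \<ge> 2 l, so the
      denominator of h is at least half of |z|^s.\<close>
    have "2 * l \<le> 2 powr s * l" using s l powr_mono[of 1 s 2] by simp
    also have "\<dots> = (2 * t) powr s" using t1 ts by (simp add: powr_mult)
    also have "\<dots> \<le> norm z powr s" using z t1 s by (intro powr_mono2) auto
    finally have "norm z powr s / 2 \<le> norm z powr s - l" by simp
    also have "norm z powr s = norm (pw z)" using nz s by (simp add: pw_def norm_powr_real_powr')
    also have "norm (pw z) - l \<le> norm (of_real l - pw z)"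
      using norm_triangle_ineq3[of "pw z" "of_real l"] l by (simp add: norm_minus_commute)
    finally have den: "norm (pw z) / 2 \<le> norm (of_real l - pw z)" .
    have pwpos: "norm (pw z) > 0" using nz by (simp add: pw_def)
    have "norm (h z) = norm z powr (- \<theta>) / norm (of_real l - pw z)"
      by (simp add: h_def pw_def norm_divide norm_powr_real_powr' flip: of_real_minus)
    also have "\<dots> \<le> 1 / (norm (pw z) / 2)"
      using den pwpos nz \<theta> by (intro frac_le) (auto simp: powr_minus inverse_le_1_iff ge_one_powr_ge_zero)
    also have "\<dots> = 2 * norm z powr (- s)"
      using nz by (simp add: pw_def norm_powr_real_powr' powr_minus field_simps)
    finally have "norm (h z) \<le> 2 * norm z powr (- s)" .
    moreover have "norm (G z) \<le> norm (of_real c * (1 / z + 1 / (?t - z))) + norm (h z)"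
      using G_eq[of z] z zt by (simp add: norm_triangle_ineq4)
    ultimately show ?thesis using 1 by (simp add: algebra_simps)
  qed
  note G_int = vertical_line_integral_zero[OF G_holo s(1) _ bound]
  have int_G: "integrable lborel (\<lambda>y. G (Complex 1 y))" and G0: "(LINT y|lborel. G (Complex 1 y)) = 0"
    using G_int[of "2 * t"] t1 by auto
  \<comment> \<open>On Re z = 1 the difference t - z equals \<open>Complex (t - 1) (- y)\<close>; l
    > 1 places the pole t to the right of the line.\<close>
  let ?k = "\<lambda>y. 1 / Complex 1 y + 1 / Complex (t - 1) (- y)"
  have int_k: "integrable lborel ?k"
  proof (rule Bochner_Integration.integrable_bound)
    show "integrable lborel (\<lambda>y. (4 * t / min 1 (t - 1)) * (1 + \<bar>y\<bar>) powr (- 2))"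
      using integrable_one_plus_abs_powr[of 2] by auto
    have "continuous_on UNIV ?k"
      using t1 by (intro continuous_intros continuous_on_Complex continuous_on_compose2[OF continuous_on_Complex[of UNIV "t - 1"]])
        (auto simp: complex_eq_iff)
    then show "?k \<in> borel_measurable lborel" using borel_measurable_continuous_onI by simp
    show "AE y in lborel. norm (?k y) \<le> norm ((4 * t / min 1 (t - 1)) * (1 + \<bar>y\<bar>) powr (- 2))"
    proof (rule AE_I2)
      fix y :: real
      define \<mu> where "\<mu> = min 1 (t - 1)"
      have \<mu>: "\<mu> > 0" "\<mu> \<le> 1" "\<mu> \<le> t - 1" using t1 by (auto simp: \<mu>_def)
      have ne: "Complex 1 y \<noteq> 0" "Complex (t - 1) (- y) \<noteq> 0" using t1 by (auto simp: complex_eq_iff)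
      have A: "norm (Complex 1 y) \<ge> (1 + \<bar>y\<bar>) / 2" by (rule norm_Complex_ge) simp
      have "\<mu> * ((1 + \<bar>y\<bar>) / 2) \<le> (t - 1 + \<bar>y\<bar>) / 2"
      proof -
        have "\<mu> * (1 + \<bar>y\<bar>) \<le> t - 1 + \<bar>y\<bar>"
          using \<mu> mult_right_mono[of \<mu> 1 "\<bar>y\<bar>"] by (simp add: algebra_simps)
        then show ?thesis by simp
      qed
      also have "\<dots> \<le> norm (Complex (t - 1) (- y))"
        using abs_Re_le_cmod[of "Complex (t - 1) (- y)"] abs_Im_le_cmod[of "Complex (t - 1) (- y)"] by auto
      finally have B: "\<mu> * ((1 + \<bar>y\<bar>) / 2) \<le> norm (Complex (t - 1) (- y))" .
      have "?k y = of_real t / (Complex 1 y * Complex (t - 1) (- y))"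
        using ne by (auto simp: divide_simps) (auto simp: complex_eq_iff)
      then have "norm (?k y) = t / (norm (Complex 1 y) * norm (Complex (t - 1) (- y)))"
        using t1 by (simp add: norm_mult norm_divide)
      also have "\<dots> \<le> t / ((1 + \<bar>y\<bar>) / 2 * (\<mu> * ((1 + \<bar>y\<bar>) / 2)))"
        using A B \<mu> t1 ne by (intro divide_left_mono mult_mono mult_pos_pos) auto
      also have "\<dots> = (4 * t / \<mu>) * (1 + \<bar>y\<bar>) powr (- 2)"
        using \<mu> by (simp add: powr_minus powr_numeral field_simps power2_eq_square)
      finally show "norm (?k y) \<le> norm ((4 * t / min 1 (t - 1)) * (1 + \<bar>y\<bar>) powr (- 2))"
        unfolding \<mu>_def real_norm_def by (rule order_trans[OF _ abs_ge_self])
    qed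
  qed
  have "h (Complex 1 y) = of_real c * ?k y - G (Complex 1 y)" for y
  proof -
    have "Complex 1 y \<noteq> ?t" using t1 by (auto simp: complex_eq_iff)
    moreover have "?t - Complex 1 y = Complex (t - 1) (- y)" by (simp add: complex_eq_iff)
    ultimately show ?thesis using G_eq[of "Complex 1 y"] by simp
  qed
  then have "(LINT y|lborel. h (Complex 1 y)) = of_real c * (LINT y|lborel. ?k y) - (LINT y|lborel. G (Complex 1 y))"
    using int_k int_G by (simp del: distrib_left)
  also have "\<dots> = of_real c * (2 * of_real pi)"
    using vertical_line_integral_partial_fractions[OF _ _ int_k] t1 G0 by simp
  also have "c = l powr (- ((s - 1 + \<theta>) / s)) / s"
  proof -
    have "c = t powr (- \<theta> - (s - 1)) / s" by (simp add: c_def powr_diff)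
    also have "t powr (- \<theta> - (s - 1)) = l powr (- ((s - 1 + \<theta>) / s))"
    proof -
      have "1 / s * (- \<theta> - (s - 1)) = - ((s - 1 + \<theta>) / s)" using s by (simp add: field_simps)
      then show ?thesis by (simp only: t_def powr_powr)
    qed
    finally show ?thesis .
  qed
  finally show ?thesis by (simp add: field_simps)
qed

text \<open>The pointwise limit of the rescaled Cauchy integrand. Substituting v = a z^s turns its
  line integral into Hankel's integral of exp(v) v^(-p) with p = (s - 1 + \<theta>)/s.\<close>

definition hankel_kernel :: "real \<Rightarrow> real \<Rightarrow> real \<Rightarrow> complex \<Rightarrow> complex" where
  "hankel_kernel \<theta> s a z = exp (complex_of_real a * z powr complex_of_real s) * z powr complex_of_real (- \<theta>)"

lemma hankel_kernel_holomorphic: "hankel_kernel \<theta> s a holomorphic_on {z. Re z > 0}"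
  unfolding hankel_kernel_def by (intro holomorphic_intros holomorphic_on_powr_halfplane)

lemma norm_hankel_kernel_le:
  assumes a: "a \<ge> 0" and \<theta>: "\<theta> \<ge> 0" and s: "s > 0" and c: "c \<ge> 0" and z: "Re z > 0"
    and sector: "Re (z powr complex_of_real s) \<le> C * Re z powr s - c * norm z powr s"
  shows "norm (hankel_kernel \<theta> s a z) \<le> exp (a * C * Re z powr s) * Re z powr (- \<theta>) * exp (- (a * c) * \<bar>Im z\<bar> powr s)"
proof -
  have "\<bar>Im z\<bar> powr s \<le> norm z powr s" using s by (intro powr_mono2 abs_Im_le_cmod) auto
  then have "c * \<bar>Im z\<bar> powr s \<le> c * norm z powr s" using c by (intro mult_left_mono)
  then have "a * Re (z powr complex_of_real s) \<le> a * (C * Re z powr s - c * \<bar>Im z\<bar> powr s)"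
    using a sector by (intro mult_left_mono) auto
  then have 1: "norm (exp (of_real a * z powr of_real s)) \<le> exp (a * C * Re z powr s) * exp (- (a * c) * \<bar>Im z\<bar> powr s)"
    by (simp add: mult_exp_exp algebra_simps)
  have "norm (z powr complex_of_real (- \<theta>)) = norm z powr (- \<theta>)" by (subst norm_powr_real_powr') auto
  also have "\<dots> \<le> Re z powr (- \<theta>)" using z \<theta> complex_Re_le_cmod by (intro powr_mono2') auto
  finally have "norm (hankel_kernel \<theta> s a z) \<le> (exp (a * C * Re z powr s) * exp (- (a * c) * \<bar>Im z\<bar> powr s)) * Re z powr (- \<theta>)"
    unfolding hankel_kernel_def norm_mult using 1 by (intro mult_mono) auto
  then show ?thesis by (simp only: mult_ac)
qed

lemma hankel_kernel_integrable:
  assumes s: "1 < s" "s < 2" and \<theta>: "\<theta> \<ge> 0" and a: "a > 0" and b: "b > 0"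
  shows "integrable lborel (\<lambda>y. hankel_kernel \<theta> s a (Complex b y))"
proof -
  obtain c C where c: "c > 0" "C > 0"
    and sector: "\<And>z. Re z > 0 \<Longrightarrow> Re (z powr complex_of_real s) \<le> C * Re z powr s - c * norm z powr s"
    using Re_powr_sector_bound[OF s] by blast
  show ?thesis
  proof (rule Bochner_Integration.integrable_bound)
    show "integrable lborel (\<lambda>y. exp (a * C * b powr s) * b powr (- \<theta>) * exp (- (a * c) * \<bar>y\<bar> powr s))"
      using integrable_exp_minus_abs_powr[of "a * c" s] a c s by simp
    show "(\<lambda>y. hankel_kernel \<theta> s a (Complex b y)) \<in> borel_measurable lborel"
      using borel_measurable_continuous_onI[OF continuous_on_vertical_line[OF hankel_kernel_holomorphic b]] by simp
    show "AE y in lborel. norm (hankel_kernel \<theta> s a (Complex b y))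
        \<le> norm (exp (a * C * b powr s) * b powr (- \<theta>) * exp (- (a * c) * \<bar>y\<bar> powr s))"
      using norm_hankel_kernel_le[OF _ \<theta> _ _ _ sector, of a "Complex b _"] a b c s by (intro AE_I2) auto
  qed
qed

lemma hankel_kernel_shift:
  assumes s: "1 < s" "s < 2" and \<theta>: "\<theta> \<ge> 0" and a: "a > 0" and b: "0 < b1" "b1 \<le> b2"
  shows "(LINT y|lborel. hankel_kernel \<theta> s a (Complex b1 y)) = (LINT y|lborel. hankel_kernel \<theta> s a (Complex b2 y))"
proof -
  obtain c C where c: "c > 0" "C > 0"
    and sector: "\<And>z. Re z > 0 \<Longrightarrow> Re (z powr complex_of_real s) \<le> C * Re z powr s - c * norm z powr s"
    using Re_powr_sector_bound[OF s] by blast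
  let ?M = "\<lambda>y. exp (a * C * b2 powr s) * b1 powr (- \<theta>) * exp (- (a * c) * y powr s)"
  show ?thesis
  proof (rule vertical_line_integral_eq[OF hankel_kernel_holomorphic b, where Y = 0 and M = ?M])
    define k where "k = a * c"
    have k: "k > 0" "s > 0" using a c s by (auto simp: k_def)
    show "(?M \<longlongrightarrow> 0) at_top"
      unfolding k_def[symmetric] by (rule tendsto_mult_right_zero) (use k in real_asymp)
    fix x y :: real assume x: "b1 \<le> x" "x \<le> b2"
    have "norm (hankel_kernel \<theta> s a (Complex x y)) \<le> exp (a * C * x powr s) * x powr (- \<theta>) * exp (- (a * c) * \<bar>y\<bar> powr s)"
      using norm_hankel_kernel_le[OF _ \<theta> _ _ _ sector, of a "Complex x y"] a b c s x by simp
    also have "\<dots> \<le> ?M \<bar>y\<bar>"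
    proof (intro mult_right_mono mult_mono)
      have "x powr s \<le> b2 powr s" using x b s by (intro powr_mono2) auto
      then show "exp (a * C * x powr s) \<le> exp (a * C * b2 powr s)" using a c by simp
      show "x powr (- \<theta>) \<le> b1 powr (- \<theta>)" using x b \<theta> by (intro powr_mono2') auto
    qed auto
    finally show "norm (hankel_kernel \<theta> s a (Complex x y)) \<le> ?M \<bar>y\<bar>" .
  qed (use assms in \<open>auto intro!: hankel_kernel_integrable\<close>)
qed

text \<open>Substituting y by b y with a b^s = 1 removes a from the exponential but works on the
  line Re z = b; \<open>hankel_kernel_shift\<close> brings that line back to Re z = 1. What remains
  is b^(1 - \<theta>), that is a^((\<theta> - 1)/s).\<close>

lemma hankel_kernel_scaling:
  assumes s: "1 < s" "s < 2" and \<theta>: "\<theta> \<ge> 0" and a: "a > 0"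
  shows "(LINT y|lborel. hankel_kernel \<theta> s a (Complex 1 y)) =
     of_real (a powr ((\<theta> - 1) / s)) * (LINT y|lborel. hankel_kernel \<theta> s 1 (Complex 1 y))"
proof -
  define b where "b = a powr (- (1 / s))"
  have b: "b > 0" using a by (simp add: b_def)
  have "b powr s = a powr (- 1)" using s by (simp add: b_def powr_powr)
  then have bs: "a * b powr s = 1" using a by (simp add: powr_minus)
  have bt: "b * b powr (- \<theta>) = a powr ((\<theta> - 1) / s)"
    using a s by (simp add: b_def powr_powr diff_divide_distrib flip: powr_add)
  have "hankel_kernel \<theta> s a (Complex b (b * y)) = of_real (b powr (- \<theta>)) * hankel_kernel \<theta> s 1 (Complex 1 y)" for y
  proof -
    have "Complex b (b * y) = of_real b * Complex 1 y" by (simp add: complex_eq_iff)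
    then have *: "Complex b (b * y) powr of_real p = of_real (b powr p) * Complex 1 y powr of_real p" for p
      using b by (simp add: powr_times_real_left powr_of_real)
    have "of_real a * Complex b (b * y) powr of_real s = of_real (a * b powr s) * Complex 1 y powr of_real s"
      by (simp add: * del: of_real_minus)
    then have e: "of_real a * Complex b (b * y) powr of_real s = Complex 1 y powr of_real s"
      by (simp only: bs of_real_1 mult_1_left)
    show ?thesis unfolding hankel_kernel_def e *[of "- \<theta>"] by (simp add: mult_ac)
  qed
  then have "(LINT y|lborel. hankel_kernel \<theta> s a (Complex b y)) =
      of_real (b * b powr (- \<theta>)) * (LINT y|lborel. hankel_kernel \<theta> s 1 (Complex 1 y))"
    using lborel_integral_real_affine[of b "\<lambda>y. hankel_kernel \<theta> s a (Complex b y)" 0] b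
    by (simp add: scaleR_conv_of_real)
  moreover have "(LINT y|lborel. hankel_kernel \<theta> s a (Complex b y)) = (LINT y|lborel. hankel_kernel \<theta> s a (Complex 1 y))"
    using hankel_kernel_shift[OF s \<theta> a, of b 1] hankel_kernel_shift[OF s \<theta> a, of 1 b] b by (cases "b \<le> 1") auto
  ultimately show ?thesis by (simp only: bt)
qed

lemma laplace_transform_powr:
  fixes p l :: real
  assumes p: "p > 0" and l: "l > 0"
  shows "(LINT t|lborel. (if t \<in> {0..} then exp (- l * t) * t powr (p - 1) else 0)) = Gamma p * l powr (- p)"
proof -
  let ?f = "\<lambda>t::real. if t \<in> {0..} then t powr (p - 1) / exp t else 0"
  have G: "((\<lambda>t. t powr (p - 1) / exp t) has_integral Gamma p) {0..}"
    using p by (rule Gamma_integral_real)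
  then have "set_integrable lebesgue {0..} (\<lambda>t. t powr (p - 1) / exp t)"
    by (intro nonnegative_absolutely_integrable_1) auto
  then have "set_integrable lborel {0..} (\<lambda>t. t powr (p - 1) / exp t)"
    by (auto simp: set_integrable_def integrable_completion)
  from set_borel_integral_eq_integral(2)[OF this]
  have "(LINT t|lborel. indicator {0..} t *\<^sub>R (t powr (p - 1) / exp t)) = Gamma p"
    using G by (simp only: set_lebesgue_integral_def integral_unique)
  moreover have "(\<lambda>t. indicator {0..} t *\<^sub>R (t powr (p - 1) / exp t)) = ?f"
    by (auto simp: fun_eq_iff indicator_def)
  ultimately have "(LINT t|lborel. ?f t) = Gamma p"
    by simp
  moreover have "(LINT t|lborel. ?f t) = l * (LINT t|lborel. ?f (l * t))"
    using lborel_integral_real_affine[of l ?f 0, unfolded add_0_left] l by simp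
  moreover have "?f (l * t) = l powr (p - 1) * (if t \<in> {0..} then exp (- l * t) * t powr (p - 1) else 0)" for t
    using l by (auto simp: powr_mult exp_minus field_simps zero_le_mult_iff)
  moreover have "l * l powr (p - 1) = l powr p" using l by (simp add: powr_mult_base)
  ultimately have "Gamma p = l powr p * (LINT t|lborel. (if t \<in> {0..} then exp (- l * t) * t powr (p - 1) else 0))"
    by (simp add: mult.assoc[symmetric])
  then show ?thesis using l by (simp add: powr_minus field_simps)
qed

text \<open>Both sides have the same Laplace transform in \<open>a\<close>; by scaling, one value of the transform suffices.\<close>

lemma hankel_integral:
  assumes s: "1 < s" "s < 2" and \<theta>: "\<theta> \<ge> 0" and a: "a > 0"
  shows "(LINT y|lborel. hankel_kernel \<theta> s a (Complex 1 y)) =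
     of_real (2 * pi * a powr ((\<theta> - 1) / s) / (s * Gamma ((s - 1 + \<theta>) / s)))"
proof -
  obtain c C where c: "c > 0" "C > 0"
    and sector: "\<And>z. Re z > 0 \<Longrightarrow> Re (z powr complex_of_real s) \<le> C * Re z powr s - c * norm z powr s"
    using Re_powr_sector_bound[OF s] by blast
  \<comment> \<open>On Re w = 1 the sector bound reads Re (w^s) \<le> C - c |w|^s. With l = C + 1
    the real part of l - w^s is therefore positive on the whole line, as the inner Laplace integral
    requires.\<close>
  define l where "l = C + 1"
  have l: "l > 1" using c by (simp add: l_def)
  define p where "p = (s - 1 + \<theta>) / s"
  have p: "p > 0" using s \<theta> by (simp add: p_def)
  have p1: "(\<theta> - 1) / s = p - 1" using s by (simp add: p_def field_simps)
  let ?J = "LINT y|lborel. hankel_kernel \<theta> s 1 (Complex 1 y)"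
  define ps where "ps = (\<lambda>y. Complex 1 y powr complex_of_real s)"
  define pt where "pt = (\<lambda>y. Complex 1 y powr complex_of_real (- \<theta>))"
  have meas [measurable]: "ps \<in> borel_measurable borel" "pt \<in> borel_measurable borel"
    unfolding ps_def pt_def
    by (rule borel_measurable_continuous_onI[OF continuous_on_vertical_line[OF holomorphic_on_powr_halfplane]], simp)+
  have low: "c * norm (Complex 1 y) powr s \<le> Re (of_real l - ps y)" for y
    using sector[of "Complex 1 y"] by (simp add: ps_def l_def)
  have pos: "Re (of_real l - ps y) > 0" for y
  proof (rule less_le_trans[OF _ low])
    have "Complex 1 y \<noteq> 0" by (simp add: complex_eq_iff)
    then show "c * norm (Complex 1 y) powr s > 0" using c by simp
  qed
  define E where "E = (\<lambda>y t. (if t \<in> {0..} then exp (- (of_real l - ps y) * of_real t) else 0 :: complex))"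
  define \<Phi> where "\<Phi> = (\<lambda>(y, t). E y t * pt y)"
  have E_int: "integrable lborel (E y)" and E_val: "(LINT t|lborel. E y t) = 1 / (of_real l - ps y)" for y
    unfolding E_def by (rule laplace_transform_exp[OF pos])+
  have normE: "(LINT t|lborel. norm (\<Phi> (y, t))) = norm (pt y) / Re (of_real l - ps y)" for y
  proof -
    let ?w = "complex_of_real (Re (of_real l - ps y))"
    have *: "complex_of_real (norm (E y t)) = (if t \<in> {0..} then exp (- ?w * of_real t) else 0)" for t
    proof -
      have "complex_of_real (exp (- Re (of_real l - ps y) * t)) = exp (- ?w * of_real t)"
        by (simp only: exp_of_real[symmetric] of_real_mult of_real_minus)
      then show ?thesis by (simp add: E_def)
    qed
    have "complex_of_real (LINT t|lborel. norm (E y t)) = (LINT t|lborel. complex_of_real (norm (E y t)))"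
      by (rule integral_complex_of_real[symmetric])
    also have "\<dots> = 1 / ?w"
      unfolding * by (rule laplace_transform_exp(2)) (use pos[of y] in simp)
    also have "\<dots> = complex_of_real (1 / Re (of_real l - ps y))" by (simp only: of_real_divide of_real_1)
    finally have "(LINT t|lborel. norm (E y t)) = 1 / Re (of_real l - ps y)"
      by (simp only: of_real_eq_iff)
    then show ?thesis by (simp add: \<Phi>_def norm_mult)
  qed
  \<comment> \<open>Fubini applies because the integral of the norm over t is at most a multiple of
    (1 + |y|)^(-s), which is integrable by s > 1.\<close>
  have "integrable (lborel \<Otimes>\<^sub>M lborel) \<Phi>"
  proof (rule lborel_pair.Fubini_integrable)
    show "\<Phi> \<in> borel_measurable (lborel \<Otimes>\<^sub>M lborel)"
      unfolding \<Phi>_def E_def by measurable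
    show "integrable lborel (\<lambda>y. LINT t|lborel. norm (\<Phi> (y, t)))"
      unfolding normE
    proof (rule Bochner_Integration.integrable_bound)
      show "integrable lborel (\<lambda>y. 2 powr s / c * (1 + \<bar>y\<bar>) powr (- s))"
        using integrable_one_plus_abs_powr[OF s(1)] by auto
      show "(\<lambda>y. norm (pt y) / Re (of_real l - ps y)) \<in> borel_measurable lborel"
        by measurable
      show "AE y in lborel. norm (norm (pt y) / Re (of_real l - ps y)) \<le> norm (2 powr s / c * (1 + \<bar>y\<bar>) powr (- s))"
      proof (rule AE_I2)
        fix y :: real
        have "norm (pt y) = norm (Complex 1 y) powr (- \<theta>)" unfolding pt_def by (subst norm_powr_real_powr') auto
        also have "\<dots> \<le> 1" using norm_Complex_ge(2)[of 1 y] \<theta>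
          by (simp add: powr_minus inverse_le_1_iff ge_one_powr_ge_zero)
        finally have "norm (pt y) \<le> 1" .
        moreover have "c * ((1 + \<bar>y\<bar>) / 2) powr s \<le> Re (of_real l - ps y)"
          using c s norm_Complex_ge(1)[of 1 y] by (intro order_trans[OF _ low] mult_left_mono powr_mono2) auto
        ultimately have "norm (pt y) / Re (of_real l - ps y) \<le> 1 / (c * ((1 + \<bar>y\<bar>) / 2) powr s)"
          using c by (intro frac_le) auto
        also have "\<dots> = 2 powr s / c * (1 + \<bar>y\<bar>) powr (- s)"
          by (simp add: powr_divide powr_minus field_simps)
        finally show "norm (norm (pt y) / Re (of_real l - ps y)) \<le> norm (2 powr s / c * (1 + \<bar>y\<bar>) powr (- s))"
          using pos[of y] c by simp
      qed
    qed
    show "AE y in lborel. integrable lborel (\<lambda>t. \<Phi> (y, t))"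
      using E_int by (simp add: \<Phi>_def)
  qed
  then have "(LINT t|lborel. LINT y|lborel. E y t * pt y) = (LINT y|lborel. LINT t|lborel. E y t * pt y)"
    using lborel_pair.Fubini_integral[of "\<lambda>y t. E y t * pt y"] by (simp add: \<Phi>_def)
  also have "\<dots> = (LINT y|lborel. pt y / (of_real l - ps y))"
    using E_int by (simp add: E_val)
  also have "\<dots> = of_real (2 * pi / s * l powr (- p))"
    using vertical_line_integral_residue[OF s \<theta> l] by (simp add: pt_def ps_def p_def)
  finally have A: "(LINT t|lborel. LINT y|lborel. E y t * pt y) = of_real (2 * pi / s * l powr (- p))" .
  \<comment> \<open>The scaling law needs a = t > 0. For t < 0 both sides vanish, and t = 0 is
    dropped as a null set.\<close>
  have "(LINT y|lborel. E y t * pt y) = of_real (if t \<in> {0..} then exp (- l * t) * t powr (p - 1) else 0) * ?J" if "t \<noteq> 0" for t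
  proof (cases "t > 0")
    case True
    have "E y t * pt y = of_real (exp (- l * t)) * hankel_kernel \<theta> s t (Complex 1 y)" for y
    proof -
      have "exp (- (of_real l - ps y) * of_real t) = exp (of_real (- l * t)) * exp (of_real t * ps y)"
        by (simp add: mult_exp_exp algebra_simps)
      also have "exp (of_real (- l * t)) = complex_of_real (exp (- l * t))" by (rule exp_of_real)
      finally show ?thesis using True by (simp add: E_def pt_def ps_def hankel_kernel_def)
    qed
    then have "(LINT y|lborel. E y t * pt y) = of_real (exp (- l * t)) * (LINT y|lborel. hankel_kernel \<theta> s t (Complex 1 y))"
      by simp
    also have "\<dots> = of_real (if t \<in> {0..} then exp (- l * t) * t powr (p - 1) else 0) * ?J"
      using hankel_kernel_scaling[OF s \<theta> True] True by (simp add: p1)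
    finally show ?thesis .
  qed (use that in \<open>auto simp: E_def\<close>)
  then have "(LINT t|lborel. LINT y|lborel. E y t * pt y) =
      (LINT t|lborel. of_real (if t \<in> {0..} then exp (- l * t) * t powr (p - 1) else 0) * ?J)"
    by (intro integral_discrete_difference[where X = "{0}"]) auto
  also have "\<dots> = of_real (LINT t|lborel. (if t \<in> {0..} then exp (- l * t) * t powr (p - 1) else 0)) * ?J"
    by (simp only: integral_mult_left_zero integral_complex_of_real)
  also have "\<dots> = of_real (Gamma p * l powr (- p)) * ?J"
    using laplace_transform_powr[OF p, of l] l by simp
  finally have "of_real (Gamma p * l powr (- p)) * ?J = of_real (2 * pi / s * l powr (- p))"
    using A by simp
  moreover have "Gamma p > 0" "l powr (- p) > 0" using p l by (auto intro: Gamma_real_pos)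
  ultimately have "?J = of_real (2 * pi / (s * Gamma p))"
    using s by (simp add: field_simps)
  then show ?thesis
    using hankel_kernel_scaling[OF s \<theta> a] by (simp add: p_def)
qed

section \<open>Cycle-weighted sums over permutations\<close>

definition orbits_on :: "('a \<Rightarrow> 'a) \<Rightarrow> 'a set \<Rightarrow> 'a set set" where
  "orbits_on f A = orbit f ` A"

definition cycle_weight :: "(nat \<Rightarrow> 'c::comm_monoid_mult) \<Rightarrow> ('a \<Rightarrow> 'a) \<Rightarrow> 'a set \<Rightarrow> 'c" where
  "cycle_weight x f A = (\<Prod>c\<in>orbits_on f A. x (card c))"

text \<open>Stated for arbitrary sets because splitting off an orbit from {1..N} leaves a set that
  is no longer an initial segment.\<close>

definition cycle_sum :: "(nat \<Rightarrow> 'c::comm_semiring_1) \<Rightarrow> 'a set \<Rightarrow> 'c" where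
  "cycle_sum x A = (\<Sum>f | f permutes A. cycle_weight x f A)"

definition cyclic_perms :: "'a set \<Rightarrow> ('a \<Rightarrow> 'a) set" where
  "cyclic_perms C = {f. f permutes C \<and> cyclic_on f C}"

lemma orbit_permutes_eq:
  assumes "finite A" "f permutes A"
  shows "orbit f x = range (\<lambda>k. (f ^^ k) x)"
  using orbit_altdef_permutation[of f x] assms permutation_permutes by fastforce

lemma orbit_comp_disjoint:
  assumes "finite A" "g permutes C" "h permutes A - C" "C \<subseteq> A"
  shows "x \<in> C \<Longrightarrow> orbit (g \<circ> h) x = orbit g x"
    and "x \<in> A - C \<Longrightarrow> orbit (g \<circ> h) x = orbit h x"
proof -
  have g: "g \<in> C \<rightarrow> C" "\<And>y. y \<notin> C \<Longrightarrow> g y = y"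
    using assms(2) by (auto simp: permutes_in_image permutes_not_in)
  have h: "h \<in> A - C \<rightarrow> A - C" "\<And>y. y \<in> C \<Longrightarrow> h y = y"
    using assms(3,4) permutes_in_image[OF assms(3)] by (auto simp: permutes_not_in)
  show "orbit (g \<circ> h) x = orbit g x" if "x \<in> C"
    using orbit_cong0[of x C g "g \<circ> h"] g h that by auto
  have "h y = (g \<circ> h) y" if "y \<in> A - C" for y
    using funcset_mem[OF h(1) that] g(2)[of "h y"] by auto
  then show "orbit (g \<circ> h) x = orbit h x" if "x \<in> A - C"
    using orbit_cong0[OF that h(1), of "g \<circ> h"] by simp
qed

text \<open>The two factors act on disjoint invariant sets, so C becomes one orbit and the others
  are those of h. As C is nonempty and orbits of h on A - C stay in A - C, C is not counted
  twice.\<close>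

lemma cycle_weight_comp:
  assumes "finite A" "g \<in> cyclic_perms C" "h permutes A - C" "C \<subseteq> A" "C \<noteq> {}"
  shows "cycle_weight x (g \<circ> h) A = x (card C) * cycle_weight x h (A - C)"
proof -
  have g: "g permutes C" "cyclic_on g C" using assms(2) by (auto simp: cyclic_perms_def)
  have "orbits_on (g \<circ> h) A = insert C (orbits_on h (A - C))"
  proof -
    have "orbit (g \<circ> h) ` A = orbit (g \<circ> h) ` C \<union> orbit (g \<circ> h) ` (A - C)"
      using assms(4) by blast
    also have "orbit (g \<circ> h) ` C = {C}"
      using orbit_comp_disjoint(1)[OF assms(1) g(1) assms(3,4)] orbit_cyclic_eq3[OF g(2)] assms(5) by (auto simp: image_iff)
    also have "orbit (g \<circ> h) ` (A - C) = orbit h ` (A - C)"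
      using orbit_comp_disjoint(2)[OF assms(1) g(1) assms(3,4)] by (intro image_cong) auto
    finally show ?thesis unfolding orbits_on_def by (simp only: Un_insert_left Un_empty_left)
  qed
  moreover have "C \<notin> orbits_on h (A - C)"
    using permutes_orbit_subset[OF assms(3)] assms(5) by (auto simp: orbits_on_def)
  moreover have "finite (orbits_on h (A - C))" using assms(1) by (simp add: orbits_on_def)
  ultimately show ?thesis by (simp add: cycle_weight_def)
qed

text \<open>The inverse map sends f to the orbit C of a and to its restrictions to C and to A - C:
  the first is cyclic on C by the choice of C, the second permutes the rest because C is
  invariant.\<close>

lemma permutes_split_orbit_bij:
  assumes A: "finite A" and a: "a \<in> A"
  shows "bij_betw (\<lambda>(C, g, h). g \<circ> h)
     (SIGMA C:{C. a \<in> C \<and> C \<subseteq> A}. cyclic_perms C \<times> {h. h permutes A - C}) {f. f permutes A}"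
proof (rule bij_betw_byWitness[where f' = "\<lambda>f. (orbit f a, perm_restrict f (orbit f a), perm_restrict f (A - orbit f a))"])
  let ?D = "SIGMA C:{C. a \<in> C \<and> C \<subseteq> A}. cyclic_perms C \<times> {h. h permutes A - C}"
  show "\<forall>d\<in>?D. (\<lambda>f. (orbit f a, perm_restrict f (orbit f a), perm_restrict f (A - orbit f a))) ((\<lambda>(C, g, h). g \<circ> h) d) = d"
  proof (clarsimp simp: cyclic_perms_def)
    fix C g h assume *: "a \<in> C" "C \<subseteq> A" "g permutes C" "cyclic_on g C" "h permutes A - C"
    have C: "orbit (g \<circ> h) a = C"
      using orbit_comp_disjoint(1)[OF A *(3,5,2,1)] orbit_cyclic_eq3[OF *(4,1)] by simp
    have "perm_restrict (g \<circ> h) C = g"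
      using permutes_not_in[OF *(3)] permutes_not_in[OF *(5)] by (auto simp: fun_eq_iff perm_restrict_def)
    moreover have "perm_restrict (g \<circ> h) (A - C) = h"
      using permutes_in_image[OF *(5)] permutes_not_in[OF *(3)] permutes_not_in[OF *(5)] *(2)
      by (auto simp: fun_eq_iff perm_restrict_def)
    ultimately show "orbit (g \<circ> h) a = C \<and> perm_restrict (g \<circ> h) (orbit (g \<circ> h) a) = g \<and>
        perm_restrict (g \<circ> h) (A - orbit (g \<circ> h) a) = h"
      using C by simp
  qed
  have dec: "orbit f a \<subseteq> A" "a \<in> orbit f a" "cyclic_on f (orbit f a)" if "f permutes A" for f
    using that A a permutes_orbit_subset cyclic_on_orbit permutation_self_in_orbit permutation_permutes by fast+
  have restr: "perm_restrict f (orbit f a) permutes orbit f a" "perm_restrict f (A - orbit f a) permutes A - orbit f a"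
    if "f permutes A" for f
  proof -
    show "perm_restrict f (A - orbit f a) permutes A - orbit f a"
      using perm_restrict_diff_cyclic[OF that dec(3)[OF that]] .
    have "f ` orbit f a \<subseteq> orbit f a" by (auto intro: orbit.intros)
    moreover have "inj_on f (orbit f a)" using that permutes_inj by (blast intro: inj_on_subset)
    moreover have "finite (orbit f a)" using dec(1)[OF that] A finite_subset by blast
    ultimately have "bij_betw f (orbit f a) (orbit f a)"
      by (simp add: bij_betw_def endo_inj_surj)
    then show "perm_restrict f (orbit f a) permutes orbit f a"
      by (intro bij_imp_permutes) (auto simp: perm_restrict_def cong: bij_betw_cong)
  qed
  show "\<forall>f\<in>{f. f permutes A}. (\<lambda>(C, g, h). g \<circ> h) (orbit f a, perm_restrict f (orbit f a), perm_restrict f (A - orbit f a)) = f"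
  proof (clarsimp simp: fun_eq_iff)
    fix f x assume f: "f permutes A"
    have "f x \<in> A - orbit f a" if "x \<in> A - orbit f a"
      using that restr(2)[OF f] permutes_in_image[OF restr(2)[OF f], of x] by (simp add: perm_restrict_def)
    then show "perm_restrict f (orbit f a) (perm_restrict f (A - orbit f a) x) = f x"
      using f dec(1)[OF f] by (auto simp: perm_restrict_def permutes_not_in)
  qed
  show "(\<lambda>(C, g, h). g \<circ> h) ` ?D \<subseteq> {f. f permutes A}"
    by (auto simp: cyclic_perms_def intro!: permutes_compose intro: permutes_subset)
  show "(\<lambda>f. (orbit f a, perm_restrict f (orbit f a), perm_restrict f (A - orbit f a))) ` {f. f permutes A} \<subseteq> ?D"
    using dec restr by (auto simp: cyclic_perms_def cyclic_on_perm_restrict)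
qed

lemma cycle_sum_split:
  assumes "finite A" "a \<in> A"
  shows "cycle_sum x A = (\<Sum>C | a \<in> C \<and> C \<subseteq> A. of_nat (card (cyclic_perms C)) * x (card C) * cycle_sum x (A - C))"
proof -
  have fin: "finite {C. a \<in> C \<and> C \<subseteq> A}" using assms by (auto intro: finite_subset[of _ "Pow A"])
  have fin2: "finite (cyclic_perms C)" if "C \<subseteq> A" for C
    using that assms(1) finite_subset[of C A] finite_permutations[of C]
    by (auto simp: cyclic_perms_def intro: finite_subset[of _ "{f. f permutes C}"])
  have "cycle_sum x A = (\<Sum>(C, g, h) \<in> (SIGMA C:{C. a \<in> C \<and> C \<subseteq> A}. cyclic_perms C \<times> {h. h permutes A - C}). cycle_weight x (g \<circ> h) A)"
    unfolding cycle_sum_def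
    using sum.reindex_bij_betw[OF permutes_split_orbit_bij[OF assms], of "\<lambda>f. cycle_weight x f A"]
    by (simp add: case_prod_unfold)
  also have "\<dots> = (\<Sum>(C, g, h) \<in> (SIGMA C:{C. a \<in> C \<and> C \<subseteq> A}. cyclic_perms C \<times> {h. h permutes A - C}). x (card C) * cycle_weight x h (A - C))"
    using cycle_weight_comp[OF assms(1)] by (intro sum.cong refl) force
  also have "\<dots> = (\<Sum>C | a \<in> C \<and> C \<subseteq> A. \<Sum>(g, h) \<in> cyclic_perms C \<times> {h. h permutes A - C}. x (card C) * cycle_weight x h (A - C))"
    using fin fin2 assms(1) by (subst sum.Sigma) (auto intro!: finite_cartesian_product finite_permutations)
  also have "\<dots> = (\<Sum>C | a \<in> C \<and> C \<subseteq> A. of_nat (card (cyclic_perms C)) * x (card C) * cycle_sum x (A - C))"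
    by (intro sum.cong refl)
       (simp add: cycle_sum_def sum_distrib_left mult.assoc flip: sum.cartesian_product)
  finally show ?thesis .
qed

text \<open>Deleting a makes C an arbitrary k-subset of A - {a}; hence the binomial over |A| - 1 and
  the shifted index \<open>Suc k\<close>.\<close>

lemma sum_subsets_containing:
  fixes F :: "nat \<Rightarrow> 'c::comm_semiring_1"
  assumes "finite A" "a \<in> A"
  shows "(\<Sum>C | a \<in> C \<and> C \<subseteq> A. F (card C)) = (\<Sum>k<card A. of_nat ((card A - 1) choose k) * F (Suc k))"
proof -
  have "(\<Sum>C | a \<in> C \<and> C \<subseteq> A. F (card C)) = (\<Sum>B\<in>Pow (A - {a}). F (Suc (card B)))"
  proof (rule sum.reindex_bij_witness[where j = "\<lambda>C. C - {a}" and i = "insert a"])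
    fix C assume "C \<in> {C. a \<in> C \<and> C \<subseteq> A}"
    then show "F (Suc (card (C - {a}))) = F (card C)"
      using assms(1) by (metis (lifting) card.remove finite_subset mem_Collect_eq)
  qed (use assms in auto)
  also have "\<dots> = (\<Sum>k<card A. \<Sum>B | B \<in> Pow (A - {a}) \<and> card B = k. F (Suc (card B)))"
  proof (rule sum.group[symmetric, unfolded Int_def mem_Collect_eq] , goal_cases)
    case 3
    have "card B < card A" if "B \<subseteq> A - {a}" for B
      using that assms by (intro psubset_card_mono) auto
    then show ?case by auto
  qed (use assms in auto)
  also have "\<dots> = (\<Sum>k<card A. of_nat ((card A - 1) choose k) * F (Suc k))"
  proof (intro sum.cong refl)
    fix k assume "k \<in> {..<card A}"
    have "card {B. B \<in> Pow (A - {a}) \<and> card B = k} = (card A - 1) choose k"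
      using assms by (simp add: n_subsets)
    then show "(\<Sum>B | B \<in> Pow (A - {a}) \<and> card B = k. F (Suc (card B))) = of_nat ((card A - 1) choose k) * F (Suc k)"
      by simp
  qed
  finally show ?thesis .
qed

section \<open>The number of cyclic permutations and the recurrence for cycle sums\<close>

lemma cycle_sum_one:
  "finite A \<Longrightarrow> cycle_sum (\<lambda>_. 1::nat) A = fact (card A)"
  by (simp add: cycle_sum_def cycle_weight_def card_permutations[OF refl])

text \<open>With all weights equal to 1, splitting off the orbit of a point counts all permutations; this
  recurrence determines the number of cyclic ones.\<close>

lemma card_cyclic_perms:
  assumes "finite C" "card C = Suc n"
  shows "card (cyclic_perms C) = fact n"
  using assms
proof (induction n arbitrary: C rule: less_induct)
  case (less n C)
  from less.prems obtain a where a: "a \<in> C" by fastforce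
  have Cin: "C \<in> {B. a \<in> B \<and> B \<subseteq> C}" using a by simp
  have fin: "finite {B. a \<in> B \<and> B \<subseteq> C}" using less.prems by (auto intro: finite_subset[of _ "Pow C"])
  \<comment> \<open>The summand for a set B of size k, if the count is (k - 1)!. For proper subsets
    B this is the induction hypothesis; for B = C it is the claim, with value n!.\<close>
  let ?F = "\<lambda>k. fact (k - 1) * fact (Suc n - k) :: nat"
  have val: "card (cyclic_perms B) * fact (card (C - B)) = ?F (card B)" if "a \<in> B" "B \<subset> C" for B
  proof -
    have "card B < Suc n" using that less.prems psubset_card_mono[of C B] by simp
    moreover have "finite B" using that less.prems finite_subset by blast
    moreover have "B \<noteq> {}" using that by auto
    then obtain m where "card B = Suc m"
      using \<open>finite B\<close> by (cases "card B") auto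
    ultimately have "card (cyclic_perms B) = fact (card B - 1)"
      using less.IH[of m B] by simp
    then show ?thesis using that \<open>finite B\<close> less.prems by (simp add: card_Diff_subset)
  qed
  have "fact (Suc n) = cycle_sum (\<lambda>_. 1::nat) C" using less.prems cycle_sum_one[of C] by simp
  also have "\<dots> = (\<Sum>B | a \<in> B \<and> B \<subseteq> C. card (cyclic_perms B) * fact (card (C - B)))"
    using less.prems a by (subst cycle_sum_split[OF _ a]) (auto simp: cycle_sum_one simp del: One_nat_def intro!: sum.cong)
  also have "\<dots> = card (cyclic_perms C) + (\<Sum>B \<in> {B. a \<in> B \<and> B \<subseteq> C} - {C}. card (cyclic_perms B) * fact (card (C - B)))"
    using fin Cin by (subst sum.remove[of _ C]) auto
  also have "(\<Sum>B \<in> {B. a \<in> B \<and> B \<subseteq> C} - {C}. card (cyclic_perms B) * fact (card (C - B))) = (\<Sum>B \<in> {B. a \<in> B \<and> B \<subseteq> C} - {C}. ?F (card B))"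
    using val by (intro sum.cong) auto
  \<comment> \<open>From here n! is added on both sides of the chain: it is the missing term of
    \<open>?F\<close> for B = C, and it completes the sum to all subsets containing a. Each size
    then contributes n!, in total (n + 1) n!.\<close>
  also have "card (cyclic_perms C) + \<dots> + fact n = card (cyclic_perms C) + (\<Sum>B | a \<in> B \<and> B \<subseteq> C. ?F (card B))"
    using fin Cin less.prems by (subst (2) sum.remove[of _ C]) auto
  also have "(\<Sum>B | a \<in> B \<and> B \<subseteq> C. ?F (card B)) = (\<Sum>k<Suc n. (n choose k) * ?F (Suc k))"
    using sum_subsets_containing[OF less.prems(1) a, of ?F] less.prems by simp
  also have "\<dots> = (\<Sum>k<Suc n. fact n)"
  proof (intro sum.cong refl)
    fix k assume "k \<in> {..<Suc n}"
    then show "(n choose k) * ?F (Suc k) = fact n"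
      using binomial_fact_lemma[of k n] by (simp add: ac_simps)
  qed
  also have "\<dots> = fact (Suc n)" by simp
  finally show ?case by simp
qed

text \<open>A set of size k + 1 carries k! cyclic permutations, which cancels the k! of the binomial
  coefficient. T is left abstract so that the expansion can be used inside the induction proving
  that cycle sums depend on cardinality alone, and again afterwards.\<close>

lemma cycle_sum_expand:
  fixes x :: "nat \<Rightarrow> real"
  assumes A: "finite A" "a \<in> A"
    and T: "\<And>C. a \<in> C \<Longrightarrow> C \<subseteq> A \<Longrightarrow> cycle_sum x (A - C) = T (card A - card C)"
  shows "cycle_sum x A = fact (card A - 1) * (\<Sum>k<card A. x (Suc k) * (T (card A - Suc k) / fact (card A - Suc k)))"
proof -
  let ?F = "\<lambda>k. fact (k - 1) * x k * T (card A - k)"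
  have "cycle_sum x A = (\<Sum>C | a \<in> C \<and> C \<subseteq> A. ?F (card C))"
  proof (subst cycle_sum_split[OF A], intro sum.cong refl)
    fix C assume C: "C \<in> {C. a \<in> C \<and> C \<subseteq> A}"
    then have fC: "finite C" "C \<noteq> {}" using A finite_subset by auto
    then have "card (cyclic_perms C) = fact (card C - 1)"
      by (intro card_cyclic_perms) (auto simp: card_gt_0_iff)
    then show "of_nat (card (cyclic_perms C)) * x (card C) * cycle_sum x (A - C) = ?F (card C)"
      using T C by simp
  qed
  also have "\<dots> = (\<Sum>k<card A. of_nat ((card A - 1) choose k) * ?F (Suc k))"
    by (rule sum_subsets_containing[OF A])
  also have "\<dots> = (\<Sum>k<card A. fact (card A - 1) * (x (Suc k) * (T (card A - Suc k) / fact (card A - Suc k))))"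
  proof (intro sum.cong refl)
    fix k assume "k \<in> {..<card A}"
    then have "real ((card A - 1) choose k) = fact (card A - 1) / (fact k * fact (card A - Suc k))"
      by (subst binomial_fact) auto
    then show "of_nat ((card A - 1) choose k) * ?F (Suc k)
        = fact (card A - 1) * (x (Suc k) * (T (card A - Suc k) / fact (card A - Suc k)))"
      by simp
  qed
  finally show ?thesis by (simp add: sum_distrib_left)
qed

text \<open>Strong induction on size: the complements A - C are smaller, so both sides expand into
  the same expression in the same T. No conjugation by a bijection is involved.\<close>

lemma cycle_sum_card:
  fixes x :: "nat \<Rightarrow> real" and A :: "nat set"
  assumes "finite A"
  shows "cycle_sum x A = cycle_sum x {1..card A}"
  using assms
proof (induction "card A" arbitrary: A rule: less_induct)
  case (less A)
  show ?case
  proof (cases "A = {}")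
    case False
    then obtain a where a: "a \<in> A" by blast
    define B where "B = {1..card A}"
    have B: "finite B" "card B = card A" "1 \<in> B"
      using False less.prems by (auto simp: B_def Suc_le_eq card_gt_0_iff)
    have T: "cycle_sum x (D - C) = cycle_sum x {1..card D - card C}"
      if "finite D" "card D = card A" "d \<in> C" "C \<subseteq> D" for D C :: "nat set" and d
    proof -
      have "finite C" using that finite_subset by blast
      then have "card (D - C) = card D - card C" using that by (simp add: card_Diff_subset)
      moreover have "card (D - C) < card A"
        using that psubset_card_mono[of D "D - C"] by auto
      ultimately show ?thesis using less.hyps[of "D - C"] that by simp
    qed
    show ?thesis
      using cycle_sum_expand[OF less.prems a, of x "\<lambda>n. cycle_sum x {1..n}"]
        cycle_sum_expand[OF B(1,3), of x "\<lambda>n. cycle_sum x {1..n}"] T[OF less.prems] T[OF B(1,2)] B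
      unfolding B_def[symmetric] by simp
  qed auto
qed

lemma cycle_sum_recurrence:
  fixes x :: "nat \<Rightarrow> real"
  defines "S \<equiv> (\<lambda>n. cycle_sum x {1..n::nat} / fact n)"
  shows "real (Suc n) * S (Suc n) = (\<Sum>k\<le>n. x (Suc k) * S (n - k))"
proof -
  have "cycle_sum x ({1..Suc n} - C) = cycle_sum x {1..card {1..Suc n} - card C}" if "C \<subseteq> {1..Suc n}" for C
    using that finite_subset[OF that] by (subst cycle_sum_card) (auto simp: card_Diff_subset)
  from cycle_sum_expand[of "{1..Suc n}" 1 x "\<lambda>n. cycle_sum x {1..n}", OF _ _ this]
  have "cycle_sum x {1..Suc n} = fact n * (\<Sum>k<Suc n. x (Suc k) * S (n - k))"
    by (simp add: S_def)
  then show ?thesis by (simp add: S_def lessThan_Suc_atMost divide_simps del: sum.lessThan_Suc)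
qed

text \<open>Grouping the orbits of a permutation by size turns the product over orbits into powers.
  For a permutation of a finite set the forward iterates counted by \<open>ncycles\<close> already
  form the full orbit.\<close>

lemma H_eq_cycle_sum:
  "H \<theta> \<kappa> N = cycle_sum (\<lambda>j. \<theta> j + real N * \<kappa> j) {1..N} / fact N"
proof -
  have "(\<Prod>j=1..N. x j ^ ncycles N f j) = cycle_weight x f {1..N}" if f: "f permutes {1..N}" for f and x :: "nat \<Rightarrow> real"
  proof -
    have n: "ncycles N f j = card {c \<in> orbits_on f {1..N}. card c = j}" for j
      unfolding ncycles_def orbits_on_def orbit_permutes_eq[OF _ f, simplified]
      by (rule arg_cong[where f = card]) auto
    have perm: "permutation f" using f by (auto simp: permutation_permutes)
    have "card ` orbits_on f {1..N} \<subseteq> {1..N}"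
    proof -
      have "orbit f y \<subseteq> {1..N}" "y \<in> orbit f y" if "y \<in> {1..N}" for y
        using permutes_orbit_subset[OF f that] permutation_self_in_orbit[OF perm] by auto
      then have "card (orbit f y) \<in> {1..N}" if "y \<in> {1..N}" for y
        using that card_mono[of "{1..N}" "orbit f y"] finite_subset[of "orbit f y" "{1..N}"]
        by (force simp: Suc_le_eq card_gt_0_iff)
      then show ?thesis by (auto simp: orbits_on_def)
    qed
    then have "cycle_weight x f {1..N} = (\<Prod>j=1..N. \<Prod>c | c \<in> orbits_on f {1..N} \<and> card c = j. x (card c))"
      unfolding cycle_weight_def by (subst prod.group) (auto simp: orbits_on_def)
    also have "\<dots> = (\<Prod>j=1..N. x j ^ ncycles N f j)" by (simp add: n)
    finally show ?thesis ..
  qed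
  then show ?thesis by (simp add: H_def cycle_sum_def)
qed

section \<open>Exponentials of power series and their coefficients\<close>

lemma fps_exp_recurrence:
  fixes g :: "complex \<Rightarrow> complex"
  assumes g: "g has_fps_expansion G"
  defines "A \<equiv> fps_expansion (\<lambda>z. exp (g z)) 0"
  shows "(\<lambda>z. exp (g z)) has_fps_expansion A"
    and "of_nat (Suc n) * fps_nth A (Suc n) = (\<Sum>k\<le>n. of_nat (Suc k) * fps_nth G (Suc k) * fps_nth A (n - k))"
proof -
  obtain U where U: "open U" "0 \<in> U" "g holomorphic_on U"
    using has_fps_expansion_imp_holomorphic[OF g] by metis
  then have "(\<lambda>z. exp (g z)) analytic_on {0}"
    using analytic_at by (blast intro: holomorphic_intros)
  then show A: "(\<lambda>z. exp (g z)) has_fps_expansion A"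
    unfolding A_def by (rule analytic_at_imp_has_fps_expansion_0)
  have "\<forall>\<^sub>F z in nhds 0. z \<in> U" using U by (intro eventually_nhds_in_open)
  then have ev: "\<forall>\<^sub>F z in nhds 0. deriv (\<lambda>z. exp (g z)) z = deriv g z * exp (g z)"
  proof eventually_elim
    case (elim z)
    then have "(g has_field_derivative deriv g z) (at z)"
      using U by (intro holomorphic_derivI) auto
    then have "((\<lambda>z. exp (g z)) has_field_derivative (deriv g z * exp (g z))) (at z)"
      by (auto intro!: derivative_eq_intros)
    then show ?case by (rule DERIV_imp_deriv)
  qed
  have "(\<lambda>z. deriv g z * exp (g z)) has_fps_expansion fps_deriv G * A"
    by (intro has_fps_expansion_mult has_fps_expansion_deriv g A)
  then have "deriv (\<lambda>z. exp (g z)) has_fps_expansion fps_deriv G * A"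
    using has_fps_expansion_cong[OF ev refl] by blast
  moreover have "deriv (\<lambda>z. exp (g z)) has_fps_expansion fps_deriv A"
    by (rule has_fps_expansion_deriv[OF A])
  ultimately have "fps_deriv A = fps_deriv G * A"
    by (metis fps_nth_fps_expansion fps_ext)
  then have "fps_nth (fps_deriv A) n = fps_nth (fps_deriv G * A) n" by simp
  then show "of_nat (Suc n) * fps_nth A (Suc n) = (\<Sum>k\<le>n. of_nat (Suc k) * fps_nth G (Suc k) * fps_nth A (n - k))"
    by (simp add: fps_mult_nth atLeast0AtMost)
qed

lemma gser_has_fps_expansion:
  assumes "conv_radius (gcoef c) > 0"
  shows "gser c has_fps_expansion Abs_fps (gcoef c)"
proof -
  have "gser c = eval_fps (Abs_fps (gcoef c))" by (simp add: gser_def eval_fps_def fun_eq_iff)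
  then show ?thesis
    using eval_fps_has_fps_expansion[of "Abs_fps (gcoef c)"] assms by (simp add: fps_conv_radius_def)
qed

text \<open>The weights depend on N, so N is fixed while the induction runs over the coefficient
  index n; both sequences obey one recurrence and start with 1.\<close>

lemma zcoeff_exp_gser:
  assumes "conv_radius (gcoef \<theta>) > 0" "conv_radius (gcoef \<kappa>) > 0"
  shows "zcoeff N (\<lambda>z. exp (gser \<theta> z + of_nat N * gser \<kappa> z)) = of_real (H \<theta> \<kappa> N)"
proof -
  define x where "x = (\<lambda>j. \<theta> j + real N * \<kappa> j)"
  let ?g = "\<lambda>z. gser \<theta> z + of_nat N * gser \<kappa> z"
  let ?G = "Abs_fps (gcoef \<theta>) + fps_const (of_nat N) * Abs_fps (gcoef \<kappa>)"
  let ?A = "fps_expansion (\<lambda>z. exp (?g z)) 0"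
  have g: "?g has_fps_expansion ?G"
    by (intro fps_expansion_intros gser_has_fps_expansion assms)
  note A = fps_exp_recurrence[OF g]
  have G: "of_nat (Suc k) * fps_nth ?G (Suc k) = of_real (x (Suc k))" for k
    by (simp add: gcoef_def x_def field_simps del: of_nat_Suc)
  have "fps_nth ?A n = of_real (cycle_sum x {1..n} / fact n)" for n
  proof (induction n rule: less_induct)
    case (less n)
    show ?case
    proof (cases n)
      case 0
      have "fps_nth ?A 0 = exp (?g 0)" using fps_nth_fps_expansion[OF A(1), of 0] by simp
      moreover have "gser c 0 = 0" for c by (simp only: gser_def powser_zero) (simp add: gcoef_def)
      ultimately show ?thesis using 0
        by (simp add: cycle_sum_def cycle_weight_def orbits_on_def)
    next
      case (Suc m)
      have "of_nat (Suc m) * fps_nth ?A (Suc m) = (\<Sum>k\<le>m. of_real (x (Suc k)) * of_real (cycle_sum x {1..m - k} / fact (m - k)))"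
        unfolding A(2) G using less Suc by (intro sum.cong) auto
      also have "\<dots> = of_real (real (Suc m) * (cycle_sum x {1..Suc m} / fact (Suc m)))"
        unfolding cycle_sum_recurrence by simp
      also have "\<dots> = of_nat (Suc m) * of_real (cycle_sum x {1..Suc m} / fact (Suc m))"
        by (simp only: of_real_mult of_real_of_nat_eq)
      finally show ?thesis unfolding Suc by (simp only: mult_cancel_left of_nat_eq_0_iff nat.simps simp_thms)
    qed
  qed
  then show ?thesis
    using fps_nth_fps_expansion[OF A(1), of N] by (simp add: zcoeff_def H_eq_cycle_sum x_def)
qed

section \<open>Power series with nonnegative coefficients\<close>

text \<open>The real counterpart of \<open>gser\<close>. It is evaluated also at r = R, where it
  stands for the boundary value g_kappa(R).\<close>

definition rser :: "(nat \<Rightarrow> real) \<Rightarrow> real \<Rightarrow> real" where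
  "rser c r = (\<Sum>j. c j / real j * r ^ j)"

lemma coef_term_mono:
  fixes c :: "nat \<Rightarrow> real"
  assumes "\<forall>j\<ge>1. c j \<ge> 0" "0 \<le> r" "r \<le> r'"
  shows "c j / real j * r ^ j \<le> c j / real j * r' ^ j"
proof (rule mult_left_mono)
  show "c j / real j \<ge> 0" using assms(1) by (cases "j = 0") auto
qed (use assms in \<open>auto intro: power_mono\<close>)

lemma norm_gcoef_term:
  assumes "\<forall>j\<ge>1. c j \<ge> 0"
  shows "norm (gcoef c j * z ^ j) = c j / real j * norm z ^ j"
  using assms by (cases "j = 0") (auto simp: gcoef_def norm_mult norm_power norm_divide)

lemma coef_term_nonneg:
  assumes "\<forall>j\<ge>1. (c :: nat \<Rightarrow> real) j \<ge> 0" "r \<ge> 0"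
  shows "c j / real j * r ^ j \<ge> 0"
  using assms by (cases "j = 0") auto

context
  fixes c :: "nat \<Rightarrow> real" and R :: real
  assumes c_nonneg: "\<forall>j\<ge>1. c j \<ge> 0" and radius: "conv_radius (gcoef c) = ereal R"
begin

lemma summable_rser:
  assumes "0 \<le> r" "r < R"
  shows "summable (\<lambda>j. c j / real j * r ^ j)"
proof -
  have "ereal (norm (complex_of_real r)) < conv_radius (gcoef c)" using assms radius by simp
  then show ?thesis
    using abs_summable_in_conv_radius[of "complex_of_real r" "gcoef c"] assms
    by (simp add: norm_gcoef_term[OF c_nonneg])
qed

lemma sums_gser:
  assumes "norm z < R"
  shows "(\<lambda>j. gcoef c j * z ^ j) sums gser c z"
  unfolding gser_def using assms radius by (intro summable_sums summable_in_conv_radius) simp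

lemma gser_of_real:
  assumes "0 \<le> r" "r < R"
  shows "gser c (of_real r) = of_real (rser c r)"
proof -
  have "(\<lambda>j. of_real (c j / real j * r ^ j)) sums complex_of_real (rser c r)"
    unfolding rser_def by (intro sums_of_real summable_sums summable_rser assms)
  moreover have "(\<lambda>j. gcoef c j * of_real r ^ j) = (\<lambda>j. of_real (c j / real j * r ^ j))"
    by (simp add: gcoef_def fun_eq_iff)
  ultimately show ?thesis using sums_gser[of "of_real r"] assms sums_unique2 by fastforce
qed

lemma gser_holomorphic: "gser c holomorphic_on ball 0 R"
proof -
  have "gser c = eval_fps (Abs_fps (gcoef c))" by (simp add: gser_def eval_fps_def fun_eq_iff)
  then show ?thesis
    using holomorphic_on_eval_fps[of "ball 0 R" "Abs_fps (gcoef c)"] radius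
    by (simp add: fps_conv_radius_def eball_def ball_def dist_norm subset_eq)
qed

lemma Re_gser_sums:
  assumes "norm z < R"
  shows "(\<lambda>j. c j / real j * norm z ^ j * cos (real j * Arg z)) sums Re (gser c z)"
proof -
  have "z ^ j = rcis (norm z ^ j) (real j * Arg z)" for j
    by (simp flip: DeMoivre2 add: rcis_cmod_Arg)
  then have "Re (gcoef c j * z ^ j) = c j / real j * norm z ^ j * cos (real j * Arg z)" for j
    by (simp add: gcoef_def)
  then show ?thesis using sums_Re[OF sums_gser[OF assms]] by simp
qed

lemma Re_gser_le:
  assumes "norm z < R"
  shows "Re (gser c z) \<le> rser c (norm z)"
  unfolding rser_def
proof (rule sums_le[OF _ Re_gser_sums[OF assms] summable_sums[OF summable_rser[OF norm_ge_zero assms]]])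
  show "c j / real j * norm z ^ j * cos (real j * Arg z) \<le> c j / real j * norm z ^ j" for j
    using coef_term_nonneg[OF c_nonneg, of "norm z" j] by (intro mult_left_le) auto
qed

lemma rser_nonneg: "0 \<le> r \<Longrightarrow> r < R \<Longrightarrow> rser c r \<ge> 0"
  unfolding rser_def by (intro suminf_nonneg summable_rser coef_term_nonneg c_nonneg)

text \<open>Each partial sum is a polynomial in r that stays below B for r < R; letting r tend to R
  bounds the partial sums at R, whose terms are nonnegative.\<close>

lemma bounded_imp_summable_boundary:
  assumes "R > 0" "\<forall>\<^sub>F r in at_left R. rser c r \<le> B"
  shows "summable (\<lambda>j. c j / real j * R ^ j)"
proof (rule summableI_nonneg_bounded)
  show "c j / real j * R ^ j \<ge> 0" for j using coef_term_nonneg[OF c_nonneg] assms(1) by simp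
  fix n
  have "((\<lambda>r. \<Sum>j<n. c j / real j * r ^ j) \<longlongrightarrow> (\<Sum>j<n. c j / real j * R ^ j)) (at_left R)"
    by (intro tendsto_intros)
  moreover have "\<forall>\<^sub>F r in at_left R. (\<Sum>j<n. c j / real j * r ^ j) \<le> B"
    using assms(2) eventually_at_left_real[OF assms(1)]
  proof eventually_elim
    case (elim r)
    then have "(\<Sum>j<n. c j / real j * r ^ j) \<le> rser c r"
      unfolding rser_def by (intro sum_le_suminf summable_rser coef_term_nonneg c_nonneg) auto
    with elim show ?case by simp
  qed
  ultimately show "(\<Sum>j<n. c j / real j * R ^ j) \<le> B"
    by (intro tendsto_upperbound) auto
qed

lemma rser_le_boundary:
  assumes "summable (\<lambda>j. c j / real j * R ^ j)" "0 \<le> r" "r < R"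
  shows "rser c r \<le> rser c R"
  unfolding rser_def
proof (rule suminf_le[OF _ summable_rser[OF assms(2,3)] assms(1)])
  show "c j / real j * r ^ j \<le> c j / real j * R ^ j" for j
    using assms by (intro coef_term_mono c_nonneg) auto
qed

section \<open>Non-arithmeticity and the size of Re g on circles\<close>

text \<open>If cis (j \<alpha>) = 1 for every j in the support of c, then the order of cis \<alpha>
  divides all these j; non-arithmeticity forces the order 1, so \<alpha> would be 0.\<close>

lemma non_arithmetic_cos_neq_1:
  assumes "non_arithmetic c" "0 < \<bar>\<alpha>\<bar>" "\<bar>\<alpha>\<bar> \<le> pi"
  obtains j where "j \<ge> 1" "c j > 0" "cos (real j * \<alpha>) \<noteq> 1"
proof -
  have "\<exists>j\<ge>1. c j \<noteq> 0 \<and> cis \<alpha> ^ j \<noteq> 1"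
  proof (rule ccontr)
    assume "\<not> ?thesis"
    then have all1: "cis \<alpha> ^ j = 1" if "j \<ge> 1" "c j \<noteq> 0" for j using that by auto
    \<comment> \<open>The support is nonempty, for otherwise j0 = 2 would divide all its elements
      vacuously.\<close>
    obtain j1 where j1: "j1 \<ge> 1" "c j1 \<noteq> 0" using assms(1) unfolding non_arithmetic_def by (metis one_less_numeral_iff semiring_norm(76))
    define d where "d = (LEAST d. d \<ge> 1 \<and> cis \<alpha> ^ d = 1)"
    have d: "d \<ge> 1" "cis \<alpha> ^ d = 1"
      using LeastI[of "\<lambda>d. d \<ge> 1 \<and> cis \<alpha> ^ d = 1" j1] j1 all1 by (auto simp: d_def)
    have "d dvd j" if "j \<ge> 1" "c j \<noteq> 0" for j
    proof -
      have "1 = cis \<alpha> ^ (d * (j div d) + j mod d)" using all1[OF that] by simp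
      also have "\<dots> = cis \<alpha> ^ (j mod d)" by (simp only: power_add power_mult d power_one mult_1_left)
      finally have "\<not> (j mod d \<ge> 1)"
        using not_less_Least[of "j mod d" "\<lambda>d. d \<ge> 1 \<and> cis \<alpha> ^ d = 1"] d by (auto simp: d_def)
      then show ?thesis by (simp add: dvd_eq_mod_eq_0)
    qed
    then have "\<not> d > 1" using assms(1) unfolding non_arithmetic_def by blast
    then have "cis \<alpha> = 1" using d by (cases "d = 1") auto
    then have "cos \<bar>\<alpha>\<bar> = cos 0" by (simp add: complex_eq_iff)
    then have "\<bar>\<alpha>\<bar> = 0" using cos_inj_pi[of "\<bar>\<alpha>\<bar>" 0] assms by simp
    then show False using assms by simp
  qed
  then obtain j where "j \<ge> 1" "c j \<noteq> 0" "cis \<alpha> ^ j \<noteq> 1" by blast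
  note j = this
  have cis_j: "cis (real j * \<alpha>) \<noteq> 1"
    using j(3) Complex.DeMoivre[of \<alpha> j] by simp
  have "cos (real j * \<alpha>) \<noteq> 1"
  proof
    assume "cos (real j * \<alpha>) = 1"
    moreover from this have "sin (real j * \<alpha>) = 0" using sin_cos_squared_add[of "real j * \<alpha>"] by simp
    ultimately have "cis (real j * \<alpha>) = 1"
      by (simp only: complex_eq_iff cis.sel one_complex.sel)
    with cis_j show False by blast
  qed
  moreover have "c j > 0" using j c_nonneg by (simp add: less_le)
  ultimately show ?thesis using that[of j] j by blast
qed

text \<open>As a series with nonnegative terms that increase with r, the deficit can be bounded
  below termwise and compared across radii.\<close>

lemma gser_deficit:
  assumes "0 \<le> r" "r < R" "- pi < \<alpha>" "\<alpha> \<le> pi" 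
  shows "(\<lambda>j. c j / real j * r ^ j * (1 - cos (real j * \<alpha>))) sums (rser c r - Re (gser c (of_real r * cis \<alpha>)))"
proof -
  have "(\<lambda>j. c j / real j * r ^ j * cos (real j * \<alpha>)) sums Re (gser c (of_real r * cis \<alpha>))"
  proof (cases "r = 0")
    case False
    then have "Arg (of_real r * cis \<alpha>) = \<alpha>" 
      using assms Arg_times_of_real2[of r "cis \<alpha>"] cis_Arg_unique[of "cis \<alpha>" \<alpha>] by (simp add: sgn_eq mult.commute)
    then show ?thesis using Re_gser_sums[of "of_real r * cis \<alpha>"] assms by (simp add: norm_mult)
  next
    case True
    have "gser c 0 = 0" by (simp only: gser_def powser_zero) (simp add: gcoef_def)
    moreover have "c j / real j * r ^ j = 0" for j using True by (cases "j = 0") auto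
    then have "(\<lambda>j. c j / real j * r ^ j * cos (real j * \<alpha>)) = (\<lambda>_. 0)" by (simp only: mult_zero_left)
    ultimately show ?thesis using True by simp
  qed
  from sums_diff[OF summable_sums[OF summable_rser[OF assms(1,2)]] this]
  show ?thesis by (simp add: rser_def right_diff_distrib)
qed

text \<open>Termwise, the deficit at radius \<open>r \<ge> R / 2\<close> is at least the deficit at radius \<open>R / 2\<close>, so
  compactness is only needed inside the disc.\<close>

lemma gser_deficit_far:
  assumes "R > 0" "non_arithmetic c" "\<alpha>0 > 0"
  obtains m where "m > 0"
    "\<And>r \<alpha>. R / 2 \<le> r \<Longrightarrow> r < R \<Longrightarrow> \<alpha>0 \<le> \<bar>\<alpha>\<bar> \<Longrightarrow> - pi < \<alpha> \<Longrightarrow> \<alpha> \<le> pi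
       \<Longrightarrow> Re (gser c (of_real r * cis \<alpha>)) \<le> rser c r - m"
proof -
  define E where "E = (\<lambda>\<alpha>. rser c (R / 2) - Re (gser c (of_real (R / 2) * cis \<alpha>)))"
  let ?S = "{- pi..pi} - {- \<alpha>0<..<\<alpha>0}"
  have S: "compact ?S" by (intro compact_diff) auto
  have cont: "continuous_on ?S E"
    unfolding E_def cis_conv_exp
    by (intro continuous_intros continuous_on_compose2[OF holomorphic_on_imp_continuous_on[OF gser_holomorphic]])
       (use assms in \<open>auto simp: norm_mult\<close>)
  have E_pos: "E \<alpha> > 0" if "0 < \<bar>\<alpha>\<bar>" "- pi < \<alpha>" "\<alpha> \<le> pi" for \<alpha>
  proof -
    have \<alpha>: "\<bar>\<alpha>\<bar> \<le> pi" using that by auto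
    obtain j where j: "j \<ge> 1" "c j > 0" "cos (real j * \<alpha>) \<noteq> 1"
      using non_arithmetic_cos_neq_1[OF assms(2) \<open>0 < \<bar>\<alpha>\<bar>\<close>] \<alpha> by blast
    have cos1: "cos (real j * \<alpha>) < 1" using j(3) cos_le_one[of "real j * \<alpha>"] by linarith
    have sums: "(\<lambda>j. c j / real j * (R / 2) ^ j * (1 - cos (real j * \<alpha>))) sums E \<alpha>"
      unfolding E_def using assms that by (intro gser_deficit) auto
    have "0 < (\<Sum>j. c j / real j * (R / 2) ^ j * (1 - cos (real j * \<alpha>)))"
    proof (rule suminf_pos2[where i = j])
      show "summable (\<lambda>j. c j / real j * (R / 2) ^ j * (1 - cos (real j * \<alpha>)))" using sums by (rule sums_summable)
      show "0 \<le> c i / real i * (R / 2) ^ i * (1 - cos (real i * \<alpha>))" for i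
        using coef_term_nonneg[OF c_nonneg, of "R / 2" i] assms(1)
        by (intro mult_nonneg_nonneg[of "c i / real i * (R / 2) ^ i"]) auto
      show "0 < c j / real j * (R / 2) ^ j * (1 - cos (real j * \<alpha>))"
        using j cos1 assms(1) by (intro mult_pos_pos) auto
    qed
    then show ?thesis using sums by (simp add: sums_iff)
  qed
  \<comment> \<open>Positivity was shown for angles in (-pi, pi], but the compact set also contains
    -pi; periodicity closes the gap.\<close>
  have "cis (- pi) = cis pi" by (simp add: complex_eq_iff)
  then have E_mpi: "E (- pi) = E pi" by (simp only: E_def)
  have E_pos': "E \<alpha> > 0" if "\<alpha> \<in> ?S" for \<alpha>
    using E_pos[of \<alpha>] E_pos[of pi] E_mpi that assms(3) by (cases "\<alpha> = - pi") auto
  obtain m where m: "m > 0" "\<And>\<alpha>. \<alpha> \<in> ?S \<Longrightarrow> m \<le> E \<alpha>"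
  proof (cases "?S = {}")
    case False
    then obtain x where "x \<in> ?S" "\<And>y. y \<in> ?S \<Longrightarrow> E x \<le> E y"
      using continuous_attains_inf[OF S _ cont] by blast
    then show ?thesis using that[of "E x"] E_pos' by blast
  next
    \<comment> \<open>For \<alpha>0 > pi no angle is left, and any positive m will do.\<close>
    case True
    then have "1 \<le> E \<alpha>" if "\<alpha> \<in> ?S" for \<alpha>
      using that by (simp only: empty_iff)
    then show ?thesis by (rule that[OF zero_less_one])
  qed
  show ?thesis
  proof (rule that[OF m(1)])
    fix r \<alpha> assume *: "R / 2 \<le> r" "r < R" "\<alpha>0 \<le> \<bar>\<alpha>\<bar>" "- pi < \<alpha>" "\<alpha> \<le> pi"
    have "m \<le> E \<alpha>" using * by (intro m) auto
    also have "E \<alpha> \<le> rser c r - Re (gser c (of_real r * cis \<alpha>))"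
      unfolding E_def
    proof (rule sums_le[OF _ gser_deficit gser_deficit])
      fix j
      have "c j / real j * (R / 2) ^ j \<le> c j / real j * r ^ j"
        using * assms(1) by (intro coef_term_mono c_nonneg) auto
      then show "c j / real j * (R / 2) ^ j * (1 - cos (real j * \<alpha>)) \<le> c j / real j * r ^ j * (1 - cos (real j * \<alpha>))"
        by (intro mult_right_mono) auto
    qed (use * assms in auto)
    finally show "Re (gser c (of_real r * cis \<alpha>)) \<le> rser c r - m" by simp
  qed
qed

end

section \<open>The critical singular expansion\<close>

text \<open>Since (1 - x + x^2/2)(1 + x + x^2/2) = 1 + x^4/4 \<ge> 1, the quadratic lower bound for
  exp x becomes an upper bound for exp (-x).\<close>

lemma one_minus_exp_neg_ge:
  fixes x :: real
  assumes "x \<ge> 0"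
  shows "x - x\<^sup>2 / 2 \<le> 1 - exp (- x)"
proof -
  have pos: "1 + x + x\<^sup>2 / 2 > 0" using assms by (simp add: add_pos_nonneg)
  have "1 \<le> (1 - x + x\<^sup>2 / 2) * (1 + x + x\<^sup>2 / 2)"
  proof -
    have "(1 - x + x\<^sup>2 / 2) * (1 + x + x\<^sup>2 / 2) = 1 + (x\<^sup>2 / 2)\<^sup>2"
      by (simp add: power2_eq_square field_simps)
    then show ?thesis by simp
  qed
  then have "1 / (1 + x + x\<^sup>2 / 2) \<le> 1 - x + x\<^sup>2 / 2" using pos by (simp add: divide_le_eq)
  moreover have "exp (- x) \<le> 1 / (1 + x + x\<^sup>2 / 2)"
    using exp_lower_Taylor_quadratic[OF assms] pos by (simp add: exp_minus field_simps frac_le)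
  ultimately show ?thesis by linarith
qed

lemma one_minus_cos_le: "1 - cos x \<le> x\<^sup>2 / 2" for x :: real
proof -
  have "1 - cos x = 2 * (sin (x / 2))\<^sup>2" using cos_double_sin[of "x / 2"] by simp
  also have "(sin (x / 2))\<^sup>2 \<le> (x / 2)\<^sup>2" using abs_sin_x_le_abs_x[of "x / 2"] by (simp only: abs_le_square_iff)
  finally show ?thesis by (simp add: power2_eq_square)
qed

lemma abs_sin_ge_half:
  fixes x :: real
  assumes "\<bar>x\<bar> \<le> 1"
  shows "\<bar>x\<bar> / 2 \<le> \<bar>sin x\<bar>"
proof -
  have *: "y / 2 \<le> sin y" if "0 \<le> y" "y \<le> 1" for y :: real
  proof -
    have "sin 0 - 0 / 2 \<le> sin y - y / 2"
    proof (rule DERIV_nonneg_imp_nondecreasing[of 0 y "\<lambda>y. sin y - y / 2"])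
      fix t assume t: "0 \<le> t" "t \<le> y"
      have "((\<lambda>y. sin y - y / 2) has_real_derivative (cos t - 1 / 2)) (at t)"
        by (auto intro!: derivative_eq_intros)
      moreover have "cos (pi / 3) \<le> cos t" using t that pi_gt3 by (intro cos_monotone_0_pi_le) auto
      then have "cos t - 1 / 2 \<ge> 0" by (simp add: cos_60)
      ultimately show "\<exists>D. ((\<lambda>y. sin y - y / 2) has_real_derivative D) (at t) \<and> D \<ge> 0" by blast
    qed (use that in auto)
    then show ?thesis by simp
  qed
  show ?thesis using *[of "\<bar>x\<bar>"] assms by (cases "x \<ge> 0") auto
qed

text \<open>Translates between the variable t = 1 - z/R of the expansion and the polar data of z = R
  exp(-\<epsilon> + i \<alpha>).\<close>

lemma one_minus_exp_bounds:
  assumes "0 \<le> \<epsilon>" "\<epsilon> \<le> 1 / 2" "\<bar>\<alpha>\<bar> \<le> 1"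
  defines "t \<equiv> 1 - exp (Complex (- \<epsilon>) \<alpha>)"
  shows "\<epsilon> - \<epsilon>\<^sup>2 / 2 \<le> Re t" "Re t \<le> \<epsilon> + \<alpha>\<^sup>2 / 2" "\<bar>\<alpha>\<bar> / 4 \<le> norm t"
proof -
  have Re: "Re t = 1 - exp (- \<epsilon>) * cos \<alpha>" and Im: "Im t = - exp (- \<epsilon>) * sin \<alpha>"
    by (simp_all add: t_def Re_exp Im_exp)
  have "exp (- \<epsilon>) * cos \<alpha> \<le> exp (- \<epsilon>)" by (intro mult_left_le) auto
  then show "\<epsilon> - \<epsilon>\<^sup>2 / 2 \<le> Re t" using one_minus_exp_neg_ge[OF assms(1)] unfolding Re by linarith
  have "exp (- \<epsilon>) * (1 - cos \<alpha>) \<le> 1 * (\<alpha>\<^sup>2 / 2)"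
    using assms(1) one_minus_cos_le[of \<alpha>] by (intro mult_mono) auto
  moreover have "1 - exp (- \<epsilon>) \<le> \<epsilon>" using exp_ge_add_one_self[of "- \<epsilon>"] by linarith
  ultimately show "Re t \<le> \<epsilon> + \<alpha>\<^sup>2 / 2" unfolding Re by (simp add: right_diff_distrib)
  have "exp (- \<epsilon>) \<ge> 1 / 2" using exp_ge_add_one_self[of "- \<epsilon>"] assms by linarith
  then have "1 / 2 * (\<bar>\<alpha>\<bar> / 2) \<le> exp (- \<epsilon>) * \<bar>sin \<alpha>\<bar>"
    using abs_sin_ge_half[OF assms(3)] by (intro mult_mono) auto
  also have "\<dots> = \<bar>Im t\<bar>" by (simp add: Im abs_mult)
  also have "\<dots> \<le> norm t" by (rule abs_Im_le_cmod)
  finally show "\<bar>\<alpha>\<bar> / 4 \<le> norm t" by simp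
qed

text \<open>The expansion is recorded as an explicit inequality on the open disc. There Re (1 - z/R)
  > 0, so every principal power is taken in the right half-plane and
  \<open>Re_powr_sector_bound\<close> applies.\<close>

locale critical_series =
  fixes \<kappa> :: "nat \<Rightarrow> real" and R s \<delta> a :: real
  assumes \<kappa>_nonneg: "\<forall>j\<ge>1. \<kappa> j \<ge> 0" and nonarith: "non_arithmetic \<kappa>"
    and R_pos: "R > 0" and radius_\<kappa>: "conv_radius (gcoef \<kappa>) = ereal R"
    and s: "1 < s" "s < 2" and a: "a > 0" and \<delta>: "\<delta> > 0"
    and near_\<kappa>: "\<exists>K d. d > 0 \<and> (\<forall>z\<in>ball 0 R. dist z (of_real R) < d \<longrightarrow>
      norm (gser \<kappa> z - (of_real (rser \<kappa> R) - (1 - z / of_real R) + of_real a * (1 - z / of_real R) powr of_real s))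
        \<le> K * norm (1 - z / of_real R) powr (s + \<delta>))"
begin

lemma Re_one_minus_pos: "z \<in> ball 0 R \<Longrightarrow> Re (1 - z / of_real R) > 0"
  using complex_Re_le_cmod[of z] R_pos by simp

text \<open>The expansion keeps \<open>rser \<kappa> r\<close> bounded as r tends to R. In this
  argument \<open>rser \<kappa> R\<close> is merely some real number; its convergence is the
  conclusion.\<close>

lemma summable_boundary: "summable (\<lambda>j. \<kappa> j / real j * R ^ j)"
proof -
  obtain K d where d: "d > 0" and K: "\<And>z. z \<in> ball 0 R \<Longrightarrow> dist z (of_real R) < d \<Longrightarrow>
      norm (gser \<kappa> z - (of_real (rser \<kappa> R) - (1 - z / of_real R) + of_real a * (1 - z / of_real R) powr of_real s))
        \<le> K * norm (1 - z / of_real R) powr (s + \<delta>)" using near_\<kappa> by blast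
  have "max 0 (R - d) < R" using d R_pos by auto
  then have "\<forall>\<^sub>F r in at_left R. r \<in> {max 0 (R - d)<..<R}" by (rule eventually_at_left_real)
  then have "\<forall>\<^sub>F r in at_left R. rser \<kappa> r \<le> \<bar>rser \<kappa> R\<bar> + 1 + a + \<bar>K\<bar>"
  proof eventually_elim
    case (elim r)
    let ?z = "complex_of_real r"
    define t where "t = 1 - ?z / of_real R"
    have t: "norm t \<le> 1"
    proof -
      have "t = of_real (1 - r / R)" by (simp add: t_def)
      moreover have "0 \<le> 1 - r / R" "1 - r / R \<le> 1" using elim R_pos by (auto simp: field_simps)
      ultimately show ?thesis by (simp only: norm_of_real abs_of_nonneg)
    qed
    then have le1: "norm t powr p \<le> 1" if "p > 0" for p using powr_mono2[of p "norm t" 1] that by simp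
    let ?A = "of_real (rser \<kappa> R) - t + of_real a * t powr of_real s"
    have "norm (gser \<kappa> ?z - ?A) \<le> K * norm t powr (s + \<delta>)"
      unfolding t_def using elim d by (intro K) (auto simp: dist_norm norm_minus_commute simp flip: of_real_diff)
    also have "\<dots> \<le> \<bar>K\<bar> * 1" using le1[of "s + \<delta>"] s \<delta> by (intro mult_mono) auto
    finally have "norm (gser \<kappa> ?z - ?A) \<le> \<bar>K\<bar>" by simp
    moreover have "norm ?A \<le> \<bar>rser \<kappa> R\<bar> + 1 + a"
    proof -
      have "norm ?A \<le> norm (complex_of_real (rser \<kappa> R)) + norm t + norm (of_real a * t powr of_real s)"
        using norm_triangle_ineq[of "of_real (rser \<kappa> R) - t" "of_real a * t powr of_real s"]
          norm_triangle_ineq4[of "of_real (rser \<kappa> R)" t] by linarith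
      also have "norm (of_real a * t powr of_real s) \<le> a * 1"
        using le1[of s] s a by (simp add: norm_mult norm_powr_real_powr')
      finally show ?thesis using t by simp
    qed
    ultimately have "norm (gser \<kappa> ?z) \<le> \<bar>rser \<kappa> R\<bar> + 1 + a + \<bar>K\<bar>"
      using norm_triangle_ineq[of "gser \<kappa> ?z - ?A" ?A] by simp
    moreover have "gser \<kappa> ?z = of_real (rser \<kappa> r)"
      using elim by (intro gser_of_real[OF \<kappa>_nonneg radius_\<kappa>]) auto
    ultimately show ?case by simp
  qed
  then show ?thesis by (rule bounded_imp_summable_boundary[OF \<kappa>_nonneg radius_\<kappa> R_pos])
qed

text \<open>The sector bound makes a Re (t^s) negative of order |t|^s up to a multiple of (Re t)^s;
  close to R the remainder of higher order costs at most half of that gain.\<close>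

lemma near_bound:
  obtains d c C where "d > 0" "c > 0" "C > 0"
    "\<And>z :: complex. z \<in> ball 0 R \<Longrightarrow> dist z (of_real R) < d \<Longrightarrow>
       Re (gser \<kappa> z) \<le> rser \<kappa> R - Re (1 - z / of_real R) - c * norm (1 - z / of_real R) powr s
         + C * Re (1 - z / of_real R) powr s"
proof -
  obtain K d where d: "d > 0" and K: "\<And>z. z \<in> ball 0 R \<Longrightarrow> dist z (of_real R) < d \<Longrightarrow>
      norm (gser \<kappa> z - (of_real (rser \<kappa> R) - (1 - z / of_real R) + of_real a * (1 - z / of_real R) powr of_real s))
        \<le> K * norm (1 - z / of_real R) powr (s + \<delta>)" using near_\<kappa> by blast
  obtain c C where c: "c > 0" "C > 0"
    and sector: "\<And>z. Re z > 0 \<Longrightarrow> Re (z powr complex_of_real s) \<le> C * Re z powr s - c * norm z powr s"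
    using Re_powr_sector_bound[OF s] by blast
  \<comment> \<open>Chosen so that (|K| + 1) e^\<delta> = a c / 2, whence the remainder is at most
    (a c / 2) |t|^s for |t| < e.\<close>
  define e where "e = (a * c / (2 * (\<bar>K\<bar> + 1))) powr (1 / \<delta>)"
  have e: "e > 0" "e powr \<delta> = a * c / (2 * (\<bar>K\<bar> + 1))" using a c \<delta> by (auto simp: e_def powr_powr)
  have Ke: "K * e powr \<delta> \<le> a * c / 2"
  proof -
    have "K * e powr \<delta> \<le> (\<bar>K\<bar> + 1) * e powr \<delta>" by (intro mult_right_mono) auto
    also have "\<dots> = a * c / 2" unfolding e(2) by (simp add: field_simps)
    finally show ?thesis .
  qed
  show ?thesis
  proof (rule that[of "min d (R * e)" "a * c / 2" "a * C"])
    fix z :: complex assume z: "z \<in> ball 0 R" "dist z (of_real R) < min d (R * e)"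
    define t where "t = 1 - z / of_real R"
    have Ret: "Re t > 0" unfolding t_def by (rule Re_one_minus_pos[OF z(1)])
    have "R * norm t = norm (of_real R * t)" using R_pos by (simp add: norm_mult)
    also have "of_real R * t = of_real R - z" using R_pos by (simp add: t_def algebra_simps)
    finally have "R * norm t < R * e" using z(2) by (simp add: dist_norm norm_minus_commute)
    then have "norm t < e" using R_pos by simp
    have "norm (gser \<kappa> z - (of_real (rser \<kappa> R) - t + of_real a * t powr of_real s)) \<le> K * norm t powr (s + \<delta>)"
      unfolding t_def using z by (intro K) auto
    also have "\<dots> \<le> \<bar>K\<bar> * norm t powr (s + \<delta>)" by (intro mult_right_mono) auto
    also have "\<dots> = \<bar>K\<bar> * norm t powr \<delta> * norm t powr s" by (simp add: powr_add)
    also have "\<dots> \<le> (\<bar>K\<bar> + 1) * e powr \<delta> * norm t powr s"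
      using \<open>norm t < e\<close> \<delta> s by (intro mult_mono powr_mono2) auto
    also have "\<dots> = a * c / 2 * norm t powr s" unfolding e(2) by (simp add: field_simps)
    finally have "norm (gser \<kappa> z - (of_real (rser \<kappa> R) - t + of_real a * t powr of_real s)) \<le> a * c / 2 * norm t powr s" .
    then have "Re (gser \<kappa> z - (of_real (rser \<kappa> R) - t + of_real a * t powr of_real s)) \<le> a * c / 2 * norm t powr s"
      using complex_Re_le_cmod order_trans by blast
    then have "Re (gser \<kappa> z) \<le> rser \<kappa> R - Re t + a * Re (t powr of_real s) + a * c / 2 * norm t powr s" by simp
    moreover have "a * Re (t powr of_real s) \<le> a * (C * Re t powr s - c * norm t powr s)"
      using sector[OF Ret] a by (intro mult_left_mono) auto
    ultimately have "Re (gser \<kappa> z) \<le> rser \<kappa> R - Re t - a * c / 2 * norm t powr s + a * C * Re t powr s"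
      by (simp add: algebra_simps)
    then show "Re (gser \<kappa> z) \<le> rser \<kappa> R - Re (1 - z / of_real R) - a * c / 2 * norm (1 - z / of_real R) powr s
         + a * C * Re (1 - z / of_real R) powr s" by (simp only: t_def)
  qed (use d a c e R_pos in auto)
qed

lemma scaled_exp_in_ball:
  assumes "Re w < 0"
  shows "of_real R * exp w \<in> ball 0 R"
  using assms R_pos by (simp add: norm_mult)

text \<open>Small angles use \<open>near_bound\<close>, large ones the uniform gap m of
  \<open>gser_deficit_far\<close>. Keeping the linear term -\<epsilon> with coefficient exactly 1 is
  essential, as it must cancel N \<epsilon> later.\<close>

lemma key_bound:
  obtains \<epsilon>0 c C where "\<epsilon>0 > 0" "c > 0" "C > 0"
    "\<And>\<epsilon> \<alpha>. 0 < \<epsilon> \<Longrightarrow> \<epsilon> \<le> \<epsilon>0 \<Longrightarrow> \<bar>\<alpha>\<bar> \<le> pi \<Longrightarrow>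
       Re (gser \<kappa> (of_real R * exp (Complex (- \<epsilon>) \<alpha>))) \<le> rser \<kappa> R - \<epsilon> - c * \<bar>\<alpha>\<bar> powr s + C * \<epsilon> powr s"
proof -
  obtain d c C where d: "d > 0" and c: "c > 0" "C > 0"
    and near: "\<And>z. z \<in> ball 0 R \<Longrightarrow> dist z (of_real R) < d \<Longrightarrow>
       Re (gser \<kappa> z) \<le> rser \<kappa> R - Re (1 - z / of_real R) - c * norm (1 - z / of_real R) powr s
         + C * Re (1 - z / of_real R) powr s"
    using near_bound by blast
  have "isCont (\<lambda>w. complex_of_real R * exp w) 0" by (intro continuous_intros)
  then obtain d' where d': "d' > 0"
    "\<And>w. dist w 0 < d' \<Longrightarrow> dist (complex_of_real R * exp w) (complex_of_real R) < d"
    using d unfolding continuous_at_eps_delta by fastforce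
  \<comment> \<open>The factor 4 powr s comes from |t| \<ge> |\<alpha>| / 4.\<close>
  define c' where "c' = c / 4 powr s"
  have c': "c' > 0" using c by (simp add: c'_def)
  \<comment> \<open>Re t may be as large as \<epsilon> + \<alpha>^2/2. For |\<alpha>| \<le>
    \<alpha>1 the resulting C |\<alpha>|^(2s) is at most half of c' |\<alpha>|^s.\<close>
  define \<alpha>1 where "\<alpha>1 = (c' / (2 * C)) powr (1 / s)"
  have \<alpha>1: "\<alpha>1 > 0" "C * \<alpha>1 powr s = c' / 2" using c c' s by (auto simp: \<alpha>1_def powr_powr field_simps)
  define \<alpha>0 where "\<alpha>0 = min 1 (min (d' / 2) \<alpha>1)"
  have \<alpha>0: "\<alpha>0 > 0" "\<alpha>0 \<le> 1" "\<alpha>0 \<le> d' / 2" "\<alpha>0 \<le> \<alpha>1" using d' \<alpha>1 by (auto simp: \<alpha>0_def)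
  obtain m where m: "m > 0" and far:
    "\<And>r \<alpha>. R / 2 \<le> r \<Longrightarrow> r < R \<Longrightarrow> \<alpha>0 \<le> \<bar>\<alpha>\<bar> \<Longrightarrow> - pi < \<alpha> \<Longrightarrow> \<alpha> \<le> pi
       \<Longrightarrow> Re (gser \<kappa> (of_real r * cis \<alpha>)) \<le> rser \<kappa> r - m"
    using gser_deficit_far[OF \<kappa>_nonneg radius_\<kappa> R_pos nonarith \<alpha>0(1)] by blast
  \<comment> \<open>The first entry is what remains of c' for small angles; the second makes c''
    |\<alpha>|^s \<le> m / 2 for every |\<alpha>| \<le> pi.\<close>
  define c'' where "c'' = min (c' / 2) (m / (2 * pi powr s))"
  have c'': "c'' > 0" "c'' \<le> c' / 2" "c'' \<le> m / (2 * pi powr s)" using c' m by (auto simp: c''_def)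
  \<comment> \<open>The added 1 absorbs the error \<epsilon>^2/2 in Re t \<ge> \<epsilon> -
    \<epsilon>^2/2, because \<epsilon>^2 \<le> \<epsilon>^s.\<close>
  define C' where "C' = C * 2 powr s + 1"
  have C': "C' > 0" using c by (simp add: C'_def add_pos_pos)
  \<comment> \<open>1/2 keeps the radius above R/2; d'/3 together with \<alpha>0 \<le> d'/2 keeps
    the exponent within d'; m/2 lets the other half of the gap m pay for -\<epsilon>.\<close>
  define \<epsilon>0 where "\<epsilon>0 = min (1 / 2) (min (d' / 3) (m / 2))"
  have \<epsilon>0: "\<epsilon>0 > 0" "\<epsilon>0 \<le> 1 / 2" "\<epsilon>0 \<le> d' / 3" "\<epsilon>0 \<le> m / 2" using d' m by (auto simp: \<epsilon>0_def)
  show ?thesis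
  proof (rule that[OF \<epsilon>0(1) c''(1) C'])
    fix \<epsilon> \<alpha> :: real assume \<epsilon>: "0 < \<epsilon>" "\<epsilon> \<le> \<epsilon>0" and \<alpha>: "\<bar>\<alpha>\<bar> \<le> pi"
    let ?z = "of_real R * exp (Complex (- \<epsilon>) \<alpha>)"
    have z: "?z \<in> ball 0 R" using \<epsilon> by (intro scaled_exp_in_ball) simp
    show "Re (gser \<kappa> ?z) \<le> rser \<kappa> R - \<epsilon> - c'' * \<bar>\<alpha>\<bar> powr s + C' * \<epsilon> powr s"
    proof (cases "\<bar>\<alpha>\<bar> < \<alpha>0")
      case True
      define t where "t = 1 - exp (Complex (- \<epsilon>) \<alpha>)"
      have t: "\<epsilon> - \<epsilon>\<^sup>2 / 2 \<le> Re t" "Re t \<le> \<epsilon> + \<alpha>\<^sup>2 / 2" "\<bar>\<alpha>\<bar> / 4 \<le> norm t"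
        unfolding t_def using \<epsilon> \<epsilon>0 True \<alpha>0 by (intro one_minus_exp_bounds; linarith)+
      have "dist (Complex (- \<epsilon>) \<alpha>) 0 < d'"
        using cmod_le[of "Complex (- \<epsilon>) \<alpha>"] \<epsilon> \<epsilon>0 True \<alpha>0 by (simp add: dist_norm)
      then have "Re (gser \<kappa> ?z) \<le> rser \<kappa> R - Re t - c * norm t powr s + C * Re t powr s"
        using near[OF z d'(2)] R_pos by (simp add: t_def)
      moreover have "c' * \<bar>\<alpha>\<bar> powr s \<le> c * norm t powr s"
      proof -
        have "(\<bar>\<alpha>\<bar> / 4) powr s \<le> norm t powr s" using t(3) s by (intro powr_mono2) auto
        then have "c * (\<bar>\<alpha>\<bar> / 4) powr s \<le> c * norm t powr s" using c by (intro mult_left_mono) auto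
        then show ?thesis by (simp add: c'_def powr_divide)
      qed
      moreover have "C * Re t powr s \<le> C * 2 powr s * \<epsilon> powr s + c' / 2 * \<bar>\<alpha>\<bar> powr s"
      proof -
        have "0 \<le> Re t" using Re_one_minus_pos[OF z] R_pos by (simp add: t_def)
        then have "Re t powr s \<le> (\<epsilon> + \<alpha>\<^sup>2 / 2) powr s" using t(2) s by (intro powr_mono2) auto
        also have "\<dots> \<le> (2 * max \<epsilon> (\<alpha>\<^sup>2 / 2)) powr s" using \<epsilon> s by (intro powr_mono2) auto
        also have "\<dots> \<le> (2 * \<epsilon>) powr s + (\<alpha>\<^sup>2) powr s"
          using \<epsilon> by (cases "\<epsilon> \<le> \<alpha>\<^sup>2 / 2") (auto simp: max_def)
        also have "(2 * \<epsilon>) powr s = 2 powr s * \<epsilon> powr s" using \<epsilon> by (simp add: powr_mult)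
        also have "(\<alpha>\<^sup>2) powr s = \<bar>\<alpha>\<bar> powr s * \<bar>\<alpha>\<bar> powr s"
          by (simp add: power2_eq_square flip: powr_mult)
        also have "\<dots> \<le> \<alpha>1 powr s * \<bar>\<alpha>\<bar> powr s"
          using True \<alpha>0 s by (intro mult_right_mono powr_mono2) auto
        finally have "C * Re t powr s \<le> C * (2 powr s * \<epsilon> powr s + \<alpha>1 powr s * \<bar>\<alpha>\<bar> powr s)"
          using c by (intro mult_left_mono) auto
        also have "\<dots> = C * 2 powr s * \<epsilon> powr s + (C * \<alpha>1 powr s) * \<bar>\<alpha>\<bar> powr s" by (simp add: algebra_simps)
        finally show ?thesis unfolding \<alpha>1(2) .
      qed
      moreover have "\<epsilon>\<^sup>2 \<le> \<epsilon> powr s"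
        using \<epsilon> \<epsilon>0 s powr_mono'[of s 2 \<epsilon>] by (simp add: powr_numeral)
      moreover have "c'' * \<bar>\<alpha>\<bar> powr s \<le> c' / 2 * \<bar>\<alpha>\<bar> powr s" using c'' by (intro mult_right_mono) auto
      ultimately show ?thesis using t(1) zero_le_power2[of \<epsilon>] unfolding C'_def distrib_right mult_1_left by argo
    next
      case False
      have z_eq: "of_real R * exp (Complex (- \<epsilon>) x) = of_real (R * exp (- \<epsilon>)) * cis x" for x
        by (simp add: exp_eq_polar)
      have r: "R / 2 \<le> R * exp (- \<epsilon>)" "R * exp (- \<epsilon>) < R" "0 \<le> R * exp (- \<epsilon>)"
        using exp_ge_add_one_self[of "- \<epsilon>"] \<epsilon> \<epsilon>0 R_pos by (auto simp: field_simps)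
      have "Re (gser \<kappa> ?z) \<le> rser \<kappa> (R * exp (- \<epsilon>)) - m"
      proof (cases "\<alpha> = - pi")
        case True
        have "cis (- pi) = cis pi" by (simp add: complex_eq_iff)
        then show ?thesis using far[OF r(1,2), of pi] False \<alpha> True by (simp only: z_eq) simp
      next
        case F: False
        then show ?thesis using far[OF r(1,2), of \<alpha>] False \<alpha> by (simp only: z_eq)
      qed
      also have "rser \<kappa> (R * exp (- \<epsilon>)) \<le> rser \<kappa> R"
        using rser_le_boundary[OF \<kappa>_nonneg radius_\<kappa> summable_boundary r(3,2)] .
      finally have "Re (gser \<kappa> ?z) \<le> rser \<kappa> R - m" by simp
      moreover have "c'' * \<bar>\<alpha>\<bar> powr s \<le> m / 2"
      proof -
        have "c'' * \<bar>\<alpha>\<bar> powr s \<le> m / (2 * pi powr s) * pi powr s"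
          using c'' \<alpha> s m by (intro mult_mono powr_mono2) auto
        then show ?thesis by simp
      qed
      moreover have "C' * \<epsilon> powr s \<ge> 0" using C' by simp
      ultimately show ?thesis using \<epsilon> \<epsilon>0 by linarith
    qed
  qed
qed

end

section \<open>Coefficient asymptotics\<close>

text \<open>Cauchy's formula on [0, 2 pi], moved by periodicity to [-pi, pi] so that the direction
  of the singularity R lies in the middle and the rescaled variable runs over symmetric
  intervals.\<close>

lemma zcoeff_circle_integral:
  assumes F: "F holomorphic_on ball 0 R" and r: "0 < r" "r < R"
  shows "zcoeff N F = 1 / (2 * of_real pi) *
    (LINT t|lborel. (if t \<in> {-pi..pi} then F (of_real r * cis t) / (of_real r * cis t) ^ N else 0))"
proof -
  define k where "k = (\<lambda>t. F (of_real r * cis t) / (of_real r * cis t) ^ N)"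
  have cont: "continuous_on A k" for A
    unfolding k_def cis_conv_exp
    by (intro continuous_intros continuous_on_compose2[OF holomorphic_on_imp_continuous_on[OF F]])
       (use r in \<open>auto simp: norm_mult\<close>)
  have "((\<lambda>z. F z / (z - 0) ^ Suc N) has_contour_integral (2 * pi * \<i>) / fact N * (deriv ^^ N) F 0) (circlepath 0 r)"
    using r by (intro Cauchy_has_contour_integral_higher_derivative_circlepath
        holomorphic_on_imp_continuous_on holomorphic_on_subset[OF F]) auto
  then have "((\<lambda>t. F (0 + r * cis t) / (0 + r * cis t - 0) ^ Suc N * r * \<i> * cis t) has_integral
      (2 * pi * \<i>) / fact N * (deriv ^^ N) F 0) {0..2 * pi}"
    unfolding circlepath_def using has_contour_integral_part_circlepath_iff[of 0 "2 * pi"] by simp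
  also have "(\<lambda>t. F (0 + r * cis t) / (0 + r * cis t - 0) ^ Suc N * r * \<i> * cis t) = (\<lambda>t. k t * \<i>)"
    using r by (simp add: k_def fun_eq_iff)
  finally have "((\<lambda>t. k t * \<i> * (- \<i>)) has_integral (2 * pi * \<i>) / fact N * (deriv ^^ N) F 0 * (- \<i>)) {0..2 * pi}"
    by (rule has_integral_mult_left)
  moreover have "(\<lambda>t. k t * \<i> * (- \<i>)) = k" by (simp add: fun_eq_iff mult.assoc)
  moreover have "(2 * pi * \<i>) / fact N * (deriv ^^ N) F 0 * (- \<i>) = 2 * pi * zcoeff N F"
    unfolding zcoeff_def divide_inverse using i_squared by algebra
  ultimately have "(k has_integral 2 * pi * zcoeff N F) {0..2 * pi}" by (simp only:)
  then have "2 * pi * zcoeff N F = integral {0..2 * pi} k" by (simp add: integral_unique)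
  also have "\<dots> = integral {0..pi} k + integral {pi..2 * pi} k"
    by (rule Henstock_Kurzweil_Integration.integral_combine[symmetric])
       (auto intro: integrable_continuous_real cont)
  also have "integral {pi..2 * pi} k = integral {-pi..0} k"
  proof -
    have "k \<circ> (+) (2 * pi) = k" by (simp add: k_def fun_eq_iff cis_mult[symmetric])
    then show ?thesis using integral_shift_Icc_real[of "-pi" 0 k "2 * pi"] by simp
  qed
  also have "integral {0..pi} k + integral {-pi..0} k = integral {-pi..pi} k"
    by (subst add.commute, rule Henstock_Kurzweil_Integration.integral_combine)
       (auto intro: integrable_continuous_real cont)
  also have "\<dots> = (LINT t:{-pi..pi}|lborel. k t)"
    by (rule set_borel_integral_eq_integral(2)[symmetric]) (intro borel_integrable_atLeastAtMost' cont)
  also have "\<dots> = (LINT t|lborel. (if t \<in> {-pi..pi} then k t else 0))"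
    unfolding set_lebesgue_integral_def by (intro Bochner_Integration.integral_cong) auto
  finally have "zcoeff N F = 1 / (2 * of_real pi) * (LINT t|lborel. (if t \<in> {-pi..pi} then k t else 0))"
    by (simp add: field_simps)
  then show ?thesis by (simp only: k_def)
qed

lemma norm_exp_minus_linear_le:
  "norm (exp w - 1 - w) \<le> exp \<bar>Re w\<bar> * (norm w)\<^sup>2"
  using Taylor_exp[of w 1] by (simp add: diff_diff_eq power2_eq_square)

text \<open>The global bound on f enters the majorant, the expansion of f at R the pointwise
  limit.\<close>

locale critical_asymptotics = critical_series +
  fixes \<theta> :: "nat \<Rightarrow> real" and \<theta>s :: real and f :: "complex \<Rightarrow> complex"
  assumes \<theta>_nonneg: "\<forall>j\<ge>1. \<theta> j \<ge> 0" and radius_\<theta>: "conv_radius (gcoef \<theta>) = ereal R"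
    and \<theta>s: "\<theta>s \<ge> 0"
    and near_\<theta>: "\<exists>K d. d > 0 \<and> (\<forall>z\<in>ball 0 R. dist z (of_real R) < d \<longrightarrow>
      norm (gser \<theta> z + of_real \<theta>s * ln (1 - z / of_real R)) \<le> K * norm (1 - z / of_real R) powr \<delta>)"
    and f_holo: "f holomorphic_on ball 0 R" and f_bounded: "bounded (f ` ball 0 R)"
    and near_f: "\<exists>K d. d > 0 \<and> (\<forall>z\<in>ball 0 R. dist z (of_real R) < d \<longrightarrow>
      norm (f z - 1) \<le> K * norm (1 - z / of_real R) powr \<delta>)"
begin

text \<open>The Cauchy integral runs over the points \<open>pt N y\<close>, and \<open>\<Phi> u N\<close> is its integrand, rescaled so
  as to converge: \<open>f z * exp (damp u N * G\<^sub>N z) / z ^ N\<close> at \<open>z = pt N y\<close>, divided by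
  \<open>exp (damp u N * N * g\<^sub>\<kappa>(R)) * R powr (- N) * scale N powr (- \<theta>s)\<close>.\<close>

abbreviation scale :: "nat \<Rightarrow> real" where "scale N \<equiv> real N powr (- (1 / s))"

definition pt :: "nat \<Rightarrow> real \<Rightarrow> complex" where
  "pt N y = of_real R * exp (- (of_real (scale N) * Complex 1 y))"

abbreviation damp :: "real \<Rightarrow> nat \<Rightarrow> real" where "damp u N \<equiv> exp (- u / sqrt (real N))"

definition \<Phi> :: "real \<Rightarrow> nat \<Rightarrow> real \<Rightarrow> complex" where
  "\<Phi> u N y = (if \<bar>scale N * y\<bar> \<le> pi then of_real (scale N powr \<theta>s) * f (pt N y) *
     exp (of_real (damp u N) * (gser \<theta> (pt N y) + of_nat N * (gser \<kappa> (pt N y) - of_real (rser \<kappa> R)))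
       + of_nat N * of_real (scale N) * Complex 1 y) else 0)"

section \<open>Scaling and the pointwise limit of the integrand\<close>

lemma scale_pos: "N > 0 \<Longrightarrow> scale N > 0" by simp

lemma scale_powr: "N > 0 \<Longrightarrow> real N * scale N powr s = 1"
proof -
  assume N: "N > 0"
  have "scale N powr s = real N powr (- 1)" using s by (simp add: powr_powr)
  then show ?thesis using N by (simp add: powr_minus)
qed

lemma scale_tendsto_0: "scale \<longlonglongrightarrow> 0"
  using s by real_asymp

text \<open>The exponent 1/2 - 1/s is negative because s < 2. This one limit controls the damping,
  and its square the quadratic error of the exponential.\<close>

lemma sqrt_scale_tendsto_0: "(\<lambda>N. sqrt (real N) * scale N) \<longlonglongrightarrow> 0"
proof -
  define p where "p = 1 / s - 1 / 2"
  have p: "p > 0" using s by (simp add: p_def field_simps)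
  have "sqrt (real N) * scale N = real N powr (- p)" for N
    by (simp add: powr_half_sqrt[symmetric] p_def flip: powr_add)
  moreover have "(\<lambda>N. real N powr (- p)) \<longlonglongrightarrow> 0" using p by real_asymp
  ultimately show ?thesis by simp
qed

lemma scale_square_tendsto_0: "(\<lambda>N. real N * (scale N)\<^sup>2) \<longlonglongrightarrow> 0"
proof -
  have "real N * (scale N)\<^sup>2 = (sqrt (real N) * scale N)\<^sup>2" for N by (simp add: power_mult_distrib)
  then show ?thesis using tendsto_power[OF sqrt_scale_tendsto_0, of 2] by simp
qed

lemma one_minus_damp: "u \<ge> 0 \<Longrightarrow> 0 \<le> 1 - damp u N" "u \<ge> 0 \<Longrightarrow> real N * (1 - damp u N) \<le> u * sqrt (real N)"
proof -
  assume u: "u \<ge> 0"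
  then show "0 \<le> 1 - damp u N" by simp
  have "1 - damp u N \<le> u / sqrt (real N)" using exp_ge_add_one_self[of "- u / sqrt (real N)"] by simp
  then have "real N * (1 - damp u N) \<le> real N * (u / sqrt (real N))" by (intro mult_left_mono) auto
  also have "\<dots> = u * (real N / sqrt (real N))" by simp
  also have "real N / sqrt (real N) = sqrt (real N)" by (rule real_div_sqrt) simp
  finally show "real N * (1 - damp u N) \<le> u * sqrt (real N)" .
qed

lemma pt_in_ball: "N > 0 \<Longrightarrow> pt N y \<in> ball 0 R"
  unfolding pt_def by (rule scaled_exp_in_ball) simp

lemma pt_eq: "pt N y = of_real R * exp (Complex (- scale N) (- (scale N * y)))"
proof -
  have "- (of_real (scale N) * Complex 1 y) = Complex (- scale N) (- (scale N * y))"
    by (simp add: complex_eq_iff)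
  then show ?thesis by (simp only: pt_def)
qed

text \<open>The substitution t = - scale N * y contributes one factor \<open>scale N\<close>, and
  the prefactor built into \<open>\<Phi>\<close> takes out \<open>scale N powr \<theta>s\<close>;
  hence the exponent 1 - \<theta>s.\<close>

lemma zcoeff_eq_integral:
  assumes "N > 0"
  shows "zcoeff N (\<lambda>z. f z * exp (of_real (damp u N) * (gser \<theta> z + of_nat N * gser \<kappa> z))) =
    of_real (scale N powr (1 - \<theta>s) * exp (damp u N * real N * rser \<kappa> R) / (2 * pi * R ^ N)) * (LINT y|lborel. \<Phi> u N y)"
    (is "zcoeff N ?F = _")
proof -
  define e where "e = scale N"
  have e: "e > 0" using scale_pos[OF assms] by (simp add: e_def)
  have F: "?F holomorphic_on ball 0 R"
    by (intro holomorphic_intros f_holo gser_holomorphic[OF \<theta>_nonneg radius_\<theta>] gser_holomorphic[OF \<kappa>_nonneg radius_\<kappa>])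
  let ?k = "\<lambda>t. if t \<in> {-pi..pi} then ?F (of_real (R * exp (- e)) * cis t) / (of_real (R * exp (- e)) * cis t) ^ N else 0"
  let ?c = "of_real (exp (damp u N * real N * rser \<kappa> R) / (R ^ N * e powr \<theta>s)) :: complex"
  have "zcoeff N ?F = 1 / (2 * of_real pi) * (LINT t|lborel. ?k t)"
    using R_pos e by (intro zcoeff_circle_integral[OF F]) auto
  also have "(LINT t|lborel. ?k t) = of_real e * (LINT y|lborel. ?k (- e * y))"
    using lborel_integral_real_affine[of "- e" ?k 0, unfolded add_0_left] e by (simp only: abs_minus_cancel abs_of_pos scaleR_conv_of_real)
  also have "(\<lambda>y. ?k (- e * y)) = (\<lambda>y. ?c * \<Phi> u N y)"
  proof
    fix y
    have z: "of_real (R * exp (- e)) * cis (- e * y) = pt N y"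
      by (simp add: pt_eq exp_eq_polar e_def)
    show "?k (- e * y) = ?c * \<Phi> u N y"
    proof (cases "\<bar>e * y\<bar> \<le> pi")
      case True
      then have mem: "- e * y \<in> {-pi..pi}" by (auto simp: abs_le_iff)
      have pN: "pt N y ^ N = of_real (R ^ N) * exp (- (of_nat N * of_real e * Complex 1 y))"
        by (simp add: pt_def power_mult_distrib exp_of_nat_mult[symmetric] mult.assoc e_def)
      let ?X = "of_real (damp u N) * (gser \<theta> (pt N y) + of_nat N * gser \<kappa> (pt N y))"
      let ?Y = "of_real (damp u N) * (gser \<theta> (pt N y) + of_nat N * (gser \<kappa> (pt N y) - of_real (rser \<kappa> R)))
        + of_nat N * of_real e * Complex 1 y"
      have "exp ?X / exp (- (of_nat N * of_real e * Complex 1 y)) = exp (of_real (damp u N * real N * rser \<kappa> R)) * exp ?Y"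
        by (simp add: mult_exp_exp exp_diff[symmetric] algebra_simps)
      then have "?F (pt N y) / pt N y ^ N = f (pt N y) * (exp (of_real (damp u N * real N * rser \<kappa> R)) * exp ?Y) / of_real (R ^ N)"
        unfolding pN by (simp add: field_simps)
      then have "?k (- e * y) = f (pt N y) * (of_real (exp (damp u N * real N * rser \<kappa> R)) * exp ?Y) / of_real (R ^ N)"
        using mem unfolding z by (simp only: if_True exp_of_real)
      also have "\<dots> = ?c * \<Phi> u N y"
        using True e by (simp add: \<Phi>_def flip: e_def)
      finally show ?thesis .
    next
      case False
      then show ?thesis by (auto simp: \<Phi>_def e_def abs_le_iff)
    qed
  qed
  also have "(LINT y|lborel. ?c * \<Phi> u N y) = ?c * (LINT y|lborel. \<Phi> u N y)" by simp
  also have "1 / (2 * of_real pi) * (of_real e * (?c * (LINT y|lborel. \<Phi> u N y))) =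
      of_real (e * exp (damp u N * real N * rser \<kappa> R) / (R ^ N * e powr \<theta>s) / (2 * pi)) * (LINT y|lborel. \<Phi> u N y)"
    by (simp add: mult_ac)
  also have "e * exp (damp u N * real N * rser \<kappa> R) / (R ^ N * e powr \<theta>s) / (2 * pi)
      = e powr (1 - \<theta>s) * exp (damp u N * real N * rser \<kappa> R) / (2 * pi * R ^ N)"
    using e by (simp add: powr_diff field_simps)
  finally show ?thesis by (simp only: e_def)
qed

text \<open>Damping also multiplies g_theta, whose logarithm grows like ln N; the product with 1 -
  damp = O(N^(-1/2)) is still negligible.\<close>

lemma one_minus_damp_ln_scale:
  assumes "u \<ge> 0"
  shows "(\<lambda>N. (1 - damp u N) * ln (scale N)) \<longlonglongrightarrow> 0"
proof (rule Lim_null_comparison)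
  show "\<forall>\<^sub>F N in sequentially. norm ((1 - damp u N) * ln (scale N)) \<le> u / s * (ln (real N) / sqrt (real N))"
    using eventually_gt_at_top[of 0]
  proof eventually_elim
    case (elim N)
    have "1 - damp u N \<le> u / sqrt (real N)" using exp_ge_add_one_self[of "- u / sqrt (real N)"] by simp
    moreover have "ln (real N) / s \<ge> 0" using elim s by simp
    ultimately have "(1 - damp u N) * (ln (real N) / s) \<le> u / sqrt (real N) * (ln (real N) / s)"
      by (intro mult_right_mono)
    moreover have "norm ((1 - damp u N) * ln (scale N)) = (1 - damp u N) * (ln (real N) / s)"
      using elim s one_minus_damp(1)[OF assms, of N] by (simp add: ln_powr abs_mult)
    ultimately show ?case by (simp add: mult_ac)
  qed
  show "(\<lambda>N. u / s * (ln (real N) / sqrt (real N))) \<longlonglongrightarrow> 0"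
    by (rule tendsto_mult_right_zero) real_asymp
qed

lemma \<Phi>_pointwise:
  assumes u: "u \<ge> 0"
  shows "(\<lambda>N. \<Phi> u N y) \<longlonglongrightarrow> hankel_kernel \<theta>s s a (Complex 1 y)"
proof -
  define \<tau> where "\<tau> = Complex 1 y"
  have \<tau>: "\<tau> \<noteq> 0" "\<tau> \<notin> \<real>\<^sub>\<le>\<^sub>0" by (auto simp: \<tau>_def complex_eq_iff complex_nonpos_Reals_iff)
  \<comment> \<open>t is 1 - z/R at the point \<open>pt N y\<close>, and q = t / scale N is its
    rescaled version, which tends to \<tau>.\<close>
  define t where "t = (\<lambda>N. 1 - exp (- (of_real (scale N) * \<tau>)))"
  define q where "q = (\<lambda>N. t N / of_real (scale N))"
  have t_pt: "1 - pt N y / of_real R = t N" for N using R_pos by (simp add: pt_def t_def \<tau>_def)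
  have t_q: "t N = of_real (scale N) * q N" if "N > 0" for N using that by (simp add: q_def)
  have Ret: "Re (t N) > 0" if "N > 0" for N
    using Re_one_minus_pos[OF pt_in_ball[OF that, of y]] by (simp add: t_pt)
  have damp1: "(\<lambda>N. damp u N) \<longlonglongrightarrow> 1"
  proof -
    have "(\<lambda>N. - u * (1 / sqrt (real N))) \<longlonglongrightarrow> 0" by (rule tendsto_mult_right_zero) real_asymp
    then show ?thesis using tendsto_exp[of _ 0] by fastforce
  qed
  have lin: "norm (of_real (scale N) * \<tau> - t N) \<le> exp (scale N) * (norm \<tau>)\<^sup>2 * (scale N)\<^sup>2" for N
    using norm_exp_minus_linear_le[of "- (of_real (scale N) * \<tau>)"]
    by (simp add: t_def \<tau>_def norm_mult power_mult_distrib algebra_simps)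
  have lim_exp: "(\<lambda>N. exp (scale N) * (norm \<tau>)\<^sup>2) \<longlonglongrightarrow> exp 0 * (norm \<tau>)\<^sup>2"
    by (intro tendsto_intros scale_tendsto_0)
  have q_lim: "q \<longlonglongrightarrow> \<tau>"
  proof -
    have "(\<lambda>N. \<tau> - q N) \<longlonglongrightarrow> 0"
    proof (rule Lim_null_comparison)
      show "\<forall>\<^sub>F N in sequentially. norm (\<tau> - q N) \<le> exp (scale N) * (norm \<tau>)\<^sup>2 * scale N"
        using eventually_gt_at_top[of 0]
      proof eventually_elim
        case (elim N)
        have "norm (of_real (scale N) * \<tau> - t N) = scale N * norm (\<tau> - q N)"
          using elim by (simp add: t_q norm_mult flip: right_diff_distrib)
        then have "scale N * norm (\<tau> - q N) \<le> scale N * (exp (scale N) * (norm \<tau>)\<^sup>2 * scale N)"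
          using lin[of N] by (simp add: power2_eq_square mult_ac)
        then show ?case using scale_pos[OF elim] by (simp only: mult_le_cancel_left_pos)
      qed
      show "(\<lambda>N. exp (scale N) * (norm \<tau>)\<^sup>2 * scale N) \<longlonglongrightarrow> 0"
        using tendsto_mult[OF lim_exp scale_tendsto_0] by simp
    qed
    from tendsto_diff[OF tendsto_const[of \<tau>] this] show ?thesis by simp
  qed
  have t_lim: "t \<longlonglongrightarrow> 0"
  proof -
    have "t \<longlonglongrightarrow> 1 - exp (- (of_real 0 * \<tau>))" unfolding t_def by (intro tendsto_intros scale_tendsto_0)
    then show ?thesis by simp
  qed
  have norm_q_powr: "(\<lambda>N. norm (q N) powr p) \<longlonglongrightarrow> norm \<tau> powr p" for p
    using \<tau> by (intro tendsto_intros q_lim) auto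
  have norm_t_powr: "(\<lambda>N. norm (t N) powr \<delta>) \<longlonglongrightarrow> 0"
  proof -
    have "(\<lambda>N. norm (t N) powr \<delta>) \<longlonglongrightarrow> norm (0::complex) powr \<delta>"
      using \<delta> by (intro tendsto_powr' tendsto_norm t_lim tendsto_const) auto
    then show ?thesis using \<delta> by simp
  qed
  have near: "\<forall>\<^sub>F N in sequentially. pt N y \<in> ball 0 R \<and> dist (pt N y) (of_real R) < d" if "d > 0" for d
  proof -
    have "(\<lambda>N. of_real R - of_real R * t N) \<longlonglongrightarrow> of_real R - of_real R * 0" by (intro tendsto_intros t_lim)
    moreover have "of_real R - of_real R * t N = pt N y" for N by (simp add: t_def pt_def \<tau>_def algebra_simps)
    ultimately have "(\<lambda>N. pt N y) \<longlonglongrightarrow> of_real R" by simp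
    then have "\<forall>\<^sub>F N in sequentially. dist (pt N y) (of_real R) < d" using that by (rule tendstoD)
    then show ?thesis using eventually_gt_at_top[of 0] by eventually_elim (use pt_in_ball in blast)
  qed
  define err\<theta> where "err\<theta> = (\<lambda>N. gser \<theta> (pt N y) + of_real \<theta>s * ln (t N))"
  \<comment> \<open>The factor N is included: N |t|^(s + \<delta>) equals |q|^s |t|^\<delta> because
    N (scale N)^s = 1, so it still tends to 0.\<close>
  define err\<kappa> where "err\<kappa> = (\<lambda>N. of_nat N * (gser \<kappa> (pt N y) - (of_real (rser \<kappa> R) - t N + of_real a * t N powr of_real s)))"
  have err\<theta>: "err\<theta> \<longlonglongrightarrow> 0"
  proof -
    obtain K d where d: "d > 0" and K: "\<And>z. z \<in> ball 0 R \<Longrightarrow> dist z (of_real R) < d \<Longrightarrow>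
      norm (gser \<theta> z + of_real \<theta>s * ln (1 - z / of_real R)) \<le> K * norm (1 - z / of_real R) powr \<delta>"
      using near_\<theta> by blast
    have "\<forall>\<^sub>F N in sequentially. norm (err\<theta> N) \<le> K * norm (t N) powr \<delta>"
      using near[OF d]
    proof eventually_elim
      case (elim N)
      then show ?case using K[of "pt N y"] by (simp add: err\<theta>_def t_pt del: mem_ball)
    qed
    moreover have "(\<lambda>N. K * norm (t N) powr \<delta>) \<longlonglongrightarrow> 0"
      by (rule tendsto_mult_right_zero[OF norm_t_powr])
    ultimately show ?thesis by (rule Lim_null_comparison)
  qed
  have f_lim: "(\<lambda>N. f (pt N y)) \<longlonglongrightarrow> 1"
  proof -
    obtain K d where d: "d > 0" and K: "\<And>z. z \<in> ball 0 R \<Longrightarrow> dist z (of_real R) < d \<Longrightarrow>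
      norm (f z - 1) \<le> K * norm (1 - z / of_real R) powr \<delta>"
      using near_f by blast
    have "\<forall>\<^sub>F N in sequentially. norm (f (pt N y) - 1) \<le> K * norm (t N) powr \<delta>"
      using near[OF d]
    proof eventually_elim
      case (elim N)
      then show ?case using K[of "pt N y"] by (simp add: t_pt del: mem_ball)
    qed
    moreover have "(\<lambda>N. K * norm (t N) powr \<delta>) \<longlonglongrightarrow> 0"
      by (rule tendsto_mult_right_zero[OF norm_t_powr])
    ultimately have "(\<lambda>N. f (pt N y) - 1) \<longlonglongrightarrow> 0" by (rule Lim_null_comparison)
    then show ?thesis by (rule LIM_zero_cancel)
  qed
  have err\<kappa>: "err\<kappa> \<longlonglongrightarrow> 0"
  proof -
    obtain K d where d: "d > 0" and K: "\<And>z. z \<in> ball 0 R \<Longrightarrow> dist z (of_real R) < d \<Longrightarrow>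
      norm (gser \<kappa> z - (of_real (rser \<kappa> R) - (1 - z / of_real R) + of_real a * (1 - z / of_real R) powr of_real s))
        \<le> K * norm (1 - z / of_real R) powr (s + \<delta>)"
      using near_\<kappa> by blast
    have "\<forall>\<^sub>F N in sequentially. norm (err\<kappa> N) \<le> K * norm (q N) powr s * norm (t N) powr \<delta>"
      using near[OF d] eventually_gt_at_top[of 0]
    proof eventually_elim
      case (elim N)
      then have "norm (err\<kappa> N) \<le> real N * (K * norm (t N) powr (s + \<delta>))"
        using K[of "pt N y"] by (simp add: err\<kappa>_def t_pt norm_mult mult_left_mono del: mem_ball)
      also have "norm (t N) powr (s + \<delta>) = (scale N powr s * norm (q N) powr s) * norm (t N) powr \<delta>"
        using elim by (simp add: powr_add t_q[of N] norm_mult powr_mult)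
      also have "real N * (K * \<dots>) = (real N * scale N powr s) * (K * norm (q N) powr s * norm (t N) powr \<delta>)"
        by (simp only: mult_ac)
      finally show ?case using scale_powr[of N] elim by simp
    qed
    moreover have "(\<lambda>N. K * norm (q N) powr s * norm (t N) powr \<delta>) \<longlonglongrightarrow> K * norm \<tau> powr s * 0"
      by (intro tendsto_mult tendsto_const norm_q_powr norm_t_powr)
    ultimately show ?thesis using Lim_null_comparison by simp
  qed
  have quad: "(\<lambda>N. of_nat N * (of_real (scale N) * \<tau> - t N)) \<longlonglongrightarrow> 0"
  proof (rule Lim_null_comparison)
    show "\<forall>\<^sub>F N in sequentially. norm (of_nat N * (of_real (scale N) * \<tau> - t N)) \<le> exp (scale N) * (norm \<tau>)\<^sup>2 * (real N * (scale N)\<^sup>2)"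
    proof (rule always_eventually, rule allI)
      fix N
      have "real N * norm (of_real (scale N) * \<tau> - t N) \<le> real N * (exp (scale N) * (norm \<tau>)\<^sup>2 * (scale N)\<^sup>2)"
        using lin[of N] by (intro mult_left_mono) auto
      then show "norm (of_nat N * (of_real (scale N) * \<tau> - t N)) \<le> exp (scale N) * (norm \<tau>)\<^sup>2 * (real N * (scale N)\<^sup>2)"
        by (simp add: norm_mult mult_ac)
    qed
    show "(\<lambda>N. exp (scale N) * (norm \<tau>)\<^sup>2 * (real N * (scale N)\<^sup>2)) \<longlonglongrightarrow> 0"
      using tendsto_mult[OF lim_exp scale_square_tendsto_0] by simp
  qed
  \<comment> \<open>Damping acts on the linear term -N t of g_kappa but not on z^(-N), so N (1 -
    damp) t survives the cancellation. It is of order sqrt N * scale N.\<close>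
  have drift: "(\<lambda>N. real N * (1 - damp u N) * scale N) \<longlonglongrightarrow> 0"
  proof (rule Lim_null_comparison)
    show "\<forall>\<^sub>F N in sequentially. norm (real N * (1 - damp u N) * scale N) \<le> u * (sqrt (real N) * scale N)"
    proof (rule always_eventually, rule allI)
      fix N
      have "real N * (1 - damp u N) * scale N \<le> u * sqrt (real N) * scale N"
        using one_minus_damp(2)[OF u, of N] by (intro mult_right_mono) auto
      then show "norm (real N * (1 - damp u N) * scale N) \<le> u * (sqrt (real N) * scale N)"
        using one_minus_damp(1)[OF u, of N] by (simp add: abs_mult mult_ac)
    qed
    show "(\<lambda>N. u * (sqrt (real N) * scale N)) \<longlonglongrightarrow> 0"
      by (rule tendsto_mult_right_zero[OF sqrt_scale_tendsto_0])
  qed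
  let ?x = "\<lambda>N. complex_of_real (damp u N)"
  \<comment> \<open>The exponent of \<open>\<Phi>\<close>, joined by \<theta>s ln (scale N) from its
    prefactor, regrouped so that each summand converges. Only the terms with ln (q N) and with the
    power of q N have limits that can be nonzero.\<close>
  define A where "A = (\<lambda>N. of_real \<theta>s * of_real ((1 - damp u N) * ln (scale N)) - ?x N * of_real \<theta>s * ln (q N) + ?x N * err\<theta> N
     + ?x N * of_real a * q N powr of_real s + ?x N * err\<kappa> N + of_nat N * (of_real (scale N) * \<tau> - t N)
     + of_real (real N * (1 - damp u N) * scale N) * q N)"
  have "A \<longlonglongrightarrow> of_real \<theta>s * of_real 0 - of_real 1 * of_real \<theta>s * ln \<tau> + of_real 1 * 0 + of_real 1 * of_real a * \<tau> powr of_real s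
     + of_real 1 * 0 + 0 + of_real 0 * \<tau>"
    unfolding A_def
    by (intro tendsto_add tendsto_diff tendsto_mult tendsto_of_real tendsto_const one_minus_damp_ln_scale u damp1
        tendsto_Ln q_lim err\<theta> err\<kappa> quad drift tendsto_powr_complex \<tau>)
  then have "A \<longlonglongrightarrow> of_real a * \<tau> powr of_real s + of_real (- \<theta>s) * ln \<tau>" by simp
  then have "(\<lambda>N. f (pt N y) * exp (A N)) \<longlonglongrightarrow> 1 * exp (of_real a * \<tau> powr of_real s + of_real (- \<theta>s) * ln \<tau>)"
    by (intro tendsto_mult f_lim tendsto_exp)
  also have "1 * exp (of_real a * \<tau> powr of_real s + of_real (- \<theta>s) * ln \<tau>) = hankel_kernel \<theta>s s a \<tau>"
    using \<tau> by (simp add: hankel_kernel_def powr_def mult_exp_exp)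
  finally have lim: "(\<lambda>N. f (pt N y) * exp (A N)) \<longlonglongrightarrow> hankel_kernel \<theta>s s a \<tau>" .
  have "\<forall>\<^sub>F N in sequentially. \<bar>scale N * y\<bar> \<le> pi"
  proof -
    have "(\<lambda>N. \<bar>scale N * y\<bar>) \<longlonglongrightarrow> \<bar>0 * y\<bar>" by (intro tendsto_intros scale_tendsto_0)
    then have "\<forall>\<^sub>F N in sequentially. \<bar>scale N * y\<bar> < pi" by (rule order_tendstoD) simp
    then show ?thesis by eventually_elim simp
  qed
  then have "\<forall>\<^sub>F N in sequentially. f (pt N y) * exp (A N) = \<Phi> u N y"
    using eventually_gt_at_top[of 0]
  proof eventually_elim
    case (elim N)
    note sp = scale_pos[OF elim(2)]
    have q0: "q N \<noteq> 0" using Ret[OF elim(2)] by (auto simp: t_q[OF elim(2)])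
    \<comment> \<open>The logarithm splits without a branch correction since \<open>scale N\<close>
      is a positive real.\<close>
    have ln_t: "ln (t N) = of_real (ln (scale N)) + ln (q N)"
      unfolding t_q[OF elim(2)] using Ln_times_of_real[OF sp q0] Ln_of_real[OF sp] by (simp only:)
    have "t N powr of_real s = of_real (scale N powr s) * q N powr of_real s"
      unfolding t_q[OF elim(2)] using sp by (simp add: powr_times_real_left powr_of_real)
    then have "of_nat N * t N powr of_real s = of_real (real N * scale N powr s) * q N powr of_real s" by simp
    then have t_s: "of_nat N * t N powr of_real s = q N powr of_real s" using scale_powr[OF elim(2)] by simp
    have g\<theta>: "gser \<theta> (pt N y) = err\<theta> N - of_real \<theta>s * (of_real (ln (scale N)) + ln (q N))"
      by (simp add: err\<theta>_def ln_t)
    have g\<kappa>: "of_nat N * (gser \<kappa> (pt N y) - of_real (rser \<kappa> R)) = err\<kappa> N - of_nat N * t N + of_real a * q N powr of_real s"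
      unfolding t_s[symmetric] by (simp add: err\<kappa>_def algebra_simps)
    have drift_t: "of_real (real N * (1 - damp u N) * scale N) * q N = of_nat N * (1 - ?x N) * t N"
      unfolding t_q[OF elim(2)] by (simp add: mult_ac)
    have "of_real \<theta>s * of_real (ln (scale N)) + (?x N * (gser \<theta> (pt N y) + of_nat N * (gser \<kappa> (pt N y) - of_real (rser \<kappa> R)))
       + of_nat N * of_real (scale N) * \<tau>) = A N"
      unfolding g\<theta> g\<kappa> A_def drift_t by (simp add: algebra_simps)
    moreover have "of_real (scale N powr \<theta>s) = exp (of_real \<theta>s * of_real (ln (scale N)) :: complex)"
      using sp by (simp add: powr_def flip: of_real_mult exp_of_real)
    ultimately show ?case
      using elim(1) by (simp add: \<Phi>_def \<tau>_def[symmetric] mult_exp_exp)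
  qed
  then show ?thesis using lim by (auto simp: \<tau>_def intro: Lim_transform_eventually)
qed

end

section \<open>The integrable majorant and the passage to the limit\<close>

context critical_asymptotics
begin

text \<open>On the circle exp(g_theta) is dominated by its value at the positive real point, which
  the expansion bounds by a multiple of \<epsilon>^(-\<theta>s); exactly this power is compensated
  by the prefactor of \<open>\<Phi>\<close>.\<close>

lemma exp_rser_bound:
  obtains \<epsilon>1 C where "\<epsilon>1 > 0" "C > 0"
    "\<And>\<epsilon>. 0 < \<epsilon> \<Longrightarrow> \<epsilon> \<le> \<epsilon>1 \<Longrightarrow> \<epsilon> powr \<theta>s * exp (rser \<theta> (R * exp (- \<epsilon>))) \<le> C"
proof -
  obtain K d where d: "d > 0" and K: "\<And>z. z \<in> ball 0 R \<Longrightarrow> dist z (of_real R) < d \<Longrightarrow>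
      norm (gser \<theta> z + of_real \<theta>s * ln (1 - z / of_real R)) \<le> K * norm (1 - z / of_real R) powr \<delta>"
    using near_\<theta> by blast
  \<comment> \<open>\<epsilon> \<le> 1 gives \<epsilon>/2 \<le> 1 - exp(-\<epsilon>) \<le>
    \<epsilon>, and d/(2R) keeps the point within distance d of R.\<close>
  define \<epsilon>1 where "\<epsilon>1 = min 1 (d / (2 * R))"
  have \<epsilon>1: "\<epsilon>1 > 0" "\<epsilon>1 \<le> 1" "\<epsilon>1 \<le> d / (2 * R)" using d R_pos by (auto simp: \<epsilon>1_def)
  show ?thesis
  proof (rule that[OF \<epsilon>1(1)])
    show "2 powr \<theta>s * exp \<bar>K\<bar> > 0" by simp
    fix \<epsilon> :: real assume \<epsilon>: "0 < \<epsilon>" "\<epsilon> \<le> \<epsilon>1"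
    define r where "r = R * exp (- \<epsilon>)"
    define t where "t = 1 - exp (- \<epsilon>)"
    have r: "0 \<le> r" "r < R" using R_pos \<epsilon> by (auto simp: r_def)
    have t_le: "t \<le> \<epsilon>" using exp_ge_add_one_self[of "- \<epsilon>"] by (simp add: t_def)
    have "\<epsilon>\<^sup>2 \<le> \<epsilon> * 1" unfolding power2_eq_square using \<epsilon> \<epsilon>1 by (intro mult_left_mono) auto
    then have t_ge: "\<epsilon> / 2 \<le> t" using one_minus_exp_neg_ge[of \<epsilon>] \<epsilon> by (simp add: t_def)
    have t01: "0 < t" "t \<le> 1" using t_ge \<epsilon> by (auto simp: t_def)
    have tr: "1 - complex_of_real r / of_real R = of_real t" using R_pos by (simp add: r_def t_def)
    have "dist (complex_of_real r) (of_real R) < d"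
    proof -
      have "dist (complex_of_real r) (of_real R) = R - r" using r by (simp add: dist_of_real dist_real_def)
      also have "\<dots> = R * t" by (simp add: r_def t_def algebra_simps)
      finally have "dist (complex_of_real r) (of_real R) = R * t" .
      also have "\<dots> \<le> R * (d / (2 * R))" using t_le \<epsilon> \<epsilon>1 R_pos by (intro mult_left_mono) auto
      also have "\<dots> < d" using R_pos d by simp
      finally show ?thesis .
    qed
    then have "norm (gser \<theta> (of_real r) + of_real \<theta>s * ln (of_real t)) \<le> K * norm (of_real t :: complex) powr \<delta>"
      using K[of "of_real r"] r by (simp add: tr)
    also have "gser \<theta> (of_real r) = of_real (rser \<theta> r)" by (rule gser_of_real[OF \<theta>_nonneg radius_\<theta> r])
    also have "of_real (rser \<theta> r) + of_real \<theta>s * ln (of_real t) = complex_of_real (rser \<theta> r + \<theta>s * ln t)"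
      using t01 by (simp add: Ln_of_real)
    also have "K * norm (of_real t :: complex) powr \<delta> \<le> \<bar>K\<bar> * 1"
      using t01 \<delta> powr_mono2[of \<delta> t 1] by (intro mult_mono) auto
    finally have "rser \<theta> r \<le> \<bar>K\<bar> + \<theta>s * (- ln t)" unfolding norm_of_real by simp
    also have "\<theta>s * (- ln t) \<le> \<theta>s * (- ln (\<epsilon> / 2))"
      using t_ge \<epsilon> t01 \<theta>s by (intro mult_left_mono) auto
    finally have "exp (rser \<theta> r) \<le> exp \<bar>K\<bar> * exp (\<theta>s * (- ln (\<epsilon> / 2)))" by (simp add: mult_exp_exp)
    also have "exp (\<theta>s * (- ln (\<epsilon> / 2))) = 2 powr \<theta>s * \<epsilon> powr (- \<theta>s)"
      using \<epsilon> by (simp add: powr_def ln_div mult_exp_exp algebra_simps)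
    finally have "\<epsilon> powr \<theta>s * exp (rser \<theta> r) \<le> \<epsilon> powr \<theta>s * (exp \<bar>K\<bar> * (2 powr \<theta>s * \<epsilon> powr (- \<theta>s)))"
      by (intro mult_left_mono) auto
    also have "\<dots> = 2 powr \<theta>s * exp \<bar>K\<bar>" using \<epsilon> by (simp add: powr_minus field_simps)
    finally show "\<epsilon> powr \<theta>s * exp (rser \<theta> (R * exp (- \<epsilon>))) \<le> 2 powr \<theta>s * exp \<bar>K\<bar>" by (simp only: r_def)
  qed
qed

text \<open>With x = \<open>damp u N\<close> and e = \<open>scale N\<close>, the exponent has real
  part x Re g_theta + x N (Re g_kappa - g_kappa(R) + e) + N (1 - x) e. Nonnegative coefficients
  bound the first term by \<open>rser \<theta>\<close>, \<open>key_bound\<close> and N e^s = 1 bound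
  the second, and sqrt N * e \<le> 1 bounds the third by u.\<close>

lemma \<Phi>_dominated:
  assumes u: "u \<ge> 0"
  obtains N0 c C where "c > 0" "N0 > 0" "\<And>N y. N \<ge> N0 \<Longrightarrow> norm (\<Phi> u N y) \<le> C * exp (- c * \<bar>y\<bar> powr s)"
proof -
  obtain \<epsilon>0 c C where c: "\<epsilon>0 > 0" "c > 0" "C > 0" and key:
    "\<And>\<epsilon> \<alpha>. 0 < \<epsilon> \<Longrightarrow> \<epsilon> \<le> \<epsilon>0 \<Longrightarrow> \<bar>\<alpha>\<bar> \<le> pi \<Longrightarrow>
       Re (gser \<kappa> (of_real R * exp (Complex (- \<epsilon>) \<alpha>))) \<le> rser \<kappa> R - \<epsilon> - c * \<bar>\<alpha>\<bar> powr s + C * \<epsilon> powr s"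
    using key_bound by blast
  obtain \<epsilon>1 C1 where \<epsilon>1: "\<epsilon>1 > 0" "C1 > 0" and g\<theta>:
    "\<And>\<epsilon>. 0 < \<epsilon> \<Longrightarrow> \<epsilon> \<le> \<epsilon>1 \<Longrightarrow> \<epsilon> powr \<theta>s * exp (rser \<theta> (R * exp (- \<epsilon>))) \<le> C1"
    using exp_rser_bound by blast
  obtain B where B: "\<And>z. z \<in> ball 0 R \<Longrightarrow> norm (f z) \<le> B"
    using f_bounded unfolding bounded_iff by blast
  have B0: "B \<ge> 0" using B[of 0] R_pos norm_ge_zero[of "f 0"] by (meson centre_in_ball order_trans)
  have "\<forall>\<^sub>F N in sequentially. N > 0 \<and> scale N \<le> \<epsilon>0 \<and> scale N \<le> \<epsilon>1 \<and> sqrt (real N) * scale N \<le> 1"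
    using eventually_gt_at_top[of 0] order_tendstoD(2)[OF scale_tendsto_0 c(1)]
      order_tendstoD(2)[OF scale_tendsto_0 \<epsilon>1(1)] order_tendstoD(2)[OF sqrt_scale_tendsto_0 zero_less_one]
    by eventually_elim auto
  then obtain N1 where N1: "\<And>N. N \<ge> N1 \<Longrightarrow> N > 0 \<and> scale N \<le> \<epsilon>0 \<and> scale N \<le> \<epsilon>1 \<and> sqrt (real N) * scale N \<le> 1"
    unfolding eventually_sequentially by blast
  have "norm (\<Phi> u N y) \<le> C1 * B * exp (C + u) * exp (- (c * exp (- u)) * \<bar>y\<bar> powr s)" if "N \<ge> Suc N1" for N y
  proof (cases "\<bar>scale N * y\<bar> \<le> pi")
    case True
    have N: "N > 0" "scale N \<le> \<epsilon>0" "scale N \<le> \<epsilon>1" "sqrt (real N) * scale N \<le> 1"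
      using N1[of N] that by auto
    define e where "e = scale N"
    define x where "x = damp u N"
    have e: "e > 0" using scale_pos[OF N(1)] by (simp add: e_def)
    have x: "0 < x" "x \<le> 1" using u by (auto simp: x_def)
    \<comment> \<open>Damping reduces the decay rate c by the factor x; for N \<ge> 1 it stays above
      exp(-u), so one rate serves all N.\<close>
    have x_ge: "exp (- u) \<le> x"
    proof -
      have "u / sqrt (real N) \<le> u / 1" using N(1) u by (intro divide_left_mono) auto
      then show ?thesis by (simp add: x_def)
    qed
    define z where "z = pt N y"
    have z: "z \<in> ball 0 R" "norm z = R * exp (- e)"
      using pt_in_ball[OF N(1)] R_pos by (auto simp: z_def pt_eq norm_mult e_def)
    have "Re (gser \<theta> z) \<le> rser \<theta> (norm z)" using z(1) by (intro Re_gser_le[OF \<theta>_nonneg radius_\<theta>]) simp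
    then have "x * Re (gser \<theta> z) \<le> x * rser \<theta> (R * exp (- e))" using x z(2) by (intro mult_left_mono) auto
    also have "\<dots> \<le> rser \<theta> (R * exp (- e))"
      using x rser_nonneg[OF \<theta>_nonneg radius_\<theta>, of "R * exp (- e)"] R_pos e by (intro mult_left_le_one_le) auto
    finally have G1: "x * Re (gser \<theta> z) \<le> rser \<theta> (R * exp (- e))" .
    have "Re (gser \<kappa> z) \<le> rser \<kappa> R - e - c * \<bar>- (e * y)\<bar> powr s + C * e powr s"
      unfolding z_def pt_eq e_def by (rule key) (use True N in auto)
    moreover have "\<bar>- (e * y)\<bar> powr s = e powr s * \<bar>y\<bar> powr s" using e by (simp add: abs_mult powr_mult)
    ultimately have "Re (gser \<kappa> z) - rser \<kappa> R + e \<le> e powr s * (C - c * \<bar>y\<bar> powr s)"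
      by (simp add: algebra_simps)
    then have "(x * real N) * (Re (gser \<kappa> z) - rser \<kappa> R + e) \<le> (x * real N) * (e powr s * (C - c * \<bar>y\<bar> powr s))"
      using x by (intro mult_left_mono) auto
    also have "\<dots> = x * (C - c * \<bar>y\<bar> powr s) * (real N * e powr s)" by (simp only: mult_ac)
    also have "real N * e powr s = 1" using scale_powr[OF N(1)] by (simp only: e_def)
    also have "x * (C - c * \<bar>y\<bar> powr s) * 1 \<le> C - c * exp (- u) * \<bar>y\<bar> powr s"
    proof -
      have "x * C \<le> C" using x c by (simp add: mult_left_le_one_le)
      moreover have "exp (- u) * (c * \<bar>y\<bar> powr s) \<le> x * (c * \<bar>y\<bar> powr s)" using x_ge c by (intro mult_right_mono) auto
      ultimately show ?thesis by (simp add: algebra_simps)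
    qed
    finally have G2: "(x * real N) * (Re (gser \<kappa> z) - rser \<kappa> R + e) \<le> C - c * exp (- u) * \<bar>y\<bar> powr s" .
    have G3: "real N * (1 - x) * e \<le> u"
    proof -
      have "real N * (1 - x) * e \<le> u * sqrt (real N) * e"
        using one_minus_damp(2)[OF u, of N] e by (intro mult_right_mono) (auto simp: x_def)
      also have "\<dots> = u * (sqrt (real N) * e)" by simp
      also have "\<dots> \<le> u * 1" using u N(4) by (intro mult_left_mono) (auto simp: e_def)
      finally show ?thesis by simp
    qed
    let ?E = "of_real x * (gser \<theta> z + of_nat N * (gser \<kappa> z - of_real (rser \<kappa> R))) + of_nat N * of_real e * Complex 1 y"
    have "Re ?E = x * Re (gser \<theta> z) + (x * real N) * (Re (gser \<kappa> z) - rser \<kappa> R + e) + real N * (1 - x) * e"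
      by (simp add: algebra_simps)
    also have "\<dots> \<le> rser \<theta> (R * exp (- e)) + (C - c * exp (- u) * \<bar>y\<bar> powr s) + u"
      using G1 G2 G3 by (intro add_mono)
    finally have "exp (Re ?E) \<le> exp (rser \<theta> (R * exp (- e))) * (exp (C + u) * exp (- (c * exp (- u)) * \<bar>y\<bar> powr s))"
      by (simp add: mult_exp_exp algebra_simps)
    then have "norm (exp ?E) \<le> exp (rser \<theta> (R * exp (- e))) * (exp (C + u) * exp (- (c * exp (- u)) * \<bar>y\<bar> powr s))"
      by (simp only: norm_exp_eq_Re)
    then have "norm (f z) * norm (exp ?E) \<le> B * (exp (rser \<theta> (R * exp (- e))) * (exp (C + u) * exp (- (c * exp (- u)) * \<bar>y\<bar> powr s)))"
      using B[OF z(1)] B0 by (intro mult_mono) auto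
    then have "e powr \<theta>s * (norm (f z) * norm (exp ?E)) \<le>
        e powr \<theta>s * (B * (exp (rser \<theta> (R * exp (- e))) * (exp (C + u) * exp (- (c * exp (- u)) * \<bar>y\<bar> powr s))))"
      by (intro mult_left_mono) auto
    also have "\<dots> = (e powr \<theta>s * exp (rser \<theta> (R * exp (- e)))) * (B * exp (C + u) * exp (- (c * exp (- u)) * \<bar>y\<bar> powr s))"
      by (simp only: mult_ac)
    also have "\<dots> \<le> C1 * (B * exp (C + u) * exp (- (c * exp (- u)) * \<bar>y\<bar> powr s))"
      using g\<theta>[of e] e N(3) B0 by (intro mult_right_mono) (auto simp: e_def)
    also have "e powr \<theta>s * (norm (f z) * norm (exp ?E)) = norm (\<Phi> u N y)"
      using True by (simp add: \<Phi>_def norm_mult x_def e_def z_def)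
    finally show ?thesis by (simp only: mult_ac)
  next
    case False
    then show ?thesis using \<epsilon>1 B0 by (simp add: \<Phi>_def)
  qed
  then show ?thesis using that[of "c * exp (- u)" "Suc N1" "C1 * B * exp (C + u)"] c by simp
qed

lemma \<Phi>_measurable:
  assumes "N > 0"
  shows "\<Phi> u N \<in> borel_measurable borel"
proof -
  have pt: "continuous_on UNIV (pt N)"
    unfolding pt_def by (intro continuous_intros continuous_on_Complex)
  note comp = continuous_on_compose2[OF holomorphic_on_imp_continuous_on pt]
  have "continuous_on UNIV (\<lambda>y. of_real (scale N powr \<theta>s) * f (pt N y) *
     exp (of_real (damp u N) * (gser \<theta> (pt N y) + of_nat N * (gser \<kappa> (pt N y) - of_real (rser \<kappa> R)))
       + of_nat N * of_real (scale N) * Complex 1 y))"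
    using pt_in_ball[OF assms]
    by (intro continuous_intros continuous_on_Complex comp[OF f_holo] comp[OF gser_holomorphic[OF \<theta>_nonneg radius_\<theta>]]
        comp[OF gser_holomorphic[OF \<kappa>_nonneg radius_\<kappa>]]) auto
  note meas = borel_measurable_continuous_onI[OF this]
  have "{y \<in> space borel. \<bar>scale N * y\<bar> \<le> pi} \<in> sets borel" by measurable
  with meas show ?thesis
    unfolding \<Phi>_def[abs_def] by (rule measurable_If[OF _ borel_measurable_const])
qed

lemma \<Phi>_integral_limit:
  assumes u: "u \<ge> 0"
  shows "(\<lambda>N. LINT y|lborel. \<Phi> u N y) \<longlonglongrightarrow>
    of_real (2 * pi * a powr ((\<theta>s - 1) / s) / (s * Gamma ((s - 1 + \<theta>s) / s)))"
proof -
  obtain c N0 C where c: "c > 0" "N0 > 0" and dom: "\<And>N y. N \<ge> N0 \<Longrightarrow> norm (\<Phi> u N y) \<le> C * exp (- c * \<bar>y\<bar> powr s)"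
    by (rule \<Phi>_dominated[OF u]) (rule that)
  have "(\<lambda>n. LINT y|lborel. \<Phi> u (n + N0) y) \<longlonglongrightarrow> (LINT y|lborel. hankel_kernel \<theta>s s a (Complex 1 y))"
  proof (rule integral_dominated_convergence)
    show "(\<lambda>y. hankel_kernel \<theta>s s a (Complex 1 y)) \<in> borel_measurable lborel"
      using borel_measurable_integrable[OF hankel_kernel_integrable[OF s \<theta>s a zero_less_one]] .
    show "\<Phi> u (n + N0) \<in> borel_measurable lborel" for n using \<Phi>_measurable[of "n + N0" u] c by simp
    show "integrable lborel (\<lambda>y. C * exp (- c * \<bar>y\<bar> powr s))"
      using integrable_exp_minus_abs_powr[OF c(1), of s] s by auto
    show "AE y in lborel. (\<lambda>n. \<Phi> u (n + N0) y) \<longlonglongrightarrow> hankel_kernel \<theta>s s a (Complex 1 y)"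
      by (intro AE_I2 LIMSEQ_ignore_initial_segment \<Phi>_pointwise u)
    show "AE y in lborel. norm (\<Phi> u (n + N0) y) \<le> C * exp (- c * \<bar>y\<bar> powr s)" for n
      by (intro AE_I2 dom) simp
  qed
  then have "(\<lambda>N. LINT y|lborel. \<Phi> u N y) \<longlonglongrightarrow> (LINT y|lborel. hankel_kernel \<theta>s s a (Complex 1 y))"
    by (rule LIMSEQ_offset)
  then show ?thesis by (simp only: hankel_integral[OF s \<theta>s a])
qed

text \<open>The exponent must be known up to o(1), so exp(-u/sqrt N) is expanded to second order;
  the next term, after multiplication by N, is O(N^(-1/2)).\<close>

lemma damp_expansion:
  assumes "u \<ge> 0"
  shows "(\<lambda>N. exp (damp u N * real N * S) / exp (real N * S - sqrt (real N) * u * S + u\<^sup>2 / 2 * S)) \<longlonglongrightarrow> 1"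
proof -
  have "(\<lambda>N. damp u N * real N - (real N - sqrt (real N) * u + u\<^sup>2 / 2)) \<longlonglongrightarrow> 0"
  proof (cases "u = 0")
    case False
    then have "u > 0" using assms by simp
    then show ?thesis unfolding power2_eq_square by real_asymp
  qed simp
  then have "(\<lambda>N. (damp u N * real N - (real N - sqrt (real N) * u + u\<^sup>2 / 2)) * S) \<longlonglongrightarrow> 0"
    by (rule tendsto_mult_left_zero)
  from tendsto_exp[OF this] show ?thesis by (simp add: exp_diff[symmetric] algebra_simps)
qed

lemma coefficient_asymptotics:
  assumes u: "u \<ge> 0"
  shows "(\<lambda>N. zcoeff N (\<lambda>z. f z * exp (of_real (damp u N) * (gser \<theta> z + of_nat N * gser \<kappa> z))))
    \<sim>[at_top] (\<lambda>N. complex_of_real (exp (real N * rser \<kappa> R - sqrt (real N) * u * rser \<kappa> R + u\<^sup>2 / 2 * rser \<kappa> R) / R ^ N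
         * (real N * a) powr ((\<theta>s - 1) / s) / (s * Gamma ((s - 1 + \<theta>s) / s))))"
    (is "?z \<sim>[_] ?T")
proof (rule asymp_equivI')
  define L where "L = a powr ((\<theta>s - 1) / s) / (s * Gamma ((s - 1 + \<theta>s) / s))"
  have "Gamma ((s - 1 + \<theta>s) / s) > 0" using s \<theta>s by (intro Gamma_real_pos) auto
  then have L: "L > 0" using a s by (simp add: L_def)
  let ?D = "\<lambda>N. exp (damp u N * real N * rser \<kappa> R) / exp (real N * rser \<kappa> R - sqrt (real N) * u * rser \<kappa> R + u\<^sup>2 / 2 * rser \<kappa> R)"
  have "(\<lambda>N. of_real (?D N) * ((LINT y|lborel. \<Phi> u N y) / of_real (2 * pi * L))) \<longlonglongrightarrow> of_real 1 * (of_real (2 * pi * L) / of_real (2 * pi * L))"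
    using \<Phi>_integral_limit[OF u] L
    by (intro tendsto_mult tendsto_of_real damp_expansion u tendsto_divide tendsto_const) (auto simp: L_def)
  then have lim: "(\<lambda>N. of_real (?D N) * ((LINT y|lborel. \<Phi> u N y) / of_real (2 * pi * L))) \<longlonglongrightarrow> 1" using L by simp
  have "\<forall>\<^sub>F N in sequentially. of_real (?D N) * ((LINT y|lborel. \<Phi> u N y) / of_real (2 * pi * L)) = ?z N / ?T N"
    using eventually_gt_at_top[of 0]
  proof eventually_elim
    case (elim N)
    have T: "exp (real N * rser \<kappa> R - sqrt (real N) * u * rser \<kappa> R + u\<^sup>2 / 2 * rser \<kappa> R) / R ^ N
         * (real N * a) powr ((\<theta>s - 1) / s) / (s * Gamma ((s - 1 + \<theta>s) / s)) =
       exp (real N * rser \<kappa> R - sqrt (real N) * u * rser \<kappa> R + u\<^sup>2 / 2 * rser \<kappa> R) / R ^ N * (real N powr ((\<theta>s - 1) / s) * L)"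
      using a elim by (simp add: L_def powr_mult)
    have sc: "scale N powr (1 - \<theta>s) = real N powr ((\<theta>s - 1) / s)"
      using s by (simp add: powr_powr algebra_simps diff_divide_distrib)
    have pos: "real N powr ((\<theta>s - 1) / s) > 0" "R ^ N > 0" "R \<noteq> 0" using elim R_pos by auto
    have X: "scale N powr (1 - \<theta>s) * exp (damp u N * real N * rser \<kappa> R) / (2 * pi * R ^ N) =
      ?D N * (1 / (2 * pi * L)) * (exp (real N * rser \<kappa> R - sqrt (real N) * u * rser \<kappa> R + u\<^sup>2 / 2 * rser \<kappa> R) / R ^ N * (real N powr ((\<theta>s - 1) / s) * L))"
      unfolding sc using L pos by (simp add: field_simps)
    have alg: "of_real d * (I / of_real m) = of_real (d * (1 / m) * t) * I / complex_of_real t" if "t \<noteq> 0" for d m t :: real and I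
      using that by simp
    show ?case
      unfolding zcoeff_eq_integral[OF elim] T X by (rule alg) (use L pos in auto)
  qed
  then show "(\<lambda>N. ?z N / ?T N) \<longlonglongrightarrow> 1"
    using lim by (rule Lim_transform_eventually[rotated])
qed

end

section \<open>From the Delta-domain to inequalities on the disc\<close>

lemma cball_subset_Delta0:
  assumes R: "R > 0" and \<eta>: "\<eta> > 0" and \<phi>: "0 < \<phi>" "\<phi> < pi / 2"
  shows "cball 0 R - {of_real R} \<subseteq> Delta0 R \<eta> \<phi>"
proof
  fix z assume z: "z \<in> cball 0 R - {complex_of_real R}"
  have cos\<phi>: "cos \<phi> > 0" using \<phi> by (intro cos_gt_zero) auto
  have "1 < Re (1 + complex_of_real \<eta> * cis \<phi>)" using \<eta> cos\<phi> by simp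
  also have "\<dots> \<le> cmod (1 + complex_of_real \<eta> * cis \<phi>)" by (rule complex_Re_le_cmod)
  finally have "R < R * cmod (1 + complex_of_real \<eta> * cis \<phi>)" using R by simp
  then have 1: "cmod z < R * cmod (1 + complex_of_real \<eta> * cis \<phi>)" using z by simp
  \<comment> \<open>Other than R itself, the closed disc lies strictly left of the line Re z = R; so
    z - R has argument beyond pi/2 in absolute value, hence beyond \<phi>.\<close>
  have "Re z < R"
  proof (rule ccontr)
    assume "\<not> Re z < R"
    then have Re: "Re z = R" using complex_Re_le_cmod[of z] z by simp
    have "(cmod z)\<^sup>2 \<le> R\<^sup>2" using z R by (intro power_mono) auto
    then have "Im z = 0" using Re by (simp add: cmod_power2)
    with Re z show False by (auto simp: complex_eq_iff)
  qed
  then have Re: "Re (z - of_real R) < 0" by simp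
  then have "cos (Arg (z - of_real R)) < 0" 
    using cos_Arg[of "z - of_real R"] z by (auto simp: divide_less_0_iff)
  then have "\<bar>Arg (z - of_real R)\<bar> > \<phi>"
    using cos_gt_zero_pi[of "Arg (z - of_real R)"] \<phi> by (force simp: abs_le_iff not_less)
  then show "z \<in> Delta0 R \<eta> \<phi>" using 1 z by (simp add: Delta0_def)
qed

text \<open>Turns a Landau bound into an explicit one with a real power, since a complex power with
  real exponent has norm |g z|^p. Replacing h by h' on B exchanges a continuation for its power
  series.\<close>

lemma bigo_powr_within_imp_bound:
  fixes h h' g :: "complex \<Rightarrow> complex"
  assumes "h \<in> O[at z0 within A](\<lambda>z. g z powr complex_of_real p)" "B \<subseteq> A" "z0 \<notin> B"
    and eq: "\<And>z. z \<in> B \<Longrightarrow> h z = h' z"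
  shows "\<exists>K d. d > 0 \<and> (\<forall>z\<in>B. dist z z0 < d \<longrightarrow> norm (h' z) \<le> K * norm (g z) powr p)"
proof -
  obtain K where "\<forall>\<^sub>F z in at z0 within A. norm (h z) \<le> K * norm (g z powr complex_of_real p)"
    using assms(1) by (auto elim: landau_o.bigE)
  then obtain d where "d > 0" "\<forall>z\<in>A. z \<noteq> z0 \<and> dist z z0 < d \<longrightarrow> norm (h z) \<le> K * norm (g z powr complex_of_real p)"
    unfolding eventually_at by blast
  then show ?thesis using assms(2,3)
    by (intro exI[of _ K] exI[of _ d]) (auto simp: norm_powr_real_powr' simp flip: eq)
qed

lemma asymp_equiv_of_real_imp:
  assumes "(\<lambda>n. complex_of_real (f n)) \<sim>[F] (\<lambda>n. complex_of_real (g n))"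
  shows "f \<sim>[F] g"
proof (rule asymp_equivI)
  let ?q = "\<lambda>n. if f n = 0 \<and> g n = 0 then 1 else f n / g n"
  have "(\<lambda>n. if complex_of_real (f n) = 0 \<and> complex_of_real (g n) = 0 then 1
      else complex_of_real (f n) / complex_of_real (g n)) = (\<lambda>n. complex_of_real (?q n))"
    by (auto simp: fun_eq_iff)
  with asymp_equivD[OF assms] have "((\<lambda>n. complex_of_real (?q n)) \<longlongrightarrow> of_real 1) F"
    by (simp only: of_real_1)
  then show "(?q \<longlongrightarrow> 1) F" by (simp only: tendsto_of_real_iff)
qed

text \<open>Removing a small ball around z0 from the closed disc leaves a compact set on which f is
  continuous; near z0 the given bound takes over.\<close>

lemma bounded_image_ball_near:
  fixes f :: "complex \<Rightarrow> complex"
  assumes cont: "continuous_on (cball 0 R - {z0}) f"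
    and near: "d > 0" "\<And>z. z \<in> ball 0 R \<Longrightarrow> dist z z0 < d \<Longrightarrow> norm (f z) \<le> B"
  shows "bounded (f ` ball 0 R)"
proof -
  have "compact (f ` (cball 0 R - ball z0 d))"
    using near(1) by (intro compact_continuous_image continuous_on_subset[OF cont] compact_diff) auto
  then have "bounded (f ` (cball 0 R - ball z0 d))" by (rule compact_imp_bounded)
  moreover have "bounded (f ` (ball 0 R \<inter> ball z0 d))"
    using near(2) by (auto simp: bounded_iff dist_commute intro!: exI[of _ B])
  ultimately have "bounded (f ` (cball 0 R - ball z0 d) \<union> f ` (ball 0 R \<inter> ball z0 d))" by simp
  then show ?thesis by (rule bounded_subset) auto
qed

theorem theorem3p13:
  fixes \<theta> \<kappa> :: "nat \<Rightarrow> real" and R \<eta> \<phi> \<theta>s \<delta> s a :: real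
    and Gth Gka f :: "complex \<Rightarrow> complex"
  assumes th_nonneg: "\<forall>j\<ge>1. \<theta> j \<ge> 0" and ka_nonneg: "\<forall>j\<ge>1. \<kappa> j \<ge> 0"
    and nonarith: "non_arithmetic \<kappa>" and ka_pos: "\<exists>j\<ge>2. \<kappa> j > 0"
    and R_pos: "R > 0"
    and rad_th: "conv_radius (gcoef \<theta>) = ereal R"
    and rad_ka: "conv_radius (gcoef \<kappa>) = ereal R"
    and \<eta>: "\<eta> > 0" and \<phi>: "0 < \<phi>" "\<phi> < pi / 2"
    and Gth_hol: "Gth holomorphic_on Delta0 R \<eta> \<phi>"
    and Gth_ext: "\<forall>z\<in>ball 0 R. Gth z = gser \<theta> z"
    and Gka_hol: "Gka holomorphic_on Delta0 R \<eta> \<phi>"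
    and Gka_ext: "\<forall>z\<in>ball 0 R. Gka z = gser \<kappa> z"
    and ka1: "((\<lambda>r. \<Sum>j. \<kappa> j * r ^ j) \<longlongrightarrow> 1) (at_left R)"
    and \<theta>s: "\<theta>s \<ge> 0" and \<delta>: "\<delta> > 0" and s: "1 < s" "s < 2" and a: "a > 0"
    and exp_th: "(\<lambda>z. Gth z - (- complex_of_real \<theta>s * ln (1 - z / complex_of_real R)))
        \<in> O[(at (complex_of_real R) within Delta0 R \<eta> \<phi>)](\<lambda>z. (1 - z / complex_of_real R) powr complex_of_real \<delta>)"
    and exp_ka: "(\<lambda>z. Gka z - (complex_of_real (\<Sum>j. \<kappa> j * R ^ j / real j)
            - (1 - z / complex_of_real R)
            + complex_of_real a * (1 - z / complex_of_real R) powr complex_of_real s))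
        \<in> O[(at (complex_of_real R) within Delta0 R \<eta> \<phi>)](\<lambda>z. (1 - z / complex_of_real R) powr complex_of_real (s + \<delta>))"
    and f_hol: "f holomorphic_on Delta0 R \<eta> \<phi>"
    and f_exp: "(\<lambda>z. f z - 1)
        \<in> O[(at (complex_of_real R) within Delta0 R \<eta> \<phi>)](\<lambda>z. (1 - z / complex_of_real R) powr complex_of_real \<delta>)"
  shows "(\<forall>u::real\<ge>0.
      (\<lambda>N::nat. zcoeff N (\<lambda>z. f z * exp (complex_of_real (exp (- u / sqrt (real N)))
            * (gser \<theta> z + of_nat N * gser \<kappa> z))))
      \<sim>[at_top]
      (\<lambda>N::nat. complex_of_real (
         exp (real N * (\<Sum>j. \<kappa> j * R ^ j / real j)
              - sqrt (real N) * u * (\<Sum>j. \<kappa> j * R ^ j / real j)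
              + u\<^sup>2 / 2 * (\<Sum>j. \<kappa> j * R ^ j / real j)) / R ^ N
         * (real N * a) powr ((\<theta>s - 1) / s) / (s * Gamma ((s - 1 + \<theta>s) / s)))))
    \<and> (\<lambda>N. H \<theta> \<kappa> N) \<sim>[at_top]
      (\<lambda>N. exp (real N * (\<Sum>j. \<kappa> j * R ^ j / real j)) * (real N * a) powr ((\<theta>s - 1) / s)
          / (s * R ^ N * Gamma ((s - 1 + \<theta>s) / s)))"
proof -
  let ?R = "complex_of_real R"
  have sub: "cball 0 R - {?R} \<subseteq> Delta0 R \<eta> \<phi>" by (rule cball_subset_Delta0[OF R_pos \<eta> \<phi>])
  have notin: "?R \<notin> ball 0 R" using R_pos by simp
  have ball: "ball 0 R \<subseteq> Delta0 R \<eta> \<phi>" using sub notin by (force simp: less_imp_le)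
  have S: "rser \<kappa> R = (\<Sum>j. \<kappa> j * R ^ j / real j)" by (simp add: rser_def)
  note bound = bigo_powr_within_imp_bound[OF _ ball notin]
  have near_f: "\<exists>K d. d > 0 \<and> (\<forall>z\<in>ball 0 R. dist z ?R < d \<longrightarrow> norm (f z - 1) \<le> K * norm (1 - z / ?R) powr \<delta>)"
    by (rule bound[OF f_exp]) simp
  then obtain Kf df where Kf: "df > 0" "\<And>z. z \<in> ball 0 R \<Longrightarrow> dist z ?R < df \<Longrightarrow> norm (f z - 1) \<le> Kf * norm (1 - z / ?R) powr \<delta>"
    by blast
  have f_bounded: "bounded (f ` ball 0 R)"
  proof (rule bounded_image_ball_near)
    show "continuous_on (cball 0 R - {?R}) f"
      by (rule continuous_on_subset[OF holomorphic_on_imp_continuous_on[OF f_hol] sub])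
    show "norm (f z) \<le> 1 + \<bar>Kf\<bar> * 2 powr \<delta>" if "z \<in> ball 0 R" "dist z ?R < df" for z
    proof -
      have "norm (1 - z / ?R) \<le> norm (1 :: complex) + norm (z / ?R)" by (rule norm_triangle_ineq4)
      also have "\<dots> \<le> 2" using that R_pos by (simp add: norm_divide field_simps)
      finally have "norm (1 - z / ?R) powr \<delta> \<le> 2 powr \<delta>" using \<delta> by (intro powr_mono2) auto
      then have "Kf * norm (1 - z / ?R) powr \<delta> \<le> \<bar>Kf\<bar> * 2 powr \<delta>" by (intro mult_mono) auto
      then have "norm (f z - 1) \<le> \<bar>Kf\<bar> * 2 powr \<delta>" using Kf(2)[OF that] by linarith
      then show ?thesis using norm_triangle_ineq[of "f z - 1" 1] by simp
    qed
  qed (rule Kf(1))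
  have near_\<kappa>: "\<exists>K d. d > 0 \<and> (\<forall>z\<in>ball 0 R. dist z ?R < d \<longrightarrow>
      norm (gser \<kappa> z - (of_real (rser \<kappa> R) - (1 - z / ?R) + of_real a * (1 - z / ?R) powr of_real s))
        \<le> K * norm (1 - z / ?R) powr (s + \<delta>))"
    by (rule bound[OF exp_ka]) (simp only: S Gka_ext)
  have near_\<theta>: "\<exists>K d. d > 0 \<and> (\<forall>z\<in>ball 0 R. dist z ?R < d \<longrightarrow>
      norm (gser \<theta> z + of_real \<theta>s * ln (1 - z / ?R)) \<le> K * norm (1 - z / ?R) powr \<delta>)"
    by (rule bound[OF exp_th]) (simp add: Gth_ext)
  interpret base: critical_series \<kappa> R s \<delta> a
    using ka_nonneg nonarith R_pos rad_ka s a \<delta> near_\<kappa> by unfold_locales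
  interpret F: critical_asymptotics \<kappa> R s \<delta> a \<theta> \<theta>s f
    using th_nonneg rad_th \<theta>s near_\<theta> f_bounded near_f holomorphic_on_subset[OF f_hol ball]
    by unfold_locales
  have bounded_one: "bounded ((\<lambda>_. 1) ` ball (0::complex) R :: complex set)"
    by (intro boundedI[of _ 1]) auto
  have near_one: "\<exists>K d. d > 0 \<and> (\<forall>z\<in>ball 0 R. dist z ?R < d \<longrightarrow> norm (1 - 1 :: complex) \<le> K * norm (1 - z / ?R) powr \<delta>)"
    by (intro exI[of _ 0] exI[of _ 1]) simp
  \<comment> \<open>The statement on H is the case f = 1, u = 0, where the damping factor is 1 for
    every N.\<close>
  interpret one: critical_asymptotics \<kappa> R s \<delta> a \<theta> \<theta>s "\<lambda>_. 1"
    using th_nonneg rad_th \<theta>s near_\<theta> holomorphic_on_const bounded_one near_one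
    by unfold_locales
  have "(\<lambda>N. of_real (H \<theta> \<kappa> N)) \<sim>[at_top]
      (\<lambda>N. complex_of_real (exp (real N * rser \<kappa> R) * (real N * a) powr ((\<theta>s - 1) / s)
          / (s * R ^ N * Gamma ((s - 1 + \<theta>s) / s))))"
    using one.coefficient_asymptotics[of 0] zcoeff_exp_gser[of \<theta> \<kappa>] rad_th rad_ka R_pos
    by (simp add: mult_ac)
  then have "(\<lambda>N. H \<theta> \<kappa> N) \<sim>[at_top] (\<lambda>N. exp (real N * rser \<kappa> R) * (real N * a) powr ((\<theta>s - 1) / s)
          / (s * R ^ N * Gamma ((s - 1 + \<theta>s) / s)))"
    by (rule asymp_equiv_of_real_imp)
  with F.coefficient_asymptotics show ?thesis unfolding S by blast
qed

end
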